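(* Consider the multi-agent system $$\dot z_i=h_i(z_i,y_i,w),\qquad \dot x_i=A_ix_i+B_i[g_i(z_i,x_i,w)+b_i(w)u_i],\qquad y_i=C_ix_i,\qquad i=1,\dots,N,$$ with local costs $f_i:\mathbb{R}\to\mathbb{R}$, digraph $\mathcal{G}$ with weights $a_{ij}$, and compact set $\mathbb{W}$, as set up in the context, and suppose Assumptions 1, 2, 3, 4 (written out in the context) hold. Then there exist positive constants $\alpha,\beta$ and smooth functions $\kappa_i(r_i)$, $\rho_i(\zeta_i,r_i)$, $\tau_i(\zeta_i,r_i)$ ($i=1,\dots,N$) such that the distributed controller $$\begin{aligned} u_i&=-\theta_i\rho_i(\zeta_i,r_i)\zeta_i+\kappa_i(r_i)\eta_i,\\ \dot\eta_i&=-\kappa_i(r_i)\eta_i+u_i,\\ \dot\theta_i&=\tau_i(\zeta_i,r_i),\\ \dot r_i&=-\alpha\nabla f_i(r_i)-\beta\sum_{j=1}^N a_{ij}(r_i-r_j)-\sum_{j=1}^N a_{ij}(v_i-v_j),\\ \dot v_i&=\alpha\beta\sum_{j=1}^N a_{ij}(r_i-r_j) \end{aligned}$$ solves the optimal output consensus problem, i.e., for each $w\in\mathbb{W}$ and each initial condition of $(z_i,x_i,\eta_i,\theta_i,r_i,v_i)$, $i=1,\dots,N$: (a) the trajectory of the closed-loop system exists and is bounded over $[0,+\infty)$; (b) $\lim_{t\to+\infty}|y_i(t)-y^\star|=0$ for every $i$, where $y^\star$ is the optimal solution of $\min_{y\in\mathbb{R}} f(y)=\sum_{i=1}^N f_i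(y)$.
   Context: **Plant.** For agent $i\in\mathcal{N}=\{1,\dots,N\}$: $z_i\in\mathbb{R}^{m_i}$, $x_i=(x_{i1},\dots,x_{in_i})^\top\in\mathbb{R}^{n_i}$, input $u_i\in\mathbb{R}$, output $y_i\in\mathbb{R}$; $w\in\mathbb{W}\subset\mathbb{R}^{n_w}$ is a constant uncertain parameter, $\mathbb{W}$ compact and containing the origin ($\mathbb{W}$ is not necessarily known). $(C_i,A_i,B_i)$ is a chain of $n_i$ integrators: $A_ix_i=(x_{i2},\dots,x_{in_i},0)^\top$, $B_i=(0,\dots,0,1)^\top$, $C_i=(1,0,\dots,0)$. All functions $h_i,g_i,b_i$ are sufficiently smooth, with $h_i(0,0,w)=0$, $g_i(0,0,w)=0$, $b_i(w)\ge b_0>0$ for all $w\in\mathbb{W}$, for some constant $b_0$. **Graph.** $\mathcal{G}=(\mathcal{N},\mathcal{E},\mathcal{A})$ is a weighted digraph, $\mathcal{A}=[a_{ij}]$, $a_{ii}=0$, $a_{ij}\ge0$, and $a_{ij}>0$ iff $(j,i)\in\mathcal{E}$ (agent $i$ gets information from agent $j$). It is weight-balanced if $\sum_j a_{ij}=\sum_j a_{ji}$ for every $i$. **Assumption 1.** $\mathcal{G}$ is weight-balanced and strongly connected. **Assumption 2.** Each $f_i$ is twice continuously differentiable and there are constants $0<\underline{l}_i\le\overline{l}_i<+\infty$ with $\underline{l}_i\le\nabla^2f_i(s)\le\overline{l}_i$ for all $s\in\mathbb{R}$. **Assumption 3.** For each $i$ there is a smooth function $z_i^\star(s,w)$ with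 $z_i^\star(0,w)=0$ and $h_i(z_i^\star(s,w),s,w)=0$ for all $s\in\mathbb{R}$, $w\in\mathbb{R}^{n_w}$. **Error variables.** $x_i^\star(r_i)=(r_i,0,\dots,0)^\top\in\mathbb{R}^{n_i}$, $\bar z_i=z_i-z_i^\star(r_i,w)$, $\bar x_i=x_i-x_i^\star(r_i)$, $e_i=\bar x_{i1}=y_i-r_i$, $\mu_i=\dot r_i$. Then $$\dot{\bar z}_i=\bar h_i(\bar z_i,e_i,r_i,w)-\tfrac{\partial z_i^\star}{\partial r_i}(r_i,w)\,\mu_i,\qquad \bar h_i(\bar z_i,e_i,r_i,w)=h_i(\bar z_i+z_i^\star(r_i,w),e_i+r_i,w)-h_i(z_i^\star(r_i,w),r_i,w).$$ **Assumption 4.** For each $i$ there is a continuously differentiable function $W_{i\bar z}(\bar z_i)$ such that, for all $r_i\in\mathbb{R}$ and $w\in\mathbb{W}$, along the trajectories of the $\bar z_i$-system, $$\underline\alpha_i(\|\bar z_i\|)\le W_{i\bar z}(\bar z_i)\le\overline\alpha_i(\|\bar z_i\|),\qquad \dot W_{i\bar z}\le-\alpha_i(\|\bar z_i\|)+\sigma_{ie}\gamma_{ie}(e_i)e_i^2+\sigma_{i\mu}\gamma_{i\mu}(r_i)\mu_i^2$$ for some known smooth functions $\underline\alpha_i,\overline\alpha_i,\alpha_i\in\mathcal{K}_\infty$, $\gamma_{ie},\gamma_{i\mu}>1$ and unknown constants $\sigma_{ie},\sigma_{i\mu}>1$, with $\limsup_{s\to0+}\alpha_i^{-1}(s^2)/s<+\infty$.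 ("Known" means available for the controller design, "unknown" means only assumed to exist.) A function $[0,\infty)\to[0,\infty)$ is in $\mathcal{K}_\infty$ if it is continuous, strictly increasing, zero at zero and unbounded. **Variable $\zeta_i$ in the controller.** For $n_i\ge2$, constants $k_{i1},\dots,k_{i,n_i-1}$ are chosen such that the polynomial $p_i(\lambda)=\sum_{j=1}^{n_i-1}k_{ij}\lambda^{j-1}+\lambda^{n_i-1}$ is Hurwitz, and $\zeta_i=\sum_{j=1}^{n_i-1}k_{ij}\bar x_{ij}+\bar x_{in_i}$. For $n_i=1$, $\zeta_i=\bar x_{i1}$. The constants $\alpha,\beta$ and functions $\kappa_i,\rho_i,\tau_i$ do not depend on $w$ or on the initial condition. *)

theory Defs
  imports "HOL-Analysis.Analysis" "HOL-Computational_Algebra.Polynomial"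
begin

text \<open>
  Functions of class $C^k$ on a set. The notion is used only for \<open>S = UNIV\<close> and for
  \<open>S = {0..}\<close> in the reals, where derivatives within \<open>S\<close> are unique (one-sided at the
  end point), so that the choice made by \<^const>\<open>frechet_derivative\<close> is immaterial. In finite
  dimension, continuity of all directional derivatives is continuity of the derivative.
\<close>

primrec Ck_on ::
  "nat \<Rightarrow> 'a set \<Rightarrow> ('a::real_normed_vector \<Rightarrow> 'b::real_normed_vector) \<Rightarrow> bool" where
  "Ck_on 0 S f \<longleftrightarrow> continuous_on S f"
| "Ck_on (Suc k) S f \<longleftrightarrow>
     f differentiable_on S \<and> (\<forall>v. Ck_on k S (\<lambda>x. frechet_derivative f (at x within S) v))"

definition smooth_on ::
  "'a set \<Rightarrow> ('a::real_normed_vector \<Rightarrow> 'b::real_normed_vector) \<Rightarrow> bool" where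
  "smooth_on S f \<longleftrightarrow> (\<forall>k. Ck_on k S f)"

definition class_K_inf :: "(real \<Rightarrow> real) \<Rightarrow> bool" where
  "class_K_inf \<phi> \<longleftrightarrow> continuous_on {0..} \<phi> \<and> strict_mono_on {0..} \<phi> \<and> \<phi> 0 = 0
     \<and> \<not> bdd_above (\<phi> ` {0..})"

definition hurwitz :: "real poly \<Rightarrow> bool" where
  "hurwitz p \<longleftrightarrow> (\<forall>s::complex. poly (map_poly of_real p) s = 0 \<longrightarrow> Re s < 0)"

text \<open>
  The state dimensions differ from agent to agent, whereas a type has one dimension. The space
  of real $n$-vectors is therefore represented, for \<open>n \<le> DIM('a)\<close>, by the span of the first
  \<open>n\<close> vectors of an enumeration of the orthonormal basis of an ambient type \<open>'a\<close>; the \<open>j\<close>-th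
  coordinate of \<open>x\<close> is \<open>x \<bullet> unit_vec j\<close> (\<open>j\<close> starting at 1). A $C^k$ function on such a
  subspace is represented by a $C^k$ function on the ambient type, of which only the values on
  the subspace are used; this is no restriction, since precomposition with the orthogonal
  projection extends every $C^k$ function on the subspace.
\<close>

definition unit_vec :: "nat \<Rightarrow> 'a::euclidean_space" where
  "unit_vec = (SOME e. bij_betw e {1..DIM('a)} Basis)"

definition Rspace :: "nat \<Rightarrow> 'a::euclidean_space set" where
  "Rspace n = span (unit_vec ` {1..n})"

lemma bij_betw_unit_vec: "bij_betw (unit_vec :: nat \<Rightarrow> 'a::euclidean_space) {1..DIM('a)} Basis"
proof -
  have "\<exists>e :: nat \<Rightarrow> 'a. bij_betw e {1..DIM('a)} Basis"
    using ex_bij_betw_nat_finite_1[of "Basis :: 'a set"] by simp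
  then show ?thesis
    unfolding unit_vec_def by (rule someI_ex)
qed

lemma dim_Rspace:
  assumes "n \<le> DIM('a::euclidean_space)"
  shows "dim (Rspace n :: 'a set) = n"
proof -
  have sub: "{1..n} \<subseteq> {1..DIM('a)}"
    using assms by auto
  have inj: "inj_on (unit_vec :: nat \<Rightarrow> 'a) {1..n}"
    using bij_betw_unit_vec sub by (metis bij_betw_def inj_on_subset)
  have "(unit_vec :: nat \<Rightarrow> 'a) ` {1..n} \<subseteq> Basis"
    using bij_betw_unit_vec sub by (metis bij_betw_def image_mono)
  then have "independent ((unit_vec :: nat \<Rightarrow> 'a) ` {1..n})"
    using independent_Basis independent_mono by blast
  then have "dim (Rspace n :: 'a set) = card ((unit_vec :: nat \<Rightarrow> 'a) ` {1..n})"
    unfolding Rspace_def by (simp add: dim_eq_card_independent)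
  also have "\<dots> = n"
    using inj by (simp add: card_image)
  finally show ?thesis .
qed

definition chain_A :: "nat \<Rightarrow> 'a::euclidean_space \<Rightarrow> 'a" where
  "chain_A n x = (\<Sum>j = 1..<n. (x \<bullet> unit_vec (j + 1)) *\<^sub>R unit_vec j)"

definition chain_B :: "nat \<Rightarrow> 'a::euclidean_space" where
  "chain_B n = unit_vec n"

definition chain_C :: "'a::euclidean_space \<Rightarrow> real" where
  "chain_C x = x \<bullet> unit_vec 1"

definition xbar :: "'x::euclidean_space \<Rightarrow> real \<Rightarrow> 'x" where
  "xbar x r = x - r *\<^sub>R unit_vec 1"

text \<open>For \<open>n = 1\<close> the sums below are empty: \<open>zeta_poly\<close> is the constant 1, which is trivially
  Hurwitz, and \<open>zeta\<close> is the first coordinate of \<open>xbar x r\<close>.\<close>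

definition zeta_poly :: "nat \<Rightarrow> (nat \<Rightarrow> real) \<Rightarrow> real poly" where
  "zeta_poly n k = (\<Sum>j = 1..n - 1. monom (k j) (j - 1)) + monom 1 (n - 1)"

definition zeta :: "nat \<Rightarrow> (nat \<Rightarrow> real) \<Rightarrow> 'x::euclidean_space \<Rightarrow> real \<Rightarrow> real" where
  "zeta n k x r =
     (\<Sum>j = 1..n - 1. k j * (xbar x r \<bullet> unit_vec j)) + xbar x r \<bullet> unit_vec n"

definition hbar ::
  "('z::euclidean_space \<Rightarrow> real \<Rightarrow> 'w \<Rightarrow> 'z) \<Rightarrow> (real \<Rightarrow> 'w \<Rightarrow> 'z) \<Rightarrow> 'z \<Rightarrow> real \<Rightarrow> real \<Rightarrow> 'w \<Rightarrow> 'z"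
where
  "hbar h zs zb e r w = h (zb + zs r w) (e + r) w - h (zs r w) r w"

text \<open>
  The derivative of the Lyapunov function \<open>V\<close> along the trajectories of the error system is
  its derivative in the direction of the vector field, required for all values of the inputs
  \<open>e\<close> and \<open>\<mu>\<close>. The comparison functions are arguments (known), whereas \<open>V\<close> and the
  gains \<open>\<sigma>e\<close>, \<open>\<sigma>\<mu>\<close> are merely asserted to exist (unknown).
\<close>

definition iss_inverse_dynamics ::
  "nat \<Rightarrow> ('z::euclidean_space \<Rightarrow> real \<Rightarrow> 'w \<Rightarrow> 'z) \<Rightarrow> (real \<Rightarrow> 'w \<Rightarrow> 'z)
    \<Rightarrow> (real \<Rightarrow> real) \<Rightarrow> (real \<Rightarrow> real) \<Rightarrow> (real \<Rightarrow> real) \<Rightarrow> (real \<Rightarrow> real) \<Rightarrow> (real \<Rightarrow> real)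
    \<Rightarrow> 'w set \<Rightarrow> bool" where
  "iss_inverse_dynamics m h zs \<alpha>lo \<alpha>up \<alpha>d \<gamma>e \<gamma>\<mu> W \<longleftrightarrow>
     (\<exists>(V :: 'z \<Rightarrow> real) \<sigma>e \<sigma>\<mu>. Ck_on 1 UNIV V \<and> \<sigma>e > 1 \<and> \<sigma>\<mu> > 1
       \<and> (\<forall>zb \<in> Rspace m. \<alpha>lo (norm zb) \<le> V zb \<and> V zb \<le> \<alpha>up (norm zb))
       \<and> (\<forall>zb \<in> Rspace m. \<forall>e r \<mu>. \<forall>w \<in> W.
            frechet_derivative V (at zb)
              (hbar h zs zb e r w - \<mu> *\<^sub>R vector_derivative (\<lambda>s. zs s w) (at r))
            \<le> - \<alpha>d (norm zb) + \<sigma>e * \<gamma>e e * e\<^sup>2 + \<sigma>\<mu> * \<gamma>\<mu> r * \<mu>\<^sup>2))"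

text \<open>Solutions on the whole half-line; at time 0 the derivatives are one-sided. The plant states
  \<open>z i\<close>, \<open>x i\<close> are required to live in the state spaces of agent \<open>i\<close>.\<close>

definition closed_loop_solution ::
  "('n::finite \<Rightarrow> nat) \<Rightarrow> ('n \<Rightarrow> nat)
    \<Rightarrow> ('n \<Rightarrow> 'z::euclidean_space \<Rightarrow> real \<Rightarrow> 'w \<Rightarrow> 'z)
    \<Rightarrow> ('n \<Rightarrow> 'z \<Rightarrow> 'x::euclidean_space \<Rightarrow> 'w \<Rightarrow> real) \<Rightarrow> ('n \<Rightarrow> 'w \<Rightarrow> real)
    \<Rightarrow> ('n \<Rightarrow> real \<Rightarrow> real) \<Rightarrow> ('n \<Rightarrow> 'n \<Rightarrow> real) \<Rightarrow> ('n \<Rightarrow> nat \<Rightarrow> real)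
    \<Rightarrow> real \<Rightarrow> real \<Rightarrow> ('n \<Rightarrow> real \<Rightarrow> real) \<Rightarrow> ('n \<Rightarrow> real \<Rightarrow> real \<Rightarrow> real)
    \<Rightarrow> ('n \<Rightarrow> real \<Rightarrow> real \<Rightarrow> real) \<Rightarrow> 'w
    \<Rightarrow> ('n \<Rightarrow> real \<Rightarrow> 'z) \<Rightarrow> ('n \<Rightarrow> real \<Rightarrow> 'x) \<Rightarrow> ('n \<Rightarrow> real \<Rightarrow> real) \<Rightarrow> ('n \<Rightarrow> real \<Rightarrow> real)
    \<Rightarrow> ('n \<Rightarrow> real \<Rightarrow> real) \<Rightarrow> ('n \<Rightarrow> real \<Rightarrow> real) \<Rightarrow> bool" where
  "closed_loop_solution m n h g b f a k \<alpha> \<beta> \<kappa> \<rho> \<tau> w z x \<eta> \<theta> r v \<longleftrightarrow>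
     (\<forall>i. \<forall>t\<ge>0.
        z i t \<in> Rspace (m i) \<and> x i t \<in> Rspace (n i) \<and>
        (let y = chain_C (x i t);
             \<zeta> = zeta (n i) (k i) (x i t) (r i t);
             u = - \<theta> i t * \<rho> i \<zeta> (r i t) * \<zeta> + \<kappa> i (r i t) * \<eta> i t
         in (z i has_vector_derivative h i (z i t) y w) (at t within {0..}) \<and>
            (x i has_vector_derivative
               chain_A (n i) (x i t) + (g i (z i t) (x i t) w + b i w * u) *\<^sub>R chain_B (n i))
              (at t within {0..}) \<and>
            (\<eta> i has_vector_derivative - \<kappa> i (r i t) * \<eta> i t + u) (at t within {0..}) \<and>
            (\<theta> i has_vector_derivative \<tau> i \<zeta> (r i t)) (at t within {0..}) \<and>
            (r i has_vector_derivative
               - \<alpha> * deriv (f i) (r i t) - \<beta> * (\<Sum>j\<in>UNIV. a i j * (r i t - r j t))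
               - (\<Sum>j\<in>UNIV. a i j * (v i t - v j t))) (at t within {0..}) \<and>
            (v i has_vector_derivative
               \<alpha> * \<beta> * (\<Sum>j\<in>UNIV. a i j * (r i t - r j t))) (at t within {0..})))"

end

theory Submission
  imports Defs "HOL-Computational_Algebra.Fundamental_Theorem_Algebra"
begin

text \<open>
  With \<open>\<kappa> = 1\<close> the internal model satisfies \<open>\<eta>' = - \<theta> \<rho>(\<zeta>) \<zeta>\<close>, i.e. it is an integrator that can supply any
  constant steady-state input. The reference generator is autonomous and converges exponentially for
  \<open>\<alpha> = 1\<close> and large \<open>\<beta>\<close>, so each agent may be studied separately, in error coordinates relative to the
  constant \<open>y\<^sup>\<star>\<close> instead of \<open>r\<^sub>i\<close>; the mismatch \<open>r\<^sub>i - y\<^sup>\<star>\<close> and \<open>\<mu>\<^sub>i = r\<^sub>i'\<close> are bounded and square integrable.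

  Since the constants of the problem are unknown but fixed along a trajectory, one only needs a known
  function \<open>H\<close> with \<open>\<bar>\<zeta>' + b \<theta> \<rho>(\<zeta>) \<zeta>\<bar> \<le> H(C (1 + M))\<close>, where \<open>M\<close> is the running maximum of \<open>\<bar>\<zeta>\<bar>\<close> and \<open>C\<close> is
  unknown. Take for \<open>\<rho>\<close> an entire function with \<open>\<rho>(\<zeta>) \<ge> 1 + H(\<zeta>\<^sup>2)\<close> and \<open>\<theta>' = \<rho>(\<zeta>) \<zeta>\<^sup>2\<close>. Whenever \<open>\<bar>\<zeta>\<bar>\<close> reaches a
  new maximum above 1, \<open>(\<zeta>\<^sup>2/2)' \<le> (A - b \<theta>) \<theta>'\<close>, and \<open>(A - b \<theta>)\<^sup>+\<close> has a finite integral in \<open>\<theta>\<close>; hence \<open>\<zeta>\<close> and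
  all other error states are bounded. On a bounded set every nonlinearity is dominated by a quadratic one
  (here the condition on \<open>\<alpha>\<^sub>i\<close> near 0 enters), so a weighted sum of \<open>\<zeta>\<^sup>2/2 + b \<theta>\<^sup>2/2 - p \<theta>\<close> and the partial Lyapunov
  functions decreases at least at the rate \<open>(y\<^sub>i - y\<^sup>\<star>)\<^sup>2\<close>. This bounds \<open>\<theta>\<close> and yields convergence. All bounds
  are uniform in the length of the time interval, which gives global existence.
\<close>

section \<open>Scalar comparison arguments\<close>

text \<open>The order of quantifiers shapes the proof: the gain is fixed before \<open>w\<close>,
  the initial condition and the unknown \<open>V\<close>, \<sigma>, \<open>b\<close>. All of these
  enter the growth bound through one number C, and the estimate H(2 C |\<zeta>|) <= H(4 C^2) +
  H(\<zeta>^2) trades the unknown C inside H for an unknown factor in front of a known function,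
  which is what the adaptive gain \<theta> can overcome. The obstacle is that \<theta> is a priori
  unbounded and appears in the equations of both \<zeta> and \<eta>. In \<eta> - \<zeta>/b the two
  terms with \<theta> cancel, so this combination, z and x are bounded through \<zeta> and the
  reference signals alone. Hence \<zeta> is bounded before anything is known about \<theta>, and the
  quadratic estimates, whose constants depend on that bound, come afterwards. Measuring errors from
  y* makes the steady-state input and the equilibrium of the inverse dynamics constant, so
  Assumption 4 is applied at r = y* and \<mu> = 0. The price is the mismatch between r and y*, which
  the Lyapunov function of the reference generator pays for.\<close>

lemma has_real_derivative_within_atLeast:
  fixes f :: "real \<Rightarrow> real"
  assumes "(f has_real_derivative D) (at t within {0..})" "0 < t"
  shows "(f has_real_derivative D) (at t)"
proof -
  have "{0<..} \<subseteq> {0::real..}" by auto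
  then show ?thesis using assms at_within_open_subset[of t "{0<..}" "{0..}"] by simp
qed

lemma continuous_on_Icc_of_derivative:
  fixes f f' :: "real \<Rightarrow> real"
  assumes "\<And>t. 0 \<le> t \<Longrightarrow> t \<le> T \<Longrightarrow> (f has_real_derivative f' t) (at t within {0..})"
  shows "continuous_on {0..T} f"
  unfolding continuous_on_eq_continuous_within
proof
  fix t assume "t \<in> {0..T}"
  then have "(f has_real_derivative f' t) (at t within {0..T})"
    using DERIV_subset[OF assms[of t], of "{0..T}"] by auto
  then show "continuous (at t within {0..T}) f"
    by (rule DERIV_continuous)
qed

lemma nonincreasing_of_derivative_nonpos:
  fixes f f' :: "real \<Rightarrow> real"
  assumes der: "\<And>t. 0 \<le> t \<Longrightarrow> t \<le> T \<Longrightarrow> (f has_real_derivative f' t) (at t within {0..})"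
    and st: "0 \<le> s" "s \<le> t" "t \<le> T"
    and le: "\<And>u. s < u \<Longrightarrow> u < t \<Longrightarrow> f' u \<le> 0"
  shows "f t \<le> f s"
proof (rule DERIV_nonpos_imp_decreasing_open[of s t f])
  show "s \<le> t" by fact
  show "\<exists>y. (f has_real_derivative y) (at u) \<and> y \<le> 0" if "s < u" "u < t" for u
    using has_real_derivative_within_atLeast[OF der[of u]] le[OF that] that st by auto
  show "continuous_on {s..t} f"
    using continuous_on_Icc_of_derivative[OF der] by (rule continuous_on_subset) (use st in auto)
qed

text \<open>After the last time at which f is at most B, it stays above B and therefore cannot
  increase.\<close>

lemma barrier_le:
  fixes f f' :: "real \<Rightarrow> real"
  assumes der: "\<And>t. 0 \<le> t \<Longrightarrow> t \<le> T \<Longrightarrow> (f has_real_derivative f' t) (at t within {0..})"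
    and init: "f 0 \<le> B"
    and neg: "\<And>t. 0 \<le> t \<Longrightarrow> t \<le> T \<Longrightarrow> B < f t \<Longrightarrow> f' t \<le> 0"
    and t: "0 \<le> t" "t \<le> T"
  shows "f t \<le> B"
proof (rule ccontr)
  assume "\<not> f t \<le> B"
  then have gt: "B < f t" by simp
  have cont: "continuous_on {0..t} f"
    using continuous_on_Icc_of_derivative[OF der] by (rule continuous_on_subset) (use t in auto)
  define S where "S = {s \<in> {0..t}. f s \<le> B}"
  have cl: "closed S"
    unfolding S_def by (rule continuous_on_closed_Collect_le) (use cont in auto)
  have ne: "S \<noteq> {}" using init t by (auto simp: S_def)
  have bdd: "bdd_above S" by (auto simp: S_def bdd_above_def)
  define s where "s = Sup S"
  have sS: "s \<in> S" unfolding s_def using closed_contains_Sup[OF ne bdd cl] .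
  have up: "B < f u" if "s < u" "u \<le> t" for u
  proof (rule ccontr)
    assume "\<not> B < f u"
    then have "u \<in> S" using that sS by (auto simp: S_def)
    then have "u \<le> s" unfolding s_def using bdd by (rule cSup_upper)
    then show False using that by simp
  qed
  have "f t \<le> f s"
    by (rule nonincreasing_of_derivative_nonpos[OF der])
      (use sS t up neg in \<open>auto simp: S_def\<close>)
  then show False using sS gt by (auto simp: S_def)
qed

text \<open>In contrast to \<open>barrier_le\<close>, the sign condition is asked only at the first
  time the level is reached, where the whole past may be used. A negative derivative there makes f
  larger just before, a contradiction. This form fits bounds that depend on a running
  maximum.\<close>

lemma first_crossing:
  fixes f f' :: "real \<Rightarrow> real"
  assumes der: "\<And>t. 0 \<le> t \<Longrightarrow> t \<le> T \<Longrightarrow> (f has_real_derivative f' t) (at t within {0..})"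
    and init: "f 0 < B"
    and neg: "\<And>s. 0 < s \<Longrightarrow> s \<le> T \<Longrightarrow> f s = B \<Longrightarrow> (\<And>u. 0 \<le> u \<Longrightarrow> u < s \<Longrightarrow> f u < B) \<Longrightarrow> f' s < 0"
    and t: "0 \<le> t" "t \<le> T"
  shows "f t < B"
proof (rule ccontr)
  assume "\<not> f t < B"
  then have ge: "B \<le> f t" by simp
  have cont: "continuous_on {0..t} f"
    using continuous_on_Icc_of_derivative[OF der] by (rule continuous_on_subset) (use t in auto)
  define S where "S = {s \<in> {0..t}. B \<le> f s}"
  have cl: "closed S"
    unfolding S_def by (rule continuous_on_closed_Collect_le) (use cont in auto)
  have ne: "S \<noteq> {}" using ge t by (auto simp: S_def)
  have bdd: "bdd_below S" by (auto simp: S_def bdd_below_def)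
  define s where "s = Inf S"
  have sS: "s \<in> S" unfolding s_def using closed_contains_Inf[OF ne bdd cl] .
  have lo: "f u < B" if "0 \<le> u" "u < s" for u
  proof (rule ccontr)
    assume "\<not> f u < B"
    then have "u \<in> S" using that sS by (auto simp: S_def)
    then have "s \<le> u" unfolding s_def using bdd by (rule cInf_lower)
    then show False using that by simp
  qed
  have s0: "0 < s" using sS init by (cases "s = 0") (auto simp: S_def)
  have sT: "s \<le> T" using sS t by (auto simp: S_def)
  have "f s = B"
  proof (rule ccontr)
    assume "f s \<noteq> B"
    then have "B < f s" using sS by (auto simp: S_def)
    moreover have "continuous_on {0..s} f"
      using cont by (rule continuous_on_subset) (use sS in \<open>auto simp: S_def\<close>)
    ultimately obtain u where u: "0 \<le> u" "u \<le> s" "f u = B"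
      using IVT'[of f 0 B s] init s0 by auto
    then show False using lo[of u] \<open>f s \<noteq> B\<close> by (cases "u = s") auto
  qed
  then have neg': "f' s < 0" using neg[of s] s0 sT lo by auto
  have "(f has_real_derivative f' s) (at s)"
    using has_real_derivative_within_atLeast[OF der] s0 sT by auto
  from DERIV_neg_dec_left[OF this neg'] obtain d where
    d: "d > 0" "\<And>h. h > 0 \<Longrightarrow> h < d \<Longrightarrow> f s < f (s - h)" by auto
  \<comment> \<open>The minimum with \<open>s\<close> keeps \<open>s - h\<close> in the time
    interval.\<close>
  define h where "h = min (d/2) s"
  have "h > 0" "h < d" "h \<le> s" using d s0 by (auto simp: h_def)
  then show False using d(2)[of h] lo[of "s - h"] \<open>f s = B\<close> by auto
qed

text \<open>A variant of Barbalat's lemma: whenever |\<phi>| reaches \<epsilon>, the Lipschitz bound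
  keeps it above \<epsilon>/2 for a time \<open>h\<close>, which costs W the fixed amount
  \<open>c\<close>. Once W is within \<open>c\<close> of its infimum, this cannot happen any
  more.\<close>

lemma tendsto_0_of_decrease:
  fixes W W' \<phi> \<phi>' :: "real \<Rightarrow> real"
  assumes W: "\<And>t. 0 \<le> t \<Longrightarrow> (W has_real_derivative W' t) (at t within {0..})"
    and W': "\<And>t. 0 \<le> t \<Longrightarrow> W' t \<le> - (\<phi> t)\<^sup>2"
    and low: "\<And>t. 0 \<le> t \<Longrightarrow> B \<le> W t"
    and lip: "\<And>s t. 0 \<le> s \<Longrightarrow> s \<le> t \<Longrightarrow> \<bar>\<phi> t - \<phi> s\<bar> \<le> K * (t - s)"
  shows "(\<phi> \<longlongrightarrow> 0) at_top"
proof (rule tendstoI)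
  fix \<epsilon> :: real assume \<epsilon>: "0 < \<epsilon>"
  \<comment> \<open>So short that \<phi> moves by at most \<epsilon>/2; the \<open>+ 1\<close>
    covers K = 0.\<close>
  define h where "h = \<epsilon> / (2 * (\<bar>K\<bar> + 1))"
  have h: "h > 0" "\<bar>K\<bar> * h \<le> \<epsilon> / 2"
    using \<epsilon> by (auto simp: h_def field_simps)
  have anti: "W t \<le> W s" if "0 \<le> s" "s \<le> t" for s t
  proof (rule nonincreasing_of_derivative_nonpos[where f = W and f' = W' and T = t])
    show "W' u \<le> 0" if "s < u" "u < t" for u
      using W'[of u] that \<open>0 \<le> s\<close> by (smt (verit) zero_le_power2)
  qed (use that W in auto)
  define c where "c = h * (\<epsilon>/2)\<^sup>2"
  have c: "c > 0" using h \<epsilon> by (auto simp: c_def)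
  define I where "I = Inf (W ` {0..})"
  have bdd: "bdd_below (W ` {0..})" using low by (auto simp: bdd_below_def)
  have "I < I + c" using c by simp
  then obtain t0 where t0: "0 \<le> t0" "W t0 < I + c"
    unfolding I_def using cInf_lessD[of "W ` {0..}" "Inf (W ` {0..}) + c"] by fastforce
  have "dist (\<phi> t) 0 < \<epsilon>" if "t0 \<le> t" for t
  proof (rule ccontr)
    assume "\<not> dist (\<phi> t) 0 < \<epsilon>"
    then have big: "\<epsilon> \<le> \<bar>\<phi> t\<bar>" by simp
    have big': "(\<epsilon>/2)\<^sup>2 \<le> (\<phi> u)\<^sup>2" if "t \<le> u" "u \<le> t + h" for u
    proof -
      have "\<bar>\<phi> u - \<phi> t\<bar> \<le> K * (u - t)" using lip[of t u] that t0 \<open>t0 \<le> t\<close> by auto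
      also have "\<dots> \<le> \<bar>K\<bar> * h" using that by (intro mult_mono) auto
      finally have "\<epsilon>/2 \<le> \<bar>\<phi> u\<bar>" using h big by linarith
      then show ?thesis using power_mono[of "\<epsilon>/2" "\<bar>\<phi> u\<bar>" 2] \<epsilon> by simp
    qed
    have "W (t + h) + (\<epsilon>/2)\<^sup>2 * (t + h) \<le> W t + (\<epsilon>/2)\<^sup>2 * t"
    proof (rule nonincreasing_of_derivative_nonpos
        [where f' = "\<lambda>u. W' u + (\<epsilon>/2)\<^sup>2" and T = "t + h" and f = "\<lambda>u. W u + (\<epsilon>/2)\<^sup>2 * u"])
      fix u :: real assume "0 \<le> u"
      then show "((\<lambda>u. W u + (\<epsilon>/2)\<^sup>2 * u) has_real_derivative W' u + (\<epsilon>/2)\<^sup>2) (at u within {0..})"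
        using W[of u] by (auto intro!: derivative_eq_intros)
    next
      fix u :: real assume "t < u" "u < t + h"
      then show "W' u + (\<epsilon>/2)\<^sup>2 \<le> 0" using W'[of u] big'[of u] t0 \<open>t0 \<le> t\<close> by auto
    qed (use t0 that h in auto)
    then have "W (t + h) + c \<le> W t" by (simp add: c_def algebra_simps)
    moreover have "W t \<le> W t0" using anti[of t0 t] t0 that by auto
    moreover have "I \<le> W (t + h)" unfolding I_def
      by (rule cInf_lower) (use bdd t0 that h in auto)
    ultimately show False using t0 by linarith
  qed
  then show "\<forall>\<^sub>F t in at_top. dist (\<phi> t) 0 < \<epsilon>"
    using eventually_at_top_linorder by blast
qed

section \<open>Locally Lipschitz maps\<close>

text \<open>Balls around the origin replace neighbourhoods of points. In finite dimension this is
  the same notion, but it yields bounds on balls at once and is closed under composition without a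
  compactness argument.\<close>

definition loc_lip :: "('a::real_normed_vector \<Rightarrow> 'b::real_normed_vector) \<Rightarrow> bool" where
  "loc_lip f \<longleftrightarrow>
    (\<forall>R. \<exists>L. \<forall>x y. norm x \<le> R \<longrightarrow> norm y \<le> R \<longrightarrow> norm (f x - f y) \<le> L * norm (x - y))"

lemma loc_lipD:
  assumes "loc_lip f"
  obtains L where "L \<ge> 0" "\<And>x y. norm x \<le> R \<Longrightarrow> norm y \<le> R \<Longrightarrow> norm (f x - f y) \<le> L * norm (x - y)"
proof -
  obtain L where L: "\<And>x y. norm x \<le> R \<Longrightarrow> norm y \<le> R \<Longrightarrow> norm (f x - f y) \<le> L * norm (x - y)"
    using assms unfolding loc_lip_def by blast
  have "norm (f x - f y) \<le> \<bar>L\<bar> * norm (x - y)" if "norm x \<le> R" "norm y \<le> R" for x y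
    using L[OF that] by (smt (verit) mult_right_mono norm_ge_zero)
  then show ?thesis using that[of "\<bar>L\<bar>"] by auto
qed

lemma loc_lip_bounded:
  assumes "loc_lip f"
  obtains B where "B \<ge> 0" "\<And>x. norm x \<le> R \<Longrightarrow> norm (f x) \<le> B"
proof -
  obtain L where L: "L \<ge> 0" "\<And>x y. norm x \<le> \<bar>R\<bar> \<Longrightarrow> norm y \<le> \<bar>R\<bar> \<Longrightarrow> norm (f x - f y) \<le> L * norm (x - y)"
    using loc_lipD[OF assms] by blast
  have "norm (f x) \<le> norm (f 0) + L * \<bar>R\<bar>" if "norm x \<le> R" for x
  proof -
    have "norm (f x - f 0) \<le> L * norm (x - 0)" using L(2)[of x 0] that by auto
    also have "\<dots> \<le> L * \<bar>R\<bar>" using that L(1) by (intro mult_left_mono) auto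
    finally show ?thesis using norm_triangle_ineq2[of "f x" "f 0"] by linarith
  qed
  then show ?thesis using that[of "norm (f 0) + L * \<bar>R\<bar>"] L(1) by auto
qed

lemma loc_lip_linear: "bounded_linear f \<Longrightarrow> loc_lip f"
  unfolding loc_lip_def
proof
  fix R
  assume f: "bounded_linear f"
  obtain K where "\<And>x. norm (f x) \<le> norm x * K" using bounded_linear.bounded[OF f] by blast
  then have "norm (f x - f y) \<le> K * norm (x - y)" for x y
    using linear_diff[OF bounded_linear.linear[OF f]] by (metis mult.commute)
  then show "\<exists>L. \<forall>x y. norm x \<le> R \<longrightarrow> norm y \<le> R \<longrightarrow> norm (f x - f y) \<le> L * norm (x - y)"
    by blast
qed

lemma loc_lip_compose:
  assumes "loc_lip g" "loc_lip f" shows "loc_lip (\<lambda>x. g (f x))"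
  unfolding loc_lip_def
proof
  fix R
  obtain L where L: "L \<ge> 0" "\<And>x y. norm x \<le> R \<Longrightarrow> norm y \<le> R \<Longrightarrow> norm (f x - f y) \<le> L * norm (x - y)"
    using loc_lipD[OF assms(2)] by blast
  obtain B where B: "\<And>x. norm x \<le> R \<Longrightarrow> norm (f x) \<le> B"
    using loc_lip_bounded[OF assms(2)] by blast
  obtain L' where L': "L' \<ge> 0" "\<And>x y. norm x \<le> B \<Longrightarrow> norm y \<le> B \<Longrightarrow> norm (g x - g y) \<le> L' * norm (x - y)"
    using loc_lipD[OF assms(1)] by blast
  have "norm (g (f x) - g (f y)) \<le> (L' * L) * norm (x - y)" if "norm x \<le> R" "norm y \<le> R" for x y
    using L'(2)[OF B[OF that(1)] B[OF that(2)]] mult_left_mono[OF L(2)[OF that] L'(1)]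
    by (simp add: mult.assoc)
  then show "\<exists>L. \<forall>x y. norm x \<le> R \<longrightarrow> norm y \<le> R \<longrightarrow> norm (g (f x) - g (f y)) \<le> L * norm (x - y)"
    by blast
qed

lemma loc_lip_Pair:
  assumes "loc_lip f" "loc_lip g" shows "loc_lip (\<lambda>x. (f x, g x))"
  unfolding loc_lip_def
proof
  fix R
  obtain L where L: "L \<ge> 0" "\<And>x y. norm x \<le> R \<Longrightarrow> norm y \<le> R \<Longrightarrow> norm (f x - f y) \<le> L * norm (x - y)"
    using loc_lipD[OF assms(1)] by blast
  obtain M where M: "M \<ge> 0" "\<And>x y. norm x \<le> R \<Longrightarrow> norm y \<le> R \<Longrightarrow> norm (g x - g y) \<le> M * norm (x - y)"
    using loc_lipD[OF assms(2)] by blast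
  have "norm ((f x, g x) - (f y, g y)) \<le> (L + M) * norm (x - y)" if "norm x \<le> R" "norm y \<le> R" for x y
    using L(2)[OF that] M(2)[OF that] norm_Pair_le[of "f x - f y" "g x - g y"]
    by (simp add: algebra_simps)
  then show "\<exists>L. \<forall>x y. norm x \<le> R \<longrightarrow> norm y \<le> R \<longrightarrow> norm ((f x, g x) - (f y, g y)) \<le> L * norm (x - y)"
    by blast
qed

lemma loc_lip_bilinear:
  assumes bil: "bounded_bilinear p" and f: "loc_lip f" and g: "loc_lip g"
  shows "loc_lip (\<lambda>x. p (f x) (g x))"
  unfolding loc_lip_def
proof
  fix R
  obtain L where L: "L \<ge> 0" "\<And>x y. norm x \<le> R \<Longrightarrow> norm y \<le> R \<Longrightarrow> norm (f x - f y) \<le> L * norm (x - y)"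
    using loc_lipD[OF f] by blast
  obtain M where M: "M \<ge> 0" "\<And>x y. norm x \<le> R \<Longrightarrow> norm y \<le> R \<Longrightarrow> norm (g x - g y) \<le> M * norm (x - y)"
    using loc_lipD[OF g] by blast
  obtain B where B: "B \<ge> 0" "\<And>x. norm x \<le> R \<Longrightarrow> norm (f x) \<le> B"
    using loc_lip_bounded[OF f] by blast
  obtain C where C: "C \<ge> 0" "\<And>x. norm x \<le> R \<Longrightarrow> norm (g x) \<le> C"
    using loc_lip_bounded[OF g] by blast
  obtain K where K: "K > 0" "\<And>a b. norm (p a b) \<le> norm a * norm b * K"
    using bounded_bilinear.pos_bounded[OF bil] by blast
  have "norm (p (f x) (g x) - p (f y) (g y)) \<le> (B * M * K + L * C * K) * norm (x - y)"
    if "norm x \<le> R" "norm y \<le> R" for x y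
  proof -
    have "p (f x) (g x) - p (f y) (g y) = p (f x) (g x - g y) + p (f x - f y) (g y)"
      by (simp add: bounded_bilinear.diff_left[OF bil] bounded_bilinear.diff_right[OF bil])
    then have "norm (p (f x) (g x) - p (f y) (g y))
        \<le> norm (f x) * norm (g x - g y) * K + norm (f x - f y) * norm (g y) * K"
      using norm_triangle_ineq[of "p (f x) (g x - g y)" "p (f x - f y) (g y)"]
        K(2)[of "f x" "g x - g y"] K(2)[of "f x - f y" "g y"] by simp
    also have "\<dots> \<le> B * (M * norm (x - y)) * K + (L * norm (x - y)) * C * K"
      using K B C M L that by (intro add_mono mult_mono) auto
    finally show ?thesis by (simp add: algebra_simps)
  qed
  then show "\<exists>L. \<forall>x y. norm x \<le> R \<longrightarrow> norm y \<le> R \<longrightarrow>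
      norm (p (f x) (g x) - p (f y) (g y)) \<le> L * norm (x - y)" by blast
qed

lemma loc_lip_const: "loc_lip (\<lambda>x. c)"
  unfolding loc_lip_def by (auto intro!: exI[of _ 0])

lemma loc_lip_add: "loc_lip f \<Longrightarrow> loc_lip g \<Longrightarrow> loc_lip (\<lambda>x. f x + g x)"
  using loc_lip_compose[OF loc_lip_linear[OF bounded_linear_add[OF bounded_linear_fst bounded_linear_snd]]
      loc_lip_Pair[of f g]] by simp

lemma loc_lip_diff: "loc_lip f \<Longrightarrow> loc_lip g \<Longrightarrow> loc_lip (\<lambda>x. f x - g x)"
  using loc_lip_compose[OF loc_lip_linear[OF bounded_linear_sub[OF bounded_linear_fst bounded_linear_snd]]
      loc_lip_Pair[of f g]] by simp

lemma loc_lip_minus: "loc_lip f \<Longrightarrow> loc_lip (\<lambda>x. - f x)"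
  using loc_lip_diff[OF loc_lip_const[of 0], of f] by simp

lemma loc_lip_sum: "(\<And>i. i \<in> I \<Longrightarrow> loc_lip (f i)) \<Longrightarrow> loc_lip (\<lambda>x. \<Sum>i\<in>I. f i x)"
  by (induction I rule: infinite_finite_induct) (auto intro: loc_lip_add loc_lip_const)

lemma loc_lip_vec:
  fixes f :: "'n::finite \<Rightarrow> 'a::real_normed_vector \<Rightarrow> 'b::euclidean_space"
  assumes "\<And>i. loc_lip (f i)" shows "loc_lip (\<lambda>x. \<chi> i. f i x)"
proof -
  have "(\<lambda>x. \<chi> i. f i x) = (\<lambda>x. \<Sum>i\<in>UNIV. axis i (f i x))"
    by (auto simp: vec_eq_iff axis_def if_distrib cong: if_cong)
  moreover have "loc_lip (\<lambda>x. axis i (f i x))" for i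
  proof (rule loc_lip_compose[OF loc_lip_linear assms])
    show "bounded_linear (axis i :: 'b \<Rightarrow> _)"
      unfolding linear_conv_bounded_linear[symmetric]
      by (rule linearI) (simp_all add: axis_def vec_eq_iff)
  qed
  ultimately show ?thesis using loc_lip_sum[of UNIV "\<lambda>i x. axis i (f i x)"] by simp
qed

text \<open>Only directional derivatives are known to be continuous; on a closed ball each basis
  direction has a bound, and the sum of these bounds the operator norm. The mean value inequality on
  the convex ball then applies.\<close>

lemma loc_lip_Ck1:
  fixes f :: "'a::euclidean_space \<Rightarrow> 'b::real_normed_vector"
  assumes "Ck_on 1 UNIV f"
  shows "loc_lip f"
  unfolding loc_lip_def
proof
  fix R
  let ?D = "\<lambda>x. frechet_derivative f (at x)"
  have diff: "(f has_derivative ?D x) (at x)" for x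
    using assms by (auto simp: frechet_derivative_works[symmetric] differentiable_on_def)
  have cont: "continuous_on UNIV (\<lambda>x. ?D x v)" for v
    using assms by (auto simp: )
  have "\<exists>B. \<forall>x. norm x \<le> R \<longrightarrow> norm (?D x v) \<le> B" for v
  proof -
    have "compact ((\<lambda>x. ?D x v) ` cball 0 R)"
      by (intro compact_continuous_image continuous_on_subset[OF cont]) auto
    from compact_imp_bounded[OF this] obtain B where
      "\<forall>x\<in>cball 0 R. norm (?D x v) \<le> B" by (auto simp: bounded_iff)
    then show ?thesis by (intro exI[of _ B]) auto
  qed
  then obtain B where B: "\<And>v x. norm x \<le> R \<Longrightarrow> norm (?D x v) \<le> B v" by metis
  have on: "onorm (?D x) \<le> (\<Sum>b\<in>Basis. B b)" if "norm x \<le> R" for x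
  proof (rule onorm_le)
    fix v
    interpret linear "?D x" using diff has_derivative_linear by blast
    have "?D x v = ?D x (\<Sum>b\<in>Basis. (v \<bullet> b) *\<^sub>R b)" by (simp add: euclidean_representation)
    also have "\<dots> = (\<Sum>b\<in>Basis. (v \<bullet> b) *\<^sub>R ?D x b)" by (simp add: sum scale)
    finally have "norm (?D x v) \<le> (\<Sum>b\<in>Basis. norm ((v \<bullet> b) *\<^sub>R ?D x b))"
      by (metis norm_sum)
    also have "\<dots> \<le> (\<Sum>b\<in>Basis. norm v * B b)"
    proof (rule sum_mono)
      fix b :: 'a assume "b \<in> Basis"
      then show "norm ((v \<bullet> b) *\<^sub>R ?D x b) \<le> norm v * B b"
        using Basis_le_norm[of b v] B[OF that, of b] by (auto intro!: mult_mono)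
    qed
    finally show "norm (?D x v) \<le> (\<Sum>b\<in>Basis. B b) * norm v"
      by (simp add: sum_distrib_left mult.commute)
  qed
  have "norm (f x - f y) \<le> (\<Sum>b\<in>Basis. B b) * norm (x - y)" if "norm x \<le> R" "norm y \<le> R" for x y
    by (rule differentiable_bound[of "cball 0 R" f ?D])
      (use that on diff in \<open>auto intro: has_derivative_at_withinI\<close>)
  then show "\<exists>L. \<forall>x y. norm x \<le> R \<longrightarrow> norm y \<le> R \<longrightarrow> norm (f x - f y) \<le> L * norm (x - y)" by blast
qed

section \<open>Smooth majorants\<close>

lemma Ck_on_const: "Ck_on k UNIV (\<lambda>x. c)"
proof (induction k arbitrary: c)
  case (Suc k)
  have "frechet_derivative (\<lambda>x. c) (at x) = (\<lambda>v. 0)" for x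
    by (rule frechet_derivative_at[symmetric]) simp
  then show ?case using Suc[of 0] by simp
qed simp

text \<open>Generalising over the coefficients closes the induction: the derivative in direction v
  is again such a series, with coefficients \<open>fst v * diffs c n\<close>. The argument is a pair
  because the gains of the controller are functions of (\<zeta>, r).\<close>

lemma Ck_on_entire:
  fixes c :: "nat \<Rightarrow> real"
  assumes "\<And>x. summable (\<lambda>n. c n * x ^ n)"
  shows "Ck_on k UNIV (\<lambda>p::real \<times> real. \<Sum>n. c n * fst p ^ n)"
  using assms
proof (induction k arbitrary: c)
  case 0
  have "continuous_on UNIV (\<lambda>x. \<Sum>n. c n * x ^ n)"
    by (intro continuous_at_imp_continuous_on ballI DERIV_isCont)
      (rule termdiffs_strong_converges_everywhere[OF 0])
  from continuous_on_compose2[OF this, of UNIV fst] show ?case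
    by (simp add: continuous_on_fst)
next
  case (Suc k)
  have der: "((\<lambda>p::real \<times> real. \<Sum>n. c n * fst p ^ n) has_derivative
      (\<lambda>v. (\<Sum>n. (fst v * diffs c n) * fst p ^ n))) (at p)" for p :: "real \<times> real"
  proof -
    have "((\<lambda>x. \<Sum>n. c n * x ^ n) has_field_derivative (\<Sum>n. diffs c n * fst p ^ n)) (at (fst p))"
      by (rule termdiffs_strong_converges_everywhere) (rule Suc.prems)
    then have "((\<lambda>x. \<Sum>n. c n * x ^ n) has_derivative (\<lambda>h. (\<Sum>n. diffs c n * fst p ^ n) * h)) (at (fst p))"
      by (simp add: has_field_derivative_def)
    from has_derivative_compose[OF bounded_linear_imp_has_derivative[OF bounded_linear_fst] this]
    have "((\<lambda>p::real \<times> real. \<Sum>n. c n * fst p ^ n) has_derivative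
      (\<lambda>v. (\<Sum>n. diffs c n * fst p ^ n) * fst v)) (at p)" .
    moreover have "(\<Sum>n. diffs c n * fst p ^ n) * fst v = (\<Sum>n. (fst v * diffs c n) * fst p ^ n)" for v :: "real \<times> real"
      using suminf_mult[OF termdiff_converges_all[OF Suc.prems], of "fst v" "fst p"] by (simp add: ac_simps)
    ultimately show ?thesis by simp
  qed
  have sm: "summable (\<lambda>n. (fst v * diffs c n) * x ^ n)" for v :: "real \<times> real" and x
    using summable_mult[OF termdiff_converges_all[OF Suc.prems], of "fst v" x] by (simp add: ac_simps)
  have "(\<lambda>p::real \<times> real. \<Sum>n. c n * fst p ^ n) differentiable_on UNIV"
    unfolding differentiable_on_def differentiable_def using der by blast
  moreover have "frechet_derivative (\<lambda>p::real \<times> real. \<Sum>n. c n * fst p ^ n) (at p)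
      = (\<lambda>v. (\<Sum>n. (fst v * diffs c n) * fst p ^ n))" for p
    by (rule frechet_derivative_at[symmetric]) (rule der)
  ultimately show ?case
    unfolding Ck_on.simps using Suc.IH[OF sm] by presburger
qed

text \<open>The majorant is a constant plus the sum over i of (x / (i + 1)) ^ \<open>e i\<close>.
  For |x| between i + 2 and i + 3 the i-th term alone is at least ((i + 2) / (i + 1)) ^
  \<open>e i\<close>, which exceeds H(i + 3) once the exponent is large; for fixed x the bases tend
  to 0, so the sum converges everywhere.\<close>

lemma entire_majorant:
  fixes H :: "real \<Rightarrow> real"
  assumes mono: "\<And>s t. 0 \<le> s \<Longrightarrow> s \<le> t \<Longrightarrow> H s \<le> H t"
  obtains c :: "nat \<Rightarrow> real" where "\<And>x. summable (\<lambda>n. c n * x ^ n)"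
    and "\<And>x. H \<bar>x\<bar> \<le> (\<Sum>n. c n * x ^ n)"
proof -
  have "\<exists>N. \<bar>H (real i + 3)\<bar> < ((real i + 2) / (real i + 1)) ^ N" for i
    by (rule real_arch_pow) simp
  then obtain N where N: "\<And>i. \<bar>H (real i + 3)\<bar> < ((real i + 2) / (real i + 1)) ^ N i" by metis
  \<comment> \<open>Strictly increasing, so that the sum is a power series; even, so that no term is
    negative; above \<open>N i\<close> for the majorization; above i for convergence.\<close>
  define e where "e i = 2 * (sum N {..i} + i + 1)" for i
  have e_mono: "strict_mono e" by (rule strict_monoI_Suc) (simp add: e_def)
  have e_N: "N i \<le> e i" for i
    using member_le_sum[of i "{..i}" N] by (simp add: e_def)
  have e_ge: "2 * i \<le> e i" and e_even: "even (e i)" for i by (simp_all add: e_def)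
  define d where "d n = (if n \<in> range e then inverse (real (the_inv e n) + 1) ^ n else 0)" for n
  have d_e: "d (e i) * x ^ e i = (x / (real i + 1)) ^ e i" for i x
    using e_mono by (simp add: d_def the_inv_f_f strict_mono_imp_inj_on field_simps)
  have sum1: "summable (\<lambda>i. (x / (real i + 1)) ^ e i)" for x :: real
  proof (rule summable_comparison_test)
    obtain M where M: "2 * \<bar>x\<bar> \<le> real M" using real_arch_simple by blast
    show "\<exists>M. \<forall>i\<ge>M. norm ((x / (real i + 1)) ^ e i) \<le> (1/2::real) ^ i"
    proof (intro exI allI impI)
      fix i assume "M \<le> i"
      then have "\<bar>x\<bar> / (real i + 1) \<le> 1/2" using M by (simp add: field_simps)
      then have "\<bar>x / (real i + 1)\<bar> ^ e i \<le> (1/2) ^ e i" by (intro power_mono) auto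
      also have "\<dots> \<le> (1/2::real) ^ i" using e_ge[of i] by (intro power_decreasing) auto
      finally show "norm ((x / (real i + 1)) ^ e i) \<le> (1/2::real) ^ i" by (simp add: power_abs)
    qed
  qed (simp add: summable_geometric)
  have sums_d: "(\<lambda>n. d n * x ^ n) sums (\<Sum>i. (x / (real i + 1)) ^ e i)" for x
  proof -
    have "(\<lambda>i. d (e i) * x ^ e i) sums (\<Sum>i. (x / (real i + 1)) ^ e i)"
      unfolding d_e using sum1[of x] by (rule summable_sums)
    then show ?thesis
      by (subst (asm) sums_mono_reindex[OF e_mono]) (auto simp: d_def)
  qed
  \<comment> \<open>The constant term takes care of |x| <= 2, where no term of the sum is
    available.\<close>
  define c where "c n = d n + (if n = 0 then \<bar>H 2\<bar> else 0)" for n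
  have sums_c: "(\<lambda>n. c n * x ^ n) sums ((\<Sum>i. (x / (real i + 1)) ^ e i) + \<bar>H 2\<bar>)" for x
  proof -
    have "(\<lambda>n. (if n = 0 then \<bar>H 2\<bar> else 0) * x ^ n) sums \<bar>H 2\<bar>"
      using sums_single[of 0 "\<lambda>_. \<bar>H 2\<bar>"]
      by (rule back_subst[where P = "\<lambda>f. f sums _"]) auto
    from sums_add[OF sums_d this] show ?thesis by (simp add: c_def algebra_simps)
  qed
  have ge0: "0 \<le> (x / (real i + 1)) ^ e i" for x i
    using e_even by (simp add: zero_le_even_power)
  have "H \<bar>x\<bar> \<le> (\<Sum>n. c n * x ^ n)" for x
  proof (cases "\<bar>x\<bar> \<le> 2")
    case True
    then have "H \<bar>x\<bar> \<le> H 2" by (intro mono) auto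
    moreover have "0 \<le> (\<Sum>i. (x / (real i + 1)) ^ e i)" by (rule suminf_nonneg[OF sum1 ge0])
    ultimately show ?thesis using sums_unique[OF sums_c[of x]] by linarith
  next
    case False
    \<comment> \<open>The index with i + 2 <= |x| <= i + 3.\<close>
    define i where "i = nat \<lfloor>\<bar>x\<bar>\<rfloor> - 2"
    have "2 \<le> \<lfloor>\<bar>x\<bar>\<rfloor>" using False by (simp add: le_floor_iff)
    then have "real i = of_int \<lfloor>\<bar>x\<bar>\<rfloor> - 2" unfolding i_def by linarith
    then have i: "real i + 2 \<le> \<bar>x\<bar>" "\<bar>x\<bar> \<le> real i + 3"
      using floor_correct[of "\<bar>x\<bar>"] by linarith+
    have "H \<bar>x\<bar> \<le> H (real i + 3)" by (rule mono) (use i in auto)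
    also have "\<dots> \<le> \<bar>H (real i + 3)\<bar>" by simp
    also have "\<dots> \<le> ((real i + 2) / (real i + 1)) ^ N i" using N[of i] by simp
    also have "\<dots> \<le> ((real i + 2) / (real i + 1)) ^ e i" using e_N[of i] by (intro power_increasing) auto
    also have "\<dots> \<le> \<bar>x / (real i + 1)\<bar> ^ e i" using i by (intro power_mono) (auto simp: divide_right_mono)
    also have "\<dots> = (x / (real i + 1)) ^ e i" by (rule power_even_abs[OF e_even])
    also have "\<dots> \<le> (\<Sum>i. (x / (real i + 1)) ^ e i)"
      using sum_le_suminf[OF sum1[of x], of "{i}"] ge0[of x] by simp
    finally show ?thesis using sums_unique[OF sums_c[of x]] by linarith
  qed
  then show ?thesis using that[of c] sums_c by (metis sums_summable)
qed

section \<open>Global solutions of differential equations\<close>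

text \<open>Picard iteration in an exponentially weighted sup norm: the unknown is u(t) = exp(-\<nu>
  t) x(t). The bound on F keeps u bounded, and the weight makes the integral operator a contraction
  on the whole half-line, so no local solutions have to be glued.\<close>

lemma ode_solution_bounded_lipschitz:
  fixes F :: "'a::euclidean_space \<Rightarrow> 'a"
  assumes lip: "\<And>x y. norm (F x - F y) \<le> L * norm (x - y)" and L: "0 \<le> L"
    and bd: "\<And>x. norm (F x) \<le> K"
  shows "\<exists>x. x 0 = x0 \<and> (\<forall>t\<ge>0. (x has_vector_derivative F (x t)) (at t within {0..}))"
proof -
  \<comment> \<open>L / \<nu> <= 1/2 gives the contraction factor; the \<open>+ 1\<close> gives
    \<nu> >= 1, hence s exp(-\<nu> s) <= 1.\<close>
  define \<nu> where "\<nu> = 2 * L + 1"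
  have \<nu>: "\<nu> \<ge> 1" "L \<le> \<nu> / 2" "\<nu> > 0" using L by (auto simp: \<nu>_def)
  have K: "0 \<le> K" using bd[of 0] norm_ge_zero order_trans by blast
  have contF: "continuous_on UNIV F"
  proof -
    have "L-lipschitz_on UNIV F" using lip L by (intro lipschitz_onI) (auto simp: dist_norm)
    then show ?thesis by (rule lipschitz_on_continuous_on)
  qed
  define G where "G u r = F (exp (\<nu> * r) *\<^sub>R apply_bcontfun u r)" for u :: "real \<Rightarrow>\<^sub>C 'a" and r
  have contG: "continuous_on S (G u)" for u S
    unfolding G_def
    by (rule continuous_on_compose2[OF contF]) (auto intro!: continuous_intros)
  have intG: "G u integrable_on {0..s}" for u s
    by (rule integrable_continuous_real[OF contG])
  define T0 where "T0 u s = exp (- \<nu> * s) *\<^sub>R (x0 + integral {0..s} (G u))" for u s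
  \<comment> \<open>Elements of \<open>bcontfun\<close> live on the whole line, so the operator is
    frozen at its initial value for negative times.\<close>
  define T where "T u = (\<lambda>t. T0 u (max t 0))" for u
  have T_bc: "T u \<in> bcontfun" for u
  proof (rule bcontfun_normI)
    have ic: "continuous_on {0..a} (\<lambda>s. integral {0..s} (G u))" for a
      by (rule indefinite_integral_continuous_1[OF intG])
    then have "continuous_on {0..} (\<lambda>s. integral {0..s} (G u))"
    proof -
      have "continuous (at s within {0..}) (\<lambda>s. integral {0..s} (G u))" if "0 \<le> s" for s
      proof -
        have "at s within {0..} = at s within {0..s+1}"
          by (rule at_within_nhd[of _ "{..<s+1}"]) auto
        then show ?thesis
          using ic[of "s+1"] that by (auto simp: continuous_on_eq_continuous_within)
      qed
      then show ?thesis by (auto simp: continuous_on_eq_continuous_within)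
    qed
    then have "continuous_on {0..} (T0 u)"
      unfolding T0_def by (intro continuous_intros)
    then show "continuous_on UNIV (T u)"
      unfolding T_def by (rule continuous_on_compose2) (auto intro!: continuous_intros)
    fix t :: real
    define s where "s = max t 0"
    have s: "0 \<le> s" by (simp add: s_def)
    have "norm (integral {0..s} (G u)) \<le> K * s"
      using integral_bound[of 0 s "G u" K] s contG bd by (auto simp: G_def)
    then have "norm (T u t) \<le> exp (-\<nu> * s) * (norm x0 + K * s)"
      unfolding T_def T0_def s_def[symmetric]
      using norm_triangle_ineq[of x0 "integral {0..s} (G u)"] by (auto simp: mult_left_mono)
    also have "\<dots> = exp (-\<nu> * s) * norm x0 + K * (exp (-\<nu> * s) * s)" by (simp add: algebra_simps)
    also have "\<dots> \<le> 1 * norm x0 + K * 1"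
    proof (intro add_mono mult_mono mult_left_mono)
      have "s \<le> \<nu> * s" using \<nu> s by (simp add: mult_le_cancel_right1)
      also have "\<dots> \<le> exp (\<nu> * s)" using exp_ge_add_one_self[of "\<nu> * s"] by linarith
      finally show "exp (-\<nu> * s) * s \<le> 1" by (simp add: exp_minus field_simps)
    qed (use \<nu> s K in auto)
    finally show "norm (T u t) \<le> norm x0 + K" by simp
  qed
  define \<Phi> where "\<Phi> u = Bcontfun (T u)" for u
  have \<Phi>: "apply_bcontfun (\<Phi> u) = T u" for u
    unfolding \<Phi>_def using T_bc by (simp add: Bcontfun_inverse)
  have "dist (\<Phi> u) (\<Phi> v) \<le> 1/2 * dist u v" for u v
  proof (rule dist_bound)
    fix t :: real
    define s where "s = max t 0"
    have s: "0 \<le> s" by (simp add: s_def)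
    define d where "d = dist u v"
    have d: "0 \<le> d" by (simp add: d_def)
    have I: "((\<lambda>r. L * d * exp (\<nu> * r)) has_integral (L * d * (exp (\<nu> * s) / \<nu>) - L * d * (exp (\<nu> * 0) / \<nu>))) {0..s}"
      by (rule fundamental_theorem_of_calculus)
        (use s \<nu> in \<open>auto intro!: derivative_eq_intros simp flip: has_real_derivative_iff_has_vector_derivative\<close>)
    have "norm (integral {0..s} (G u) - integral {0..s} (G v)) = norm (integral {0..s} (\<lambda>r. G u r - G v r))"
      by (simp add: integral_diff[OF intG intG])
    also have "\<dots> \<le> integral {0..s} (\<lambda>r. L * d * exp (\<nu> * r))"
    proof (rule integral_norm_bound_integral)
      show "(\<lambda>r. G u r - G v r) integrable_on {0..s}" by (intro integrable_diff intG)
      show "(\<lambda>r. L * d * exp (\<nu> * r)) integrable_on {0..s}" using I by blast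
      fix r assume "r \<in> {0..s}"
      have "norm (G u r - G v r) \<le> L * norm (exp (\<nu> * r) *\<^sub>R u r - exp (\<nu> * r) *\<^sub>R v r)"
        unfolding G_def by (rule lip)
      also have "\<dots> = L * (exp (\<nu> * r) * dist (u r) (v r))"
        by (simp add: scaleR_diff_right[symmetric] dist_norm)
      also have "\<dots> \<le> L * (exp (\<nu> * r) * d)"
        using L dist_bounded[of u r v] by (intro mult_left_mono) (auto simp: d_def)
      finally show "norm (G u r - G v r) \<le> L * d * exp (\<nu> * r)" by (simp add: ac_simps)
    qed
    also have "\<dots> = L * d * (exp (\<nu> * s) / \<nu>) - L * d * (exp (\<nu> * 0) / \<nu>)"
      using I by (rule integral_unique)
    also have "\<dots> \<le> L * d * (exp (\<nu> * s) / \<nu>)" using L d \<nu> by simp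
    also have "\<dots> = (L / \<nu>) * d * exp (\<nu> * s)" by simp
    also have "\<dots> \<le> (1/2) * d * exp (\<nu> * s)"
      using \<nu> d by (intro mult_right_mono) (auto simp: field_simps)
    finally have le: "norm (integral {0..s} (G u) - integral {0..s} (G v)) \<le> (1/2) * d * exp (\<nu> * s)" .
    have "dist (T u t) (T v t) = exp (-\<nu> * s) * norm (integral {0..s} (G u) - integral {0..s} (G v))"
      unfolding T_def T0_def s_def[symmetric] dist_norm
      by (simp add: scaleR_diff_right[symmetric])
    also have "\<dots> \<le> exp (-\<nu> * s) * ((1/2) * d * exp (\<nu> * s))" by (intro mult_left_mono le) auto
    also have "\<dots> = 1/2 * d" by (simp add: exp_minus field_simps)
    finally show "dist (\<Phi> u t) (\<Phi> v t) \<le> 1/2 * dist u v" by (simp add: \<Phi> d_def)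
  qed
  then obtain u where "\<Phi> u = u"
    using banach_fix_type[of "1/2" \<Phi>] by auto
  then have u: "u t = T u t" for t using \<Phi>[of u] by simp
  define x where "x t = x0 + integral {0..t} (G u)" for t
  have Gx: "G u r = F (x r)" if "0 \<le> r" for r
    using that u[of r] by (simp add: G_def T_def T0_def x_def exp_add[symmetric])
  have "(x has_vector_derivative F (x t)) (at t within {0..})" if "0 \<le> t" for t
  proof -
    have "((\<lambda>s. integral {0..s} (G u)) has_vector_derivative G u t) (at t within {0..t+1})"
      by (rule integral_has_vector_derivative[OF contG]) (use that in auto)
    moreover have "at t within {0..} = at t within {0..t+1}"
      by (rule at_within_nhd[of _ "{..<t+1}"]) auto
    ultimately show ?thesis
      using Gx[OF that] unfolding x_def by (auto intro!: derivative_eq_intros)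
  qed
  moreover have "x 0 = x0" by (simp add: x_def)
  ultimately show ?thesis by blast
qed

text \<open>Composing F with the metric projection onto a large ball makes it bounded and Lipschitz,
  so that a global solution exists. Up to its first exit from the ball it solves the original
  equation, and there the a priori bound, which is uniform in T, rules out the exit.\<close>

lemma ode_solution_of_apriori_bound:
  fixes F :: "'a::euclidean_space \<Rightarrow> 'a"
  assumes lip: "loc_lip F"
    and apriori: "\<And>T x t. x 0 = x0 \<Longrightarrow>
      (\<And>s. 0 \<le> s \<Longrightarrow> s \<le> T \<Longrightarrow> (x has_vector_derivative F (x s)) (at s within {0..})) \<Longrightarrow>
      0 \<le> t \<Longrightarrow> t \<le> T \<Longrightarrow> norm (x t) \<le> B"
  shows "\<exists>x. x 0 = x0 \<and> (\<forall>t\<ge>0. (x has_vector_derivative F (x t)) (at t within {0..}))"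
proof -
  \<comment> \<open>Strictly above both numbers: the solution starts inside the ball, and the bound
    B contradicts reaching its boundary.\<close>
  define R where "R = max B (norm x0) + 1"
  have R: "0 \<le> R" "B < R" "norm x0 < R" using norm_ge_zero[of x0] unfolding R_def by linarith+
  let ?c = "closest_point (cball (0::'a) R)"
  have c_in: "norm (?c x) \<le> R" for x
    using closest_point_in_set[of "cball (0::'a) R" x] R by auto
  have c_lip: "norm (?c x - ?c y) \<le> norm (x - y)" for x y
    using closest_point_lipschitz[of "cball (0::'a) R" x y] R by (auto simp: dist_norm)
  have c_id: "?c x = x" if "norm x \<le> R" for x
    by (rule closest_point_self) (use that in auto)
  obtain L where L: "L \<ge> 0" "\<And>x y. norm x \<le> R \<Longrightarrow> norm y \<le> R \<Longrightarrow> norm (F x - F y) \<le> L * norm (x - y)"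
    using loc_lipD[OF lip] by blast
  obtain K where K: "\<And>x. norm x \<le> R \<Longrightarrow> norm (F x) \<le> K" using loc_lip_bounded[OF lip] by blast
  have "norm (F (?c x) - F (?c y)) \<le> L * norm (x - y)" for x y
    using L(2)[OF c_in c_in, of x y] mult_left_mono[OF c_lip L(1), of x y] by linarith
  from ode_solution_bounded_lipschitz[where F = "\<lambda>x. F (?c x)", OF this L(1) K[OF c_in]]
  obtain x where x: "x 0 = x0" "\<And>t. 0 \<le> t \<Longrightarrow> (x has_vector_derivative F (?c (x t))) (at t within {0..})"
    by blast
  have cont: "continuous_on {0..} (\<lambda>t. norm (x t))"
  proof (intro continuous_on_norm)
    show "continuous_on {0..} x"
      unfolding continuous_on_eq_continuous_within using x(2) by (auto intro: has_vector_derivative_continuous)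
  qed
  have small: "norm (x t) < R" if "0 \<le> t" for t
  proof (rule ccontr)
    assume "\<not> norm (x t) < R"
    define S where "S = {s \<in> {0..t}. R \<le> norm (x s)}"
    have cl: "closed S"
      unfolding S_def
      by (rule continuous_on_closed_Collect_le) (auto intro: continuous_on_subset[OF cont])
    have ne: "S \<noteq> {}" using \<open>\<not> norm (x t) < R\<close> that by (auto simp: S_def)
    have bdd: "bdd_below S" by (auto simp: S_def bdd_below_def)
    define T where "T = Inf S"
    have TS: "T \<in> S" unfolding T_def using closed_contains_Inf[OF ne bdd cl] .
    have T0: "0 \<le> T" using TS by (auto simp: S_def)
    have lo: "norm (x s) < R" if "0 \<le> s" "s < T" for s
    proof (rule ccontr)
      assume "\<not> norm (x s) < R"
      then have "s \<in> S" using that TS by (auto simp: S_def)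
      then have "T \<le> s" unfolding T_def using bdd by (rule cInf_lower)
      then show False using that by simp
    qed
    have "norm (x T) \<le> R"
    proof (rule ccontr)
      assume "\<not> norm (x T) \<le> R"
      moreover have "continuous_on {0..T} (\<lambda>t. norm (x t))" by (rule continuous_on_subset[OF cont]) auto
      ultimately obtain s where "0 \<le> s" "s \<le> T" "norm (x s) = R"
        using IVT'[of "\<lambda>t. norm (x t)" 0 R T] T0 R x(1) by auto
      then show False using lo[of s] \<open>\<not> norm (x T) \<le> R\<close> by (cases "s = T") auto
    qed
    then have le: "norm (x s) \<le> R" if "0 \<le> s" "s \<le> T" for s
      using lo[of s] that by (cases "s = T") auto
    have "(x has_vector_derivative F (x s)) (at s within {0..})" if "0 \<le> s" "s \<le> T" for s
      using x(2)[OF that(1)] c_id[OF le[OF that]] by simp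
    from apriori[OF x(1) this, of T T] have "norm (x T) \<le> B" using T0 by auto
    then show False using TS R by (auto simp: S_def)
  qed
  have "(x has_vector_derivative F (x t)) (at t within {0..})" if "0 \<le> t" for t
    using x(2)[OF that] c_id small[OF that] by simp
  then show ?thesis using x(1) by blast
qed

section \<open>Chains of integrators\<close>

lemma inner_unit_vec:
  assumes "i \<in> {1..DIM('a)}" "j \<in> {1..DIM('a::euclidean_space)}"
  shows "(unit_vec i :: 'a) \<bullet> unit_vec j = (if i = j then 1 else 0)"
proof -
  have "inj_on (unit_vec :: nat \<Rightarrow> 'a) {1..DIM('a)}" "(unit_vec i :: 'a) \<in> Basis" "(unit_vec j :: 'a) \<in> Basis"
    using bij_betw_unit_vec[where 'a = 'a] assms by (auto simp: bij_betw_def)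
  then show ?thesis using assms by (auto simp: inner_Basis inj_on_eq_iff)
qed

lemma norm_unit_vec: "j \<in> {1..DIM('a::euclidean_space)} \<Longrightarrow> norm (unit_vec j :: 'a) = 1"
  using inner_unit_vec[of j j, where 'a = 'a] by (simp add: norm_eq_sqrt_inner)

lemma Rspace_expand:
  fixes x :: "'a::euclidean_space"
  assumes "x \<in> Rspace n" "n \<le> DIM('a)"
  shows "x = (\<Sum>j\<in>{1..n}. (x \<bullet> unit_vec j) *\<^sub>R unit_vec j)"
  using assms(1) unfolding Rspace_def
proof (induction rule: span_induct_alt)
  case base
  then show ?case by simp
next
  case (step c u y)
  then obtain i where i: "i \<in> {1..n}" "u = unit_vec i" by auto
  have "(\<Sum>j\<in>{1..n}. (u \<bullet> unit_vec j) *\<^sub>R (unit_vec j :: 'a)) = (\<Sum>j\<in>{1..n}. if i = j then unit_vec j else 0)"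
    using i assms(2) by (intro sum.cong) (auto simp: inner_unit_vec)
  also have "\<dots> = u" using i by simp
  finally have "c *\<^sub>R u + y = c *\<^sub>R (\<Sum>j\<in>{1..n}. (u \<bullet> unit_vec j) *\<^sub>R unit_vec j)
      + (\<Sum>j\<in>{1..n}. (y \<bullet> unit_vec j) *\<^sub>R unit_vec j)"
    using step by metis
  also have "\<dots> = (\<Sum>j\<in>{1..n}. ((c *\<^sub>R u + y) \<bullet> unit_vec j) *\<^sub>R unit_vec j)"
    by (simp add: inner_add_left scaleR_add_left sum.distrib scaleR_sum_right)
  finally show ?case .
qed

lemma unit_vec_in_Rspace: "1 \<le> j \<Longrightarrow> j \<le> n \<Longrightarrow> unit_vec j \<in> Rspace n"
  unfolding Rspace_def by (rule span_base) auto

lemma subspace_Rspace: "subspace (Rspace n)"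
  unfolding Rspace_def by (rule subspace_span)

lemma chain_A_in_Rspace: "chain_A n x \<in> Rspace n"
  unfolding chain_A_def
  by (intro subspace_sum[OF subspace_Rspace] subspace_scale[OF subspace_Rspace] unit_vec_in_Rspace) auto

lemma linear_chain_A: "linear (chain_A n)"
  unfolding chain_A_def
  by (rule linearI) (simp_all add: inner_add_left scaleR_add_left sum.distrib scaleR_sum_right)

lemma chain_A_inner:
  assumes "n \<le> DIM('a::euclidean_space)" "1 \<le> i" "i \<le> n"
  shows "chain_A n (x :: 'a) \<bullet> unit_vec i = (if i < n then x \<bullet> unit_vec (i + 1) else 0)"
proof -
  have "chain_A n x \<bullet> unit_vec i = (\<Sum>j = 1..<n. (x \<bullet> unit_vec (j + 1)) * (unit_vec j \<bullet> (unit_vec i :: 'a)))"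
    by (simp add: chain_A_def inner_sum_left)
  also have "\<dots> = (\<Sum>j = 1..<n. if j = i then x \<bullet> unit_vec (i + 1) else 0)"
    by (intro sum.cong) (use assms in \<open>auto simp: inner_unit_vec\<close>)
  also have "\<dots> = (if i < n then x \<bullet> unit_vec (i + 1) else 0)" using assms by simp
  finally show ?thesis .
qed

text \<open>\<open>zeta\<close> without the reference, so that the same combination can be taken of
  errors measured from y* as well as from r.\<close>

definition zlin :: "nat \<Rightarrow> (nat \<Rightarrow> real) \<Rightarrow> 'x::euclidean_space \<Rightarrow> real" where
  "zlin n k x = (\<Sum>j = 1..n - 1. k j * (x \<bullet> unit_vec j)) + x \<bullet> unit_vec n"

lemma linear_zlin: "linear (zlin n k)"
  unfolding zlin_def
  by (rule linearI) (simp_all add: inner_add_left distrib_left sum.distrib sum_distrib_left ac_simps)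

lemma zeta_eq: "zeta n k x r = zlin n k x - r * zlin n k (unit_vec 1 :: 'x)"
  for x :: "'x::euclidean_space"
proof -
  have "zeta n k x r = zlin n k (x - r *\<^sub>R unit_vec 1)" by (simp add: zeta_def zlin_def xbar_def)
  then show ?thesis by (simp add: linear_diff[OF linear_zlin] linear_scale[OF linear_zlin])
qed

text \<open>The input acts on the last coordinate, so it enters the derivative of this combination
  with unit gain.\<close>

lemma zlin_unit_vec:
  assumes "1 \<le> n" "n \<le> DIM('a::euclidean_space)"
  shows "zlin n k (unit_vec n :: 'a) = 1"
  proof -
  have "(\<Sum>j = 1..n - 1. k j * ((unit_vec n :: 'a) \<bullet> unit_vec j)) = 0"
  proof (rule sum.neutral, intro ballI)
    fix j assume "j \<in> {1..n - 1}"
    then have "n \<noteq> j" "j \<in> {1..DIM('a)}" "n \<in> {1..DIM('a)}" using assms by auto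
    then show "k j * ((unit_vec n :: 'a) \<bullet> unit_vec j) = 0" using inner_unit_vec[of n j, where 'a = 'a] by auto
  qed
  then show ?thesis unfolding zlin_def using assms by (simp add: inner_unit_vec)
qed

lemma coeff_zeta_poly:
  "coeff (zeta_poly n k) i = (if i < n - 1 then k (i + 1) else if i = n - 1 then 1 else 0)"
proof -
  have "coeff (zeta_poly n k) i = (\<Sum>j = 1..n - 1. if j - 1 = i then k j else 0) + (if n - 1 = i then 1 else 0)"
    by (simp add: zeta_poly_def coeff_sum)
  also have "(\<Sum>j = 1..n - 1. if j - 1 = i then k j else 0) = (\<Sum>j = 1..n - 1. if j = i + 1 then k (i + 1) else 0)"
    by (intro sum.cong) auto
  finally show ?thesis by auto
qed

text \<open>The linear functional of a chain of integrators that corresponds to the differential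
  operator \<open>q\<close> applied to the first coordinate.\<close>

definition chain_op :: "nat \<Rightarrow> complex poly \<Rightarrow> 'x::euclidean_space \<Rightarrow> complex" where
  "chain_op n q x = (\<Sum>i<n. coeff q i * of_real (x \<bullet> unit_vec (Suc i)))"

lemma linear_chain_op: "linear (chain_op n q)"
  unfolding chain_op_def
  by (rule linearI) (simp_all add: inner_add_left distrib_left sum.distrib sum_distrib_left scaleR_conv_of_real ac_simps)

text \<open>In terms of differential operators, \<lambda> q = \<mu> q + (\<lambda> - \<mu>) q.
  Cutting off at n is consistent, because both sides drop the coefficients beyond index n -
  1.\<close>

lemma chain_op_chain_A:
  fixes x :: "'x::euclidean_space"
  assumes "1 \<le> n" "n \<le> DIM('x)"
  shows "chain_op n q (chain_A n x) = \<mu> * chain_op n q x + chain_op n ([:-\<mu>, 1:] * q) x"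
proof -
  obtain m where m: "n = Suc m" using assms by (cases n) auto
  have "chain_op n q (chain_A n x) = (\<Sum>i<m. coeff q i * of_real (x \<bullet> unit_vec (Suc (Suc i))))"
    using assms unfolding chain_op_def m by (simp add: chain_A_inner)
  also have "\<dots> = (\<Sum>i<n. coeff (pCons 0 q) i * of_real (x \<bullet> unit_vec (Suc i)))"
    unfolding m by (subst sum.lessThan_Suc_shift) simp
  also have "\<dots> = \<mu> * chain_op n q x + chain_op n ([:-\<mu>, 1:] * q) x"
    unfolding chain_op_def sum_distrib_left sum.distrib[symmetric]
    by (intro sum.cong) (auto simp: algebra_simps)
  finally show ?thesis .
qed

text \<open>The relative degree of the chain: an operator of lower order does not see the
  input.\<close>

lemma chain_op_unit_vec:
  assumes "1 \<le> n" "n \<le> DIM('x::euclidean_space)" "degree q < n - 1"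
  shows "chain_op n q (unit_vec n :: 'x) = 0"
  unfolding chain_op_def
proof (rule sum.neutral, intro ballI)
  fix i assume "i \<in> {..<n}"
  show "coeff q i * of_real ((unit_vec n :: 'x) \<bullet> unit_vec (Suc i)) = 0"
  proof (cases "Suc i = n")
    case True
    then show ?thesis using assms by (simp add: coeff_eq_0)
  next
    case False
    then show ?thesis using assms \<open>i \<in> {..<n}\<close> by (simp add: inner_unit_vec)
  qed
qed

text \<open>Induction over the roots. With q the product over the later roots, y = q(d/dt) x_1
  satisfies y' = \<mu> y + ((d/dt - \<mu>) q) x_1, a stable scalar filter driven by the next output
  of the cascade. Adding a multiple of |y|^2 absorbs the |y|^2 by which the earlier stage was
  driven. Complex values are needed because the roots may be complex.\<close>

lemma chain_cascade_lyapunov: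
  fixes ls :: "complex list"
  assumes n: "1 \<le> n" "n \<le> DIM('x::euclidean_space)"
    and "\<forall>\<mu>\<in>set ls. Re \<mu> < 0" "length ls \<le> n - 1"
  shows "\<exists>(Q :: 'x \<Rightarrow> real) DQ c C. 0 < c \<and> 0 < C \<and>
    (\<forall>x. 0 \<le> Q x \<and> (Q has_derivative DQ x) (at x) \<and> (\<forall>i<length ls. \<bar>x \<bullet> unit_vec (Suc i)\<bar> \<le> C * sqrt (Q x))
      \<and> (\<forall>s. DQ x (chain_A n x + s *\<^sub>R unit_vec n)
          \<le> - c * Q x + C * (norm (chain_op n (\<Prod>\<mu>\<leftarrow>ls. [:-\<mu>, 1:]) x))\<^sup>2))"
  using assms(3,4)
proof (induction ls)
  case Nil
  show ?case
    by (rule exI[of _ "\<lambda>_. 0"], rule exI[of _ "\<lambda>_ _. 0"], rule exI[of _ 1], rule exI[of _ 1]) simp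
next
  case (Cons \<mu> ls)
  define q where "q = (\<Prod>\<mu>\<leftarrow>ls. [:-\<mu>, 1:])"
  have q: "degree q = length ls" "coeff q (length ls) = 1"
  proof -
    have "degree (\<Prod>\<mu>\<leftarrow>ls. [:-\<mu>, 1:]) = length ls \<and> lead_coeff (\<Prod>\<mu>\<leftarrow>ls. [:-\<mu>, 1:]) = 1" for ls :: "complex list"
    proof (induction ls)
      case (Cons a ls)
      then have "(\<Prod>\<mu>\<leftarrow>ls. [:-\<mu>, 1:]) \<noteq> 0" by auto
      with Cons have "degree (\<Prod>\<mu>\<leftarrow>a # ls. [:-\<mu>, 1:]) = length (a # ls)"
        by (simp add: degree_mult_eq del: mult_pCons_left)
      moreover have "lead_coeff (\<Prod>\<mu>\<leftarrow>a # ls. [:-\<mu>, 1:]) = 1"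
      proof -
        have "lead_coeff [:-a, 1:] = 1" by simp
        then show ?thesis
          unfolding list.map prod_list.Cons lead_coeff_mult
          by (simp only: conjunct2[OF Cons.IH] mult_1)
      qed
      ultimately show ?case by blast
    qed simp
    from this[of ls] have *: "degree q = length ls" "lead_coeff q = 1"
      unfolding q_def by (rule conjunct1, rule conjunct2)
    show "degree q = length ls" by (rule *)
    show "coeff q (length ls) = 1" using *(2) unfolding *(1) .
  qed
  obtain Q DQ c C where c: "0 < c" "0 < C"
    and Q: "\<And>x::'x. 0 \<le> Q x" "\<And>x. (Q has_derivative DQ x) (at x)"
    and co: "\<And>x i. i < length ls \<Longrightarrow> \<bar>x \<bullet> unit_vec (Suc i)\<bar> \<le> C * sqrt (Q x)"
    and dec: "\<And>x s. DQ x (chain_A n x + s *\<^sub>R unit_vec n) \<le> - c * Q x + C * (norm (chain_op n q x))\<^sup>2"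
  proof -
    have "\<forall>\<mu>\<in>set ls. Re \<mu> < 0" "length ls \<le> n - 1" using Cons.prems by auto
    from Cons.IH[OF this] obtain Q DQ c C where "0 < c \<and> 0 < C \<and>
    (\<forall>x::'x. 0 \<le> Q x \<and> (Q has_derivative DQ x) (at x) \<and> (\<forall>i<length ls. \<bar>x \<bullet> unit_vec (Suc i)\<bar> \<le> C * sqrt (Q x))
      \<and> (\<forall>s. DQ x (chain_A n x + s *\<^sub>R unit_vec n)
          \<le> - c * Q x + C * (norm (chain_op n q x))\<^sup>2))"
      unfolding q_def by (elim exE)
    then show thesis by (intro that[of c C Q DQ]) simp_all
  qed
  define s0 where "s0 = - Re \<mu>"
  have s0: "0 < s0" using Cons.prems by (simp add: s0_def)
  \<comment> \<open>The damping \<omega> s0 |y|^2 then beats the driving term C |y|^2 with margin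
    |y|^2, and c' * \<omega> <= 1 below turns this margin into decay of the new summand.\<close>
  define \<omega> where "\<omega> = (C + 1) / s0"
  have \<omega>: "0 < \<omega>" "\<omega> * s0 = C + 1" using s0 c by (auto simp: \<omega>_def)
  let ?y = "\<lambda>x::'x. chain_op n q x"
  let ?y' = "\<lambda>x::'x. chain_op n ([:-\<mu>, 1:] * q) x"
  define Q' where "Q' x = Q x + \<omega> * (?y x \<bullet> ?y x)" for x
  define DQ' where "DQ' x v = DQ x v + \<omega> * (2 * (?y x \<bullet> ?y v))" for x v
  have lin: "bounded_linear ?y" using linear_chain_op by (simp add: linear_conv_bounded_linear)
  have der: "(Q' has_derivative DQ' x) (at x)" for x
    unfolding Q'_def[abs_def] DQ'_def[abs_def]
    by (rule derivative_eq_intros Q(2) bounded_linear.has_derivative[OF lin] refl)+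
      (auto simp: fun_eq_iff inner_commute algebra_simps)
  have Q'0: "0 \<le> Q' x" for x using Q(1)[of x] \<omega> by (simp add: Q'_def)
  define c' where "c' = min c (1/\<omega>)"
  have c': "0 < c'" "c' \<le> c" "c' * \<omega> \<le> 1" using c \<omega> by (auto simp: c'_def min_def field_simps)
  have dec': "DQ' x (chain_A n x + s *\<^sub>R unit_vec n) \<le> - c' * Q' x + (\<omega> / s0) * (norm (?y' x))\<^sup>2" for x s
  proof -
    have "?y (chain_A n x + s *\<^sub>R unit_vec n) = \<mu> * ?y x + ?y' x"
      using n Cons.prems q
      by (simp add: linear_add[OF linear_chain_op] linear_scale[OF linear_chain_op] chain_op_chain_A[of n q x \<mu>]
          chain_op_unit_vec del: mult_pCons_left)
    then have "DQ' x (chain_A n x + s *\<^sub>R unit_vec n) = DQ x (chain_A n x + s *\<^sub>R unit_vec n)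
        + \<omega> * (2 * (?y x \<bullet> (\<mu> * ?y x)) + 2 * (?y x \<bullet> ?y' x))"
      by (simp add: DQ'_def inner_add_right)
    moreover have "?y x \<bullet> (\<mu> * ?y x) = - s0 * (norm (?y x))\<^sup>2"
      unfolding cmod_power2 s0_def by (simp add: inner_complex_def algebra_simps power2_eq_square)
    moreover have "2 * (?y x \<bullet> ?y' x) \<le> s0 * (norm (?y x))\<^sup>2 + (norm (?y' x))\<^sup>2 / s0"
    proof -
      have "0 \<le> (s0 * norm (?y x) - norm (?y' x))\<^sup>2 / s0" using s0 by simp
      also have "\<dots> = s0 * (norm (?y x))\<^sup>2 + (norm (?y' x))\<^sup>2 / s0 - 2 * (norm (?y x) * norm (?y' x))"
        using s0 by (simp add: power2_diff field_simps) (simp add: power2_eq_square)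
      finally show ?thesis using norm_cauchy_schwarz[of "?y x" "?y' x"] by linarith
    qed
    ultimately have "DQ' x (chain_A n x + s *\<^sub>R unit_vec n)
        \<le> - c * Q x + C * (norm (?y x))\<^sup>2 + \<omega> * (- s0 * (norm (?y x))\<^sup>2 + (norm (?y' x))\<^sup>2 / s0)"
      using dec[of x s] mult_left_mono[of "2 * (?y x \<bullet> (\<mu> * ?y x)) + 2 * (?y x \<bullet> ?y' x)"
          "- s0 * (norm (?y x))\<^sup>2 + (norm (?y' x))\<^sup>2 / s0" \<omega>] \<omega> by (auto simp: algebra_simps)
    also have "\<dots> = - c * Q x + (C - \<omega> * s0) * (norm (?y x))\<^sup>2 + (\<omega> / s0) * (norm (?y' x))\<^sup>2"
      by (simp add: algebra_simps)
    also have "\<dots> = - c * Q x - (norm (?y x))\<^sup>2 + (\<omega> / s0) * (norm (?y' x))\<^sup>2"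
      by (simp add: \<omega>)
    also have "\<dots> \<le> - c' * Q x - c' * \<omega> * (norm (?y x))\<^sup>2 + (\<omega> / s0) * (norm (?y' x))\<^sup>2"
      using mult_right_mono[OF c'(2) Q(1)[of x]] mult_right_mono[OF c'(3), of "(norm (?y x))\<^sup>2"] by simp
    finally show ?thesis by (simp add: Q'_def algebra_simps power2_norm_eq_inner)
  qed
  define K where "K = (\<Sum>i<length ls. norm (coeff q i))"
  define C' where "C' = C + 1 / sqrt \<omega> + K * C + \<omega> / s0"
  have K: "0 \<le> K" by (auto simp: K_def intro: sum_nonneg)
  have C': "0 < C'" "C \<le> C'" "1 / sqrt \<omega> + K * C \<le> C'" "\<omega> / s0 \<le> C'"
    using c \<omega> s0 K by (auto simp: C'_def intro!: add_pos_nonneg add_nonneg_nonneg)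
  have "\<bar>x \<bullet> unit_vec (Suc i)\<bar> \<le> C' * sqrt (Q' x)" if "i < Suc (length ls)" for x i
  proof -
    have QQ: "sqrt (Q x) \<le> sqrt (Q' x)" using \<omega> by (simp add: Q'_def)
    have le: "\<bar>x \<bullet> unit_vec (Suc i)\<bar> \<le> C * sqrt (Q' x)" if "i < length ls" for i
      using co[OF that, of x] mult_left_mono[OF QQ, of C] c by linarith
    show ?thesis
    proof (cases "i < length ls")
      case True
      then show ?thesis using le[of i] mult_right_mono[OF C'(2), of "sqrt (Q' x)"] Q'0[of x] by simp
    next
      case False
      then have i: "i = length ls" using that by simp
      \<comment> \<open>Since q is monic of degree \<open>length ls\<close>, its output determines
        the next coordinate in terms of the previous ones.\<close>
      have "?y x = (\<Sum>i<Suc (length ls). coeff q i * of_real (x \<bullet> unit_vec (Suc i)))"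
        unfolding chain_op_def
        by (rule sum.mono_neutral_right) (use Cons.prems q n in \<open>auto simp: coeff_eq_0\<close>)
      then have "of_real (x \<bullet> unit_vec (Suc i)) = ?y x - (\<Sum>i<length ls. coeff q i * of_real (x \<bullet> unit_vec (Suc i)))"
        using q i by simp
      then have "norm (of_real (x \<bullet> unit_vec (Suc i)) :: complex) \<le> norm (?y x) + norm (\<Sum>i<length ls. coeff q i * of_real (x \<bullet> unit_vec (Suc i)))"
        by (simp add: norm_triangle_ineq4)
      also have "norm (\<Sum>i<length ls. coeff q i * of_real (x \<bullet> unit_vec (Suc i))) \<le> (\<Sum>i<length ls. norm (coeff q i) * (C * sqrt (Q' x)))"
      proof (rule order_trans[OF norm_sum], rule sum_mono)
        fix i assume "i \<in> {..<length ls}"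
        then show "norm (coeff q i * of_real (x \<bullet> unit_vec (Suc i))) \<le> norm (coeff q i) * (C * sqrt (Q' x))"
          using le[of i] by (auto simp: norm_mult intro: mult_left_mono)
      qed
      also have "\<dots> = K * C * sqrt (Q' x)" by (simp add: K_def sum_distrib_right mult.assoc)
      also have "norm (?y x) \<le> (1 / sqrt \<omega>) * sqrt (Q' x)"
      proof -
        have "sqrt \<omega> * norm (?y x) = sqrt (\<omega> * (?y x \<bullet> ?y x))" by (simp add: real_sqrt_mult norm_eq_sqrt_inner)
        also have "\<dots> \<le> sqrt (Q' x)" using Q(1)[of x] by (simp add: Q'_def)
        finally show ?thesis using \<omega> by (simp add: field_simps)
      qed
      finally have "\<bar>x \<bullet> unit_vec (Suc i)\<bar> \<le> (1 / sqrt \<omega> + K * C) * sqrt (Q' x)" by (simp add: algebra_simps)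
      also have "\<dots> \<le> C' * sqrt (Q' x)" using C'(3) Q'0[of x] by (intro mult_right_mono) auto
      finally show ?thesis .
    qed
  qed
  moreover have "DQ' x (chain_A n x + s *\<^sub>R unit_vec n) \<le> - c' * Q' x + C' * (norm (?y' x))\<^sup>2" for x s
    using dec'[of x s] mult_right_mono[OF C'(4), of "(norm (?y' x))\<^sup>2"] by simp
  ultimately show ?case
    using c'(1) C'(1) Q'0 der
    by (intro exI[of _ Q'] exI[of _ DQ'] exI[of _ c'] exI[of _ C'])
      (simp add: q_def del: mult_pCons_left)
qed

text \<open>The chain seen as a system with \<zeta> as its input. Over the complex numbers
  \<open>zeta_poly\<close> splits into stable linear factors, and the last output of the cascade is
  \<open>zlin\<close>. The cascade controls the first n - 1 coordinates; the last one is recovered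
  from \<open>zlin\<close>.\<close>

lemma hurwitz_chain_lyapunov:
  assumes n: "1 \<le> n" "n \<le> DIM('x)" and hur: "hurwitz (zeta_poly n k)"
  obtains Q :: "'x::euclidean_space \<Rightarrow> real" and DQ c C where "0 < c" "0 < C" "\<And>x. 0 \<le> Q x"
    "\<And>x. (Q has_derivative DQ x) (at x)"
    "\<And>x. x \<in> Rspace n \<Longrightarrow> norm x \<le> C * (sqrt (Q x) + \<bar>zlin n k x\<bar>)"
    "\<And>x s. DQ x (chain_A n x + s *\<^sub>R unit_vec n) \<le> - c * Q x + C * (zlin n k x)\<^sup>2"
proof -
  define p where "p = map_poly complex_of_real (zeta_poly n k)"
  have cp: "coeff p i = of_real (if i < n - 1 then k (i + 1) else if i = n - 1 then 1 else 0)" for i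
    by (simp add: p_def coeff_map_poly coeff_zeta_poly)
  have "degree p = n - 1"
    by (rule antisym[OF degree_le le_degree]) (auto simp: cp)
  have p0: "p \<noteq> 0" and lc: "lead_coeff p = 1"
    using cp[of "n - 1"] \<open>degree p = n - 1\<close> by auto
  obtain A where A: "size A = degree p" "p = smult (lead_coeff p) (\<Prod>x\<in>#A. [:-x, 1:])"
    using alg_closed_imp_factorization[OF p0] by blast
  obtain ls where ls: "mset ls = A" using ex_mset by blast
  have p_ls: "p = (\<Prod>\<mu>\<leftarrow>ls. [:-\<mu>, 1:])"
    using A(2) lc ls by (metis (no_types) prod_mset_prod_list mset_map smult_1_left)
  have len: "length ls = n - 1" using A(1) \<open>degree p = n - 1\<close> ls by (metis size_mset)
  have Re: "Re \<mu> < 0" if "\<mu> \<in> set ls" for \<mu>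
  proof -
    have "poly p \<mu> = 0" unfolding p_ls using that by (induction ls) auto
    then show ?thesis using hur by (simp add: hurwitz_def p_def)
  qed
  have op: "norm (chain_op n p x) = \<bar>zlin n k x\<bar>" for x :: 'x
  proof -
    obtain m where m: "n = Suc m" using n by (cases n) auto
    have "zlin n k x = (\<Sum>i<m. k (Suc i) * (x \<bullet> unit_vec (Suc i))) + x \<bullet> unit_vec n"
    proof -
      have "(\<Sum>j = 1..m. k j * (x \<bullet> unit_vec j)) = (\<Sum>i<m. k (Suc i) * (x \<bullet> unit_vec (Suc i)))"
        by (rule sum.reindex_bij_witness[of _ Suc "\<lambda>j. j - 1"]) auto
      then show ?thesis by (simp add: zlin_def m)
    qed
    then have "chain_op n p x = of_real (zlin n k x)"
      unfolding chain_op_def m by (simp add: cp m)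
    then show ?thesis by simp
  qed
  obtain Q DQ c C where c: "0 < c" "0 < C"
    and Q: "\<And>x::'x. 0 \<le> Q x" "\<And>x. (Q has_derivative DQ x) (at x)"
    and co: "\<And>x i. i < n - 1 \<Longrightarrow> \<bar>x \<bullet> unit_vec (Suc i)\<bar> \<le> C * sqrt (Q x)"
    and dec: "\<And>x s. DQ x (chain_A n x + s *\<^sub>R unit_vec n) \<le> - c * Q x + C * (norm (chain_op n p x))\<^sup>2"
    using chain_cascade_lyapunov[OF n, of ls] Re len unfolding p_ls[symmetric] by auto blast
  define K where "K = (\<Sum>j = 1..n - 1. \<bar>k j\<bar>)"
  have K: "0 \<le> K" by (auto simp: K_def intro: sum_nonneg)
  define C' where "C' = real (n - 1) * C + K * C + C + 1"
  have C': "0 < C'" "C \<le> C'" using c K by (auto simp: C'_def intro!: add_nonneg_pos add_nonneg_nonneg)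
  have co': "\<bar>x \<bullet> unit_vec j\<bar> \<le> C * sqrt (Q x)" if "j \<in> {1..n - 1}" for x j
    using co[of "j - 1" x] that by (cases j) auto
  have "norm x \<le> C' * (sqrt (Q x) + \<bar>zlin n k x\<bar>)" if "x \<in> Rspace n" for x
  proof -
    have q0: "0 \<le> sqrt (Q x)" using Q by simp
    have last: "\<bar>x \<bullet> unit_vec n\<bar> \<le> \<bar>zlin n k x\<bar> + K * (C * sqrt (Q x))"
    proof -
      have "\<bar>\<Sum>j = 1..n - 1. k j * (x \<bullet> unit_vec j)\<bar> \<le> (\<Sum>j = 1..n - 1. \<bar>k j\<bar> * (C * sqrt (Q x)))"
        by (rule order_trans[OF sum_abs], rule sum_mono) (auto simp: abs_mult intro!: mult_left_mono co')
      also have "\<dots> = K * (C * sqrt (Q x))" by (simp add: K_def sum_distrib_right)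
      finally show ?thesis unfolding zlin_def by linarith
    qed
    have "norm x \<le> (\<Sum>j\<in>{1..n}. \<bar>x \<bullet> unit_vec j\<bar>)"
    proof -
      have "norm x = norm (\<Sum>j\<in>{1..n}. (x \<bullet> unit_vec j) *\<^sub>R (unit_vec j :: 'x))" using arg_cong[OF Rspace_expand[OF that n(2)], of norm] .
      also have "\<dots> \<le> (\<Sum>j\<in>{1..n}. norm ((x \<bullet> unit_vec j) *\<^sub>R (unit_vec j :: 'x)))" by (rule norm_sum)
      also have "\<dots> = (\<Sum>j\<in>{1..n}. \<bar>x \<bullet> unit_vec j\<bar>)"
        by (rule sum.cong) (use n in \<open>auto simp: norm_unit_vec\<close>)
      finally show ?thesis .
    qed
    also have "\<dots> = (\<Sum>j = 1..n - 1. \<bar>x \<bullet> unit_vec j\<bar>) + \<bar>x \<bullet> unit_vec n\<bar>"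
      using n by (cases n) auto
    also have "\<dots> \<le> real (n - 1) * (C * sqrt (Q x)) + (\<bar>zlin n k x\<bar> + K * (C * sqrt (Q x)))"
      using sum_bounded_above[of "{1..n - 1}" "\<lambda>j. \<bar>x \<bullet> unit_vec j\<bar>" "C * sqrt (Q x)"] co' last
      by (intro add_mono) auto
    also have "\<dots> \<le> C' * sqrt (Q x) + C' * \<bar>zlin n k x\<bar>"
    proof -
      have "real (n - 1) * (C * sqrt (Q x)) + K * (C * sqrt (Q x)) \<le> C' * sqrt (Q x)"
        using mult_right_mono[of "real (n - 1) * C + K * C" C' "sqrt (Q x)"] c q0 by (simp add: C'_def algebra_simps)
      moreover have "1 * \<bar>zlin n k x\<bar> \<le> C' * \<bar>zlin n k x\<bar>"
        using c K by (intro mult_right_mono) (auto simp: C'_def intro!: add_nonneg_nonneg)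
      ultimately show ?thesis by simp
    qed
    finally show ?thesis by (simp add: algebra_simps)
  qed
  moreover have "DQ x (chain_A n x + s *\<^sub>R unit_vec n) \<le> - c * Q x + C' * (zlin n k x)\<^sup>2" for x s
    using dec[of x s] mult_right_mono[OF C'(2), of "(zlin n k x)\<^sup>2"] by (simp add: op)
  ultimately show ?thesis using that[of c C' Q DQ] c(1) C'(1) Q by blast
qed

section \<open>The reference generator\<close>

lemma deriv_facts_of_hessian:
  fixes f :: "real \<Rightarrow> real"
  assumes C2: "Ck_on 2 UNIV f" and l: "\<And>s. l \<le> deriv (deriv f) s" and u: "\<And>s. deriv (deriv f) s \<le> u"
    and l0: "0 < l"
  shows "(f has_real_derivative deriv f x) (at x)"
    and "l * (x - y)\<^sup>2 \<le> (deriv f x - deriv f y) * (x - y)"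
    and "\<bar>deriv f x - deriv f y\<bar> \<le> u * \<bar>x - y\<bar>"
    and "continuous_on UNIV (deriv f)"
proof -
  have d1: "f differentiable (at x)" for x
    using C2 by (auto simp: numeral_2_eq_2 differentiable_on_def)
  then have df: "(f has_real_derivative deriv f x) (at x)" for x
    by (simp add: DERIV_deriv_iff_real_differentiable)
  then show "(f has_real_derivative deriv f x) (at x)" .
  have "frechet_derivative f (at x) = (\<lambda>h. deriv f x * h)" for x
    by (rule frechet_derivative_at[symmetric]) (use df[of x] in \<open>simp add: has_field_derivative_def\<close>)
  then have eq: "(\<lambda>x. frechet_derivative f (at x within UNIV) 1) = deriv f" by auto
  have "Ck_on 1 UNIV (\<lambda>x. frechet_derivative f (at x within UNIV) 1)"
    using C2 unfolding numeral_2_eq_2 Ck_on.simps(2)[of "Suc 0"] One_nat_def by blast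
  then have "(deriv f) differentiable (at x)" for x
    unfolding eq by (auto simp: differentiable_on_def)
  then have d2: "(deriv f has_real_derivative deriv (deriv f) x) (at x)" for x
    by (simp add: DERIV_deriv_iff_real_differentiable)
  then show "continuous_on UNIV (deriv f)"
    by (intro continuous_at_imp_continuous_on ballI DERIV_isCont)
  have "\<exists>s. deriv f x - deriv f y = (x - y) * s \<and> l \<le> s \<and> s \<le> u"
  proof -
    have *: "\<exists>s. deriv f x - deriv f y = (x - y) * s \<and> l \<le> s \<and> s \<le> u" if "y < x" for x y
      using MVT2[OF that d2] l u by blast
    consider "x < y" | "x = y" | "y < x" by linarith
    then show ?thesis
    proof cases
      case 1
      then obtain s where "deriv f y - deriv f x = (y - x) * s" "l \<le> s" "s \<le> u" using * by blast
      then show ?thesis by (intro exI[of _ s]) (auto simp: algebra_simps)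
    next
      case 2
      then show ?thesis using order_trans[OF l u] by (auto intro!: exI[of _ l])
    qed (use * in blast)
  qed
  then obtain s where s: "deriv f x - deriv f y = (x - y) * s" "l \<le> s" "s \<le> u" by blast
  show "l * (x - y)\<^sup>2 \<le> (deriv f x - deriv f y) * (x - y)"
    unfolding s using mult_right_mono[OF s(2), of "(x - y)\<^sup>2"] by (simp add: power2_eq_square ac_simps)
  show "\<bar>deriv f x - deriv f y\<bar> \<le> u * \<bar>x - y\<bar>"
    unfolding s abs_mult using s l0 by (simp add: mult.commute mult_right_mono)
qed

text \<open>The sum of the derivatives increases at rate at least \<open>c\<close>. This gives a
  zero by the intermediate value theorem, and a definite sign on either side of it.\<close>

lemma strongly_convex_sum_minimizer:
  fixes f :: "'n::finite \<Rightarrow> real \<Rightarrow> real"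
  assumes der: "\<And>i x. (f i has_real_derivative f' i x) (at x)"
    and cont: "\<And>i. continuous_on UNIV (f' i)"
    and l: "0 < l" "\<And>i x y. l * (x - y)\<^sup>2 \<le> (f' i x - f' i y) * (x - y)"
  obtains ystar where "(\<Sum>i\<in>UNIV. f' i ystar) = 0"
    and "\<And>y. is_arg_min (\<lambda>s. \<Sum>i\<in>UNIV. f i s) (\<lambda>_. True) y \<longleftrightarrow> y = ystar"
proof -
  define S where "S x = (\<Sum>i\<in>UNIV. f' i x)" for x
  define c where "c = l * CARD('n)"
  have c: "0 < c" using l by (simp add: c_def)
  have Sm: "c * (x - y)\<^sup>2 \<le> (S x - S y) * (x - y)" for x y
    using sum_mono[of UNIV "\<lambda>_::'n. l * (x - y)\<^sup>2" "\<lambda>i. (f' i x - f' i y) * (x - y)"] l(2)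
    unfolding sum_distrib_right[symmetric] sum_subtractf
    by (simp add: S_def c_def ac_simps)
  have inc: "c * (x - y) \<le> S x - S y" if "y < x" for x y
    using Sm[of x y] that by (simp add: power2_eq_square mult.assoc[symmetric])
  have contS: "continuous_on A S" for A
    unfolding S_def by (intro continuous_on_sum continuous_on_subset[OF cont]) auto
  \<comment> \<open>On an interval of length M the increase outweighs |S 0|, which gives a sign
    change.\<close>
  define M where "M = \<bar>S 0\<bar> / c + 1"
  have M: "0 < M" "\<bar>S 0\<bar> \<le> c * M" using c by (auto simp: M_def field_simps intro: add_nonneg_pos)
  have "S (-M) \<le> 0" "0 \<le> S M"
    using inc[of 0 M] inc[of "-M" 0] M by auto
  then obtain ystar where ys: "S ystar = 0"
    using IVT'[of S "-M" 0 M] contS M by auto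
  define \<Phi> where "\<Phi> s = (\<Sum>i\<in>UNIV. f i s)" for s
  have d\<Phi>: "(\<Phi> has_real_derivative S x) (at x)" for x
    unfolding \<Phi>_def S_def by (intro DERIV_sum der)
  have less: "\<Phi> ystar < \<Phi> y" if "y \<noteq> ystar" for y
  proof (cases "ystar < y")
    case True
    from MVT2[OF this d\<Phi>] obtain z where z: "ystar < z" "\<Phi> y - \<Phi> ystar = (y - ystar) * S z" by auto
    have "0 < S z" using inc[OF z(1)] ys c z(1) by (smt (verit) mult_pos_pos)
    then show ?thesis using z True by (smt (verit) mult_pos_pos)
  next
    case False
    then have "y < ystar" using that by simp
    from MVT2[OF this d\<Phi>] obtain z where z: "z < ystar" "\<Phi> ystar - \<Phi> y = (ystar - y) * S z" by auto
    have "S z < 0" using inc[OF z(1)] ys c z(1) by (smt (verit) mult_pos_pos)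
    then show ?thesis using z \<open>y < ystar\<close> by (smt (verit) mult_pos_neg)
  qed
  have "is_arg_min (\<lambda>s. \<Sum>i\<in>UNIV. f i s) (\<lambda>_. True) y \<longleftrightarrow> y = ystar" for y
    using less unfolding is_arg_min_def \<Phi>_def[symmetric] by (metis less_irrefl less_asym)
  then show ?thesis using that ys by (simp add: S_def)
qed

section \<open>Laplacians of weight-balanced, strongly connected digraphs\<close>

definition laplacian :: "('n::finite \<Rightarrow> 'n \<Rightarrow> real) \<Rightarrow> real^'n \<Rightarrow> real^'n" where
  "laplacian a x = (\<chi> i. \<Sum>j\<in>UNIV. a i j * (x $ i - x $ j))"

text \<open>Orthogonal projection onto the vectors of zero sum, the complement of the consensus
  direction.\<close>

definition center :: "real^'n \<Rightarrow> real^'n" where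
  "center x = x - (\<chi> i. (\<Sum>j\<in>UNIV. x $ j) / CARD('n))"

lemma linear_laplacian: "linear (laplacian a)"
  by (rule linearI)
    (simp_all add: laplacian_def vec_eq_iff algebra_simps sum.distrib sum_subtractf sum_distrib_left)

lemma linear_center: "linear center"
  by (rule linearI)
    (simp_all add: center_def vec_eq_iff sum.distrib sum_distrib_left[symmetric] add_divide_distrib algebra_simps)

lemma sum_center: "(\<Sum>i\<in>UNIV. center x $ i) = 0"
  by (simp add: center_def sum_subtractf)

lemma inner_center: "center x \<bullet> center y = center x \<bullet> y"
proof -
  have "center x \<bullet> (\<chi> i. c) = 0" for c :: real
    using sum_center[of x] by (simp add: inner_vec_def sum_distrib_right[symmetric])
  then show ?thesis by (simp add: center_def[of y] inner_diff_right)
qed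

lemma norm_center_le: "norm (center x) \<le> norm x"
proof -
  have "norm (center x) * norm (center x) \<le> norm (center x) * norm x"
    using inner_center[of x x] norm_cauchy_schwarz[of "center x" x]
    by (simp add: power2_norm_eq_inner[symmetric] power2_eq_square)
  then show ?thesis by (cases "norm (center x) = 0") auto
qed

lemma laplacian_const: "laplacian a (\<chi> i. c) = 0"
  by (simp add: laplacian_def vec_eq_iff)

lemma laplacian_center: "laplacian a (center x) = laplacian a x"
  by (simp add: center_def linear_diff[OF linear_laplacian] laplacian_const)

locale balanced_graph =
  fixes a :: "'n::finite \<Rightarrow> 'n \<Rightarrow> real"
  assumes nonneg: "0 \<le> a i j"
    and balanced: "(\<Sum>j\<in>UNIV. a i j) = (\<Sum>j\<in>UNIV. a j i)"
    and connected: "(i, j) \<in> {(j, i). 0 < a i j}\<^sup>*"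
begin

text \<open>How weight balance stands in for symmetry: in a sum over edges, a function of one end
  point may be replaced by the same function of the other.\<close>

lemma balanced_swap: "(\<Sum>i\<in>UNIV. \<Sum>j\<in>UNIV. a i j * g j) = (\<Sum>i\<in>UNIV. \<Sum>j\<in>UNIV. a i j * g i)"
proof -
  have "(\<Sum>i\<in>UNIV. \<Sum>j\<in>UNIV. a i j * g j) = (\<Sum>j\<in>UNIV. \<Sum>i\<in>UNIV. a i j * g j)" by (rule sum.swap)
  also have "\<dots> = (\<Sum>j\<in>UNIV. (\<Sum>i\<in>UNIV. a j i) * g j)" by (simp add: sum_distrib_right[symmetric] balanced)
  finally show ?thesis by (simp add: sum_distrib_right)
qed

lemma sum_laplacian: "(\<Sum>i\<in>UNIV. laplacian a x $ i) = 0"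
  using balanced_swap[of "\<lambda>i. x $ i"] by (simp add: laplacian_def right_diff_distrib sum_subtractf)

text \<open>By \<open>balanced_swap\<close> the pure squares cancel, which leaves the Dirichlet form
  familiar from undirected graphs.\<close>

lemma inner_laplacian: "x \<bullet> laplacian a x = (\<Sum>i\<in>UNIV. \<Sum>j\<in>UNIV. a i j * (x $ i - x $ j)\<^sup>2) / 2"
proof -
  have "(\<Sum>i\<in>UNIV. \<Sum>j\<in>UNIV. a i j * (x $ i - x $ j)\<^sup>2)
      = (\<Sum>i\<in>UNIV. \<Sum>j\<in>UNIV. (2 * (x $ i * (a i j * (x $ i - x $ j))) + a i j * (x $ j)\<^sup>2 - a i j * (x $ i)\<^sup>2))"
    by (intro sum.cong refl) (simp add: power2_eq_square algebra_simps)
  also have "\<dots> = 2 * (\<Sum>i\<in>UNIV. \<Sum>j\<in>UNIV. x $ i * (a i j * (x $ i - x $ j)))"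
    using balanced_swap[of "\<lambda>i. (x $ i)\<^sup>2"] by (simp add: sum.distrib sum_subtractf sum_distrib_left)
  also have "(\<Sum>i\<in>UNIV. \<Sum>j\<in>UNIV. x $ i * (a i j * (x $ i - x $ j))) = x \<bullet> laplacian a x"
    by (simp add: inner_vec_def laplacian_def sum_distrib_left)
  finally show ?thesis by simp
qed

lemma inner_laplacian_nonneg: "0 \<le> x \<bullet> laplacian a x"
  unfolding inner_laplacian using nonneg by (auto intro!: sum_nonneg)

lemma inner_laplacian_eq_0:
  assumes "x \<bullet> laplacian a x = 0" shows "x $ i = x $ j"
proof -
  have "(\<Sum>i\<in>UNIV. \<Sum>j\<in>UNIV. a i j * (x $ i - x $ j)\<^sup>2) = 0"
    using assms unfolding inner_laplacian by simp
  then have "\<forall>i j. a i j * (x $ i - x $ j)\<^sup>2 = 0"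
    using nonneg by (simp add: sum_nonneg_eq_0_iff sum_nonneg)
  then have edge: "x $ i = x $ j" if "0 < a i j" for i j
    using that by (metis less_irrefl mult_eq_0_iff power2_eq_square right_minus_eq)
  from connected[of i j] show ?thesis
    by (induction rule: rtrancl_induct) (auto dest: edge)
qed

text \<open>The form attains its minimum on the unit sphere of the zero-sum vectors. The minimum is
  positive, because a zero of the form is a constant vector; homogeneity does the rest.\<close>

lemma laplacian_coercive:
  obtains c where "0 < c" "\<And>x. c * (norm (center x))\<^sup>2 \<le> center x \<bullet> laplacian a (center x)"
proof -
  define S where "S = {x :: real^'n. norm x = 1 \<and> (\<Sum>i\<in>UNIV. x $ i) = 0}"
  have "S = sphere 0 1 \<inter> {x. (\<Sum>i\<in>UNIV. x $ i) = 0}" by (auto simp: S_def)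
  moreover have "closed {x :: real^'n. (\<Sum>i\<in>UNIV. x $ i) = 0}"
    by (intro closed_Collect_eq continuous_intros)
  ultimately have S: "compact S" by (auto intro: compact_Int_closed)
  have cont: "continuous_on S (\<lambda>x. x \<bullet> laplacian a x)"
    by (intro continuous_on_inner continuous_on_id linear_continuous_on)
      (use linear_laplacian in \<open>simp add: linear_conv_bounded_linear\<close>)
  have "\<exists>c>0. \<forall>x\<in>S. c \<le> x \<bullet> laplacian a x"
  \<comment> \<open>With a single agent the sphere is empty and every \<open>center x\<close>
    vanishes.\<close>
  proof (cases "S = {}")
    case False
    from continuous_attains_inf[OF S False cont] obtain x where
      x: "x \<in> S" "\<And>y. y \<in> S \<Longrightarrow> x \<bullet> laplacian a x \<le> y \<bullet> laplacian a y" by blast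
    have "x \<bullet> laplacian a x \<noteq> 0"
    proof
      assume "x \<bullet> laplacian a x = 0"
      then have eq: "x $ i = x $ j" for i j by (rule inner_laplacian_eq_0)
      have "x $ i = 0" for i
      proof -
        have "(\<Sum>j\<in>UNIV. x $ j) = (\<Sum>j\<in>(UNIV :: 'n set). x $ i)" by (intro sum.cong refl eq)
        then show ?thesis using x(1) by (simp add: S_def)
      qed
      then have "x = 0" by (simp add: vec_eq_iff)
      then show False using x(1) by (simp add: S_def)
    qed
    then show ?thesis using x(2) inner_laplacian_nonneg[of x] by (intro exI[of _ "x \<bullet> laplacian a x"]) auto
  qed (auto intro: exI[of _ 1])
  then obtain c where c: "0 < c" "\<And>x. x \<in> S \<Longrightarrow> c \<le> x \<bullet> laplacian a x" by blast
  have "c * (norm (center x))\<^sup>2 \<le> center x \<bullet> laplacian a (center x)" for x :: "real^'n"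
  proof (cases "center x = 0")
    case False
    define y where "y = (1 / norm (center x)) *\<^sub>R center x"
    have "(\<Sum>i\<in>UNIV. y $ i) = 0"
      using sum_center[of x] by (simp add: y_def sum_divide_distrib[symmetric])
    then have y: "y \<in> S" using False by (simp add: S_def y_def)
    have cy: "norm (center x) *\<^sub>R y = center x" using False by (simp add: y_def)
    have "(s *\<^sub>R y) \<bullet> laplacian a (s *\<^sub>R y) = s\<^sup>2 * (y \<bullet> laplacian a y)" for s
      by (simp add: linear_scale[OF linear_laplacian] power2_eq_square)
    from this[of "norm (center x)"]
    have eq: "center x \<bullet> laplacian a (center x) = (norm (center x))\<^sup>2 * (y \<bullet> laplacian a y)"
      unfolding cy .
    show ?thesis
      unfolding eq using mult_left_mono[OF c(2)[OF y], of "(norm (center x))\<^sup>2"] by (simp add: mult.commute)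
  qed simp
  then show ?thesis using that c(1) by blast
qed

text \<open>Adding the all-ones matrix \<open>J\<close> fills the kernel, so the sum is invertible.
  The column sums of the Laplacian vanish, hence a right-hand side of zero sum forces
  \<open>J x = 0\<close>.\<close>

lemma laplacian_surj:
  assumes "(\<Sum>i\<in>UNIV. u $ i) = 0"
  obtains x where "laplacian a x = u"
proof -
  define J :: "real^'n \<Rightarrow> real^'n" where "J x = (\<chi> i. \<Sum>j\<in>UNIV. x $ j)" for x
  have lin: "linear (\<lambda>x. laplacian a x + J x)"
    by (intro linear_compose_add linear_laplacian linearI)
      (simp_all add: J_def vec_eq_iff sum.distrib sum_distrib_left)
  have "inj (\<lambda>x. laplacian a x + J x)"
    unfolding linear_injective_0[OF lin]
  proof (intro allI impI)
    fix x assume 0: "laplacian a x + J x = 0"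
    have "x \<bullet> J x = (\<Sum>j\<in>UNIV. x $ j)\<^sup>2"
      by (simp add: J_def inner_vec_def sum_distrib_right[symmetric] power2_eq_square)
    then have "x \<bullet> laplacian a x + (\<Sum>j\<in>UNIV. x $ j)\<^sup>2 = x \<bullet> (laplacian a x + J x)"
      by (simp add: inner_add_right)
    then have z: "x \<bullet> laplacian a x = 0" "(\<Sum>j\<in>UNIV. x $ j) = 0"
      using 0 inner_laplacian_nonneg[of x] by (auto simp: add_nonneg_eq_0_iff)
    have "x $ i = 0" for i
    proof -
      have "(\<Sum>j\<in>UNIV. x $ j) = (\<Sum>j\<in>(UNIV :: 'n set). x $ i)"
        by (intro sum.cong refl inner_laplacian_eq_0 z)
      then show ?thesis using z by simp
    qed
    then show "x = 0" by (simp add: vec_eq_iff)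
  qed
  then have "surj (\<lambda>x. laplacian a x + J x)" by (rule linear_inj_imp_surj[OF lin])
  from surjD[OF this, of u] obtain x where x: "laplacian a x + J x = u" by auto
  have "(\<Sum>i\<in>UNIV. (laplacian a x + J x) $ i) = 0" using assms x by simp
  then have "(\<Sum>j\<in>UNIV. x $ j) = 0"
    by (simp add: sum.distrib sum_laplacian J_def)
  then have "J x = 0" by (simp add: J_def vec_eq_iff)
  then show ?thesis using that x by simp
qed

end

section \<open>A Lyapunov function for the reference generator\<close>

lemma has_vector_derivative_vec:
  fixes f :: "'n::finite \<Rightarrow> real \<Rightarrow> 'b::euclidean_space"
  assumes "\<And>i. (f i has_vector_derivative f' i) F"
  shows "((\<lambda>t. \<chi> i. f i t) has_vector_derivative (\<chi> i. f' i)) F"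
proof -
  have vec: "(\<chi> i. g i) = (\<Sum>i\<in>UNIV. axis i (g i))" for g :: "'n \<Rightarrow> 'b"
    by (auto simp: vec_eq_iff axis_def if_distrib cong: if_cong)
  have lin: "bounded_linear (axis i :: 'b \<Rightarrow> 'b^'n)" for i
    unfolding linear_conv_bounded_linear[symmetric]
    by (rule linearI) (simp_all add: axis_def vec_eq_iff)
  show ?thesis
    unfolding vec by (intro has_vector_derivative_sum bounded_linear.has_vector_derivative[OF lin] assms)
qed

lemma has_real_derivative_inner_self:
  fixes f :: "real \<Rightarrow> 'a::real_inner"
  assumes "(f has_vector_derivative f') (at t within S)"
  shows "((\<lambda>t. f t \<bullet> f t) has_real_derivative 2 * (f t \<bullet> f')) (at t within S)"
proof -
  have "((\<lambda>t. f t \<bullet> f t) has_derivative (\<lambda>h. f t \<bullet> (h *\<^sub>R f') + (h *\<^sub>R f') \<bullet> f t)) (at t within S)"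
    using assms unfolding has_vector_derivative_def by (intro has_derivative_inner)
  moreover have "(\<lambda>h. f t \<bullet> (h *\<^sub>R f') + (h *\<^sub>R f') \<bullet> f t) = (*) (2 * (f t \<bullet> f'))"
    by (simp add: fun_eq_iff inner_commute)
  ultimately show ?thesis
    unfolding has_field_derivative_def by simp
qed

context balanced_graph
begin

text \<open>The gradient flow of the reference generator, with \<open>\<alpha> = 1\<close>.\<close>

definition ref_field :: "('n \<Rightarrow> real \<Rightarrow> real) \<Rightarrow> real \<Rightarrow> real^'n \<Rightarrow> real^'n \<Rightarrow> real^'n" where
  "ref_field f' \<beta> r v = - (\<chi> i. f' i (r $ i)) - \<beta> *\<^sub>R laplacian a r - laplacian a v"

text \<open>Write L for the Laplacian, x = r - y* and q = v - vs + x. The derivative of q is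
  -\<Phi>(x) + L x - L q, free of \<beta>, whereas x is damped by -(\<beta> - 1) L x. So \<beta> can
  be raised until it beats the cross terms that see only the disagreement part of x. Only
  \<open>center q\<close> enters V, since L is blind to the mean of v; the sum of the entries of v
  therefore appears separately in the bound on v.\<close>

lemma reference_lyapunov:
  fixes f' :: "'n \<Rightarrow> real \<Rightarrow> real"
  assumes l: "0 < l" "\<And>i x y. l * (x - y)\<^sup>2 \<le> (f' i x - f' i y) * (x - y)"
    and u: "\<And>i x y. \<bar>f' i x - f' i y\<bar> \<le> u * \<bar>x - y\<bar>"
    and ystar: "(\<Sum>i\<in>UNIV. f' i ystar) = 0"
  obtains \<beta> V D C B where "0 < \<beta>"
    "\<And>r v. 0 \<le> V r v"
    "\<And>r v. (norm (r - (\<chi> i. ystar)))\<^sup>2 + (norm (ref_field f' \<beta> r v))\<^sup>2 \<le> C * V r v"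
    "\<And>r v. D r v \<le> - ((norm (r - (\<chi> i. ystar)))\<^sup>2 + (norm (ref_field f' \<beta> r v))\<^sup>2)"
    "\<And>r v t S. (r has_vector_derivative ref_field f' \<beta> (r t) (v t)) (at t within S) \<Longrightarrow>
      (v has_vector_derivative \<beta> *\<^sub>R laplacian a (r t)) (at t within S) \<Longrightarrow>
      ((\<lambda>t. V (r t) (v t)) has_real_derivative D (r t) (v t)) (at t within S)"
    "\<And>r v. norm v \<le> B * (1 + V r v + \<bar>\<Sum>i\<in>UNIV. v $ i\<bar>)"
proof -
  obtain c where c: "0 < c" "\<And>x. c * (norm (center x))\<^sup>2 \<le> center x \<bullet> laplacian a (center x)"
    using laplacian_coercive by blast
  obtain K where K: "0 < K" "\<And>x. norm (laplacian a x) \<le> K * norm x"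
    using linear_bounded_pos[OF linear_laplacian] by blast
  define one :: "real^'n" where "one = (\<chi> i. 1)"
  define ys :: "real^'n" where "ys = (\<chi> i. ystar)"
  have ys_one: "ys = ystar *\<^sub>R one" by (simp add: ys_def one_def vec_eq_iff)
  have "(\<Sum>i\<in>UNIV. (- (\<chi> i. f' i ystar)) $ i) = 0" using ystar by (simp add: sum_negf)
  \<comment> \<open>The individual gradients need not vanish at y*; at the equilibrium they are
    balanced by v, which is possible because they sum to 0.\<close>
  then obtain vs where vs: "laplacian a vs = - (\<chi> i. f' i ystar)"
    by (rule laplacian_surj) simp
  define \<Phi> :: "real^'n \<Rightarrow> real^'n" where "\<Phi> x = (\<chi> i. f' i (x $ i + ystar) - f' i ystar)" for x
  have u0: "l \<le> u"
    using l(2)[of 1 0 undefined] u[of undefined 1 0] by (simp add: power2_eq_square abs_le_iff)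
  have \<Phi>l: "l * (norm x)\<^sup>2 \<le> x \<bullet> \<Phi> x" for x
  proof -
    have "l * (norm x)\<^sup>2 = (\<Sum>i\<in>UNIV. l * (x $ i)\<^sup>2)"
      unfolding power2_norm_eq_inner inner_vec_def sum_distrib_left by (simp add: power2_eq_square)
    also have "\<dots> \<le> (\<Sum>i\<in>UNIV. x $ i * (f' i (x $ i + ystar) - f' i ystar))"
    proof (rule sum_mono)
      fix i
      show "l * (x $ i)\<^sup>2 \<le> x $ i * (f' i (x $ i + ystar) - f' i ystar)"
        using l(2)[of "x $ i + ystar" ystar i] by (simp add: mult.commute)
    qed
    finally show ?thesis by (simp add: \<Phi>_def inner_vec_def)
  qed
  have \<Phi>u: "norm (\<Phi> x) \<le> u * norm x" for x
  proof -
    have "norm (\<Phi> x) \<le> norm (u *\<^sub>R x)"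
      unfolding norm_vec_def
    proof (rule L2_set_mono)
      fix i
      show "norm (\<Phi> x $ i) \<le> norm ((u *\<^sub>R x) $ i)"
        using u[of i "x $ i + ystar" ystar] u0 l(1) by (simp add: \<Phi>_def abs_mult)
    qed simp
    then show ?thesis using u0 l by simp
  qed
  \<comment> \<open>Small enough for the convexity constant \<open>l\<close> to absorb the product
    of \<open>center q\<close> with \<Phi>(x), which sees the mean of x and is out of reach of
    \<beta>.\<close>
  define \<epsilon> where "\<epsilon> = c * l / (2 * u\<^sup>2)"
  have \<epsilon>: "0 < \<epsilon>" "\<epsilon> * u\<^sup>2 = c * l / 2" using c l u0 by (auto simp: \<epsilon>_def power2_eq_square)
  define M where "M = (1 + \<epsilon>) * K"
  \<comment> \<open>From Young's inequality: the damping of \<open>center x\<close> has to absorb M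
    |center x| |center q| at the cost of a quarter of the damping of
    \<open>center q\<close>.\<close>
  define \<beta> where "\<beta> = 1 + M\<^sup>2 / (\<epsilon> * c\<^sup>2)"
  have \<beta>: "0 < \<beta>" "1 \<le> \<beta>" "(\<beta> - 1) * c = M\<^sup>2 / (\<epsilon> * c)"
    using \<epsilon> c by (auto simp: \<beta>_def power2_eq_square intro: add_pos_nonneg)
  define R where "R = ref_field f' \<beta>"
  have R: "R (x + ys) (q - x + vs) = - \<Phi> x - (\<beta> - 1) *\<^sub>R laplacian a x - laplacian a q" for x q
  proof -
    have "laplacian a (x + ys) = laplacian a x"
      by (simp add: linear_add[OF linear_laplacian] laplacian_const ys_def)
    moreover have "laplacian a (q - x + vs) = laplacian a q - laplacian a x - (\<chi> i. f' i ystar)"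
      by (simp add: linear_add[OF linear_laplacian] linear_diff[OF linear_laplacian] vs)
    ultimately show ?thesis
      by (simp add: R_def ref_field_def \<Phi>_def ys_def vec_eq_iff algebra_simps)
  qed
  \<comment> \<open>The derivative of |x|^2 / 2 + \<epsilon> |center q|^2 / 2 along the flow, before
    scaling by \<open>s\<close>.\<close>
  define D0 where "D0 x q = x \<bullet> R (x + ys) (q - x + vs)
      + \<epsilon> * (center q \<bullet> (\<beta> *\<^sub>R laplacian a x + R (x + ys) (q - x + vs)))" for x q
  have D0: "D0 x q \<le> - (l / 2) * (norm x)\<^sup>2 - (\<epsilon> * c / 2) * (norm (center q))\<^sup>2" for x q
  proof -
    define A B P where "A = norm x" "B = norm (center q)" "P = norm (center x)"
    have ABP: "0 \<le> A" "0 \<le> B" "0 \<le> P" by (auto simp: A_B_P_def)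
    \<comment> \<open>By weight balance, constants are orthogonal to the range of the
      Laplacian.\<close>
    have lap_inner: "z \<bullet> laplacian a y = center z \<bullet> laplacian a y" for z y
    proof -
      have "(\<chi> i. k) \<bullet> laplacian a y = 0" for k :: real
        using sum_laplacian[of y] by (simp add: inner_vec_def sum_distrib_left[symmetric])
      then show ?thesis by (simp add: center_def inner_diff_left)
    qed
    have t1: "l * A\<^sup>2 \<le> x \<bullet> \<Phi> x" unfolding A_B_P_def by (rule \<Phi>l)
    have t2: "c * P\<^sup>2 \<le> x \<bullet> laplacian a x"
      using c(2)[of x] by (simp add: A_B_P_def lap_inner[of x] laplacian_center)
    have t3: "\<bar>x \<bullet> laplacian a q\<bar> \<le> P * (K * B)"
      using Cauchy_Schwarz_ineq2[of "center x" "laplacian a (center q)"]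
        mult_left_mono[OF K(2)[of "center q"], of "norm (center x)"]
      by (simp add: A_B_P_def lap_inner[of x] laplacian_center)
    have t4: "\<bar>center q \<bullet> \<Phi> x\<bar> \<le> B * (u * A)"
      using Cauchy_Schwarz_ineq2[of "center q" "\<Phi> x"] mult_left_mono[OF \<Phi>u[of x], of "norm (center q)"]
      by (simp add: A_B_P_def)
    have t5: "c * B\<^sup>2 \<le> center q \<bullet> laplacian a q"
      using c(2)[of q] by (simp add: A_B_P_def laplacian_center)
    have t6: "\<bar>center q \<bullet> laplacian a x\<bar> \<le> B * (K * P)"
      using Cauchy_Schwarz_ineq2[of "center q" "laplacian a (center x)"]
        mult_left_mono[OF K(2)[of "center x"], of "norm (center q)"]
      by (simp add: A_B_P_def laplacian_center)
    have "D0 x q = - (x \<bullet> \<Phi> x) - (\<beta> - 1) * (x \<bullet> laplacian a x) - x \<bullet> laplacian a q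
        + \<epsilon> * (- (center q \<bullet> \<Phi> x) - center q \<bullet> laplacian a q + center q \<bullet> laplacian a x)"
      unfolding D0_def R by (simp add: inner_diff_right inner_add_right algebra_simps)
    also have "\<dots> \<le> - (l * A\<^sup>2) - (\<beta> - 1) * (c * P\<^sup>2) + P * (K * B)
        + \<epsilon> * (B * (u * A) - c * B\<^sup>2 + B * (K * P))"
      using t1 mult_left_mono[OF t2, of "\<beta> - 1"] t3 t4 t5 t6 \<beta>(2) \<epsilon>(1)
      by (intro add_mono mult_left_mono diff_mono) auto
    also have "\<dots> = - (l * A\<^sup>2) - (M\<^sup>2 / (\<epsilon> * c)) * P\<^sup>2 + M * P * B + \<epsilon> * u * A * B - \<epsilon> * c * B\<^sup>2"
    proof -
      have e1: "(\<beta> - 1) * (c * P\<^sup>2) = (M\<^sup>2 / (\<epsilon> * c)) * P\<^sup>2"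
        using \<beta>(3) by (metis mult.assoc)
      have e2: "P * (K * B) + \<epsilon> * (B * (K * P)) = M * P * B" by (simp add: M_def algebra_simps)
      have "- (l * A\<^sup>2) - X + P * (K * B) + \<epsilon> * (B * (u * A) - c * B\<^sup>2 + B * (K * P))
        = - (l * A\<^sup>2) - X + (P * (K * B) + \<epsilon> * (B * (K * P))) + \<epsilon> * u * A * B - \<epsilon> * c * B\<^sup>2" for X
        by (simp add: algebra_simps)
      then show ?thesis unfolding e1 e2 .
    qed
    also have "\<dots> \<le> - (l / 2) * A\<^sup>2 - (\<epsilon> * c / 2) * B\<^sup>2"
    proof -
      have y1: "M * P * B \<le> (M\<^sup>2 / (\<epsilon> * c)) * P\<^sup>2 + (\<epsilon> * c / 4) * B\<^sup>2"
      proof -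
        have "0 \<le> (M * P - (\<epsilon> * c / 2) * B)\<^sup>2 / (\<epsilon> * c)" using \<epsilon> c by simp
        also have "\<dots> = (M\<^sup>2 / (\<epsilon> * c)) * P\<^sup>2 + (\<epsilon> * c / 4) * B\<^sup>2 - M * P * B"
          using \<epsilon> c by (simp add: power2_eq_square field_simps)
        finally show ?thesis by simp
      qed
      have y2: "\<epsilon> * u * A * B \<le> (l / 2) * A\<^sup>2 + (\<epsilon> * c / 4) * B\<^sup>2"
      proof -
        have "0 \<le> (l * A - \<epsilon> * u * B)\<^sup>2 / (2 * l)" using l by simp
        also have "\<dots> = (l / 2) * A\<^sup>2 + \<epsilon> * (\<epsilon> * u\<^sup>2) / (2 * l) * B\<^sup>2 - \<epsilon> * u * A * B"
          using l by (simp add: power2_eq_square field_simps)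
        also have "\<epsilon> * (\<epsilon> * u\<^sup>2) / (2 * l) = \<epsilon> * c / 4" unfolding \<epsilon>(2) using l by simp
        finally show ?thesis by simp
      qed
      show ?thesis using y1 y2 by (simp add: algebra_simps)
    qed
    finally show ?thesis by (simp add: A_B_P_def)
  qed
  define N where "N = u + (\<beta> - 1) * K + K"
  have N: "0 < N" using u0 l \<beta> K by (auto simp: N_def intro!: add_nonneg_pos)
  have Rbound: "(norm (R (x + ys) (q - x + vs)))\<^sup>2 \<le> 2 * N\<^sup>2 * ((norm x)\<^sup>2 + (norm (center q))\<^sup>2)" for x q
  proof -
    have "norm (R (x + ys) (q - x + vs)) \<le> norm (\<Phi> x) + norm ((\<beta> - 1) *\<^sub>R laplacian a x) + norm (laplacian a (center q))"
      unfolding R laplacian_center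
      using norm_triangle_ineq4[of "- \<Phi> x - (\<beta> - 1) *\<^sub>R laplacian a x" "laplacian a q"]
        norm_triangle_ineq4[of "- \<Phi> x" "(\<beta> - 1) *\<^sub>R laplacian a x"] by simp
    also have "\<dots> \<le> u * norm x + (\<beta> - 1) * (K * norm x) + K * norm (center q)"
      using \<Phi>u[of x] K(2)[of x] K(2)[of "center q"] \<beta>(2) by (auto intro!: add_mono mult_left_mono)
    also have "\<dots> \<le> N * (norm x + norm (center q))"
    proof -
      have "0 \<le> K * norm x" "0 \<le> u * norm (center q)" "0 \<le> (\<beta> - 1) * K * norm (center q)"
        using K u0 l \<beta> by auto
      then show ?thesis by (simp add: N_def algebra_simps)
    qed
    finally have "(norm (R (x + ys) (q - x + vs)))\<^sup>2 \<le> (N * (norm x + norm (center q)))\<^sup>2"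
      by (intro power_mono) auto
    also have "\<dots> = N\<^sup>2 * (norm x + norm (center q))\<^sup>2" by (simp add: power_mult_distrib)
    also have "\<dots> \<le> N\<^sup>2 * (2 * ((norm x)\<^sup>2 + (norm (center q))\<^sup>2))"
      using arith_geo_mean_sqrt zero_le_power2[of "norm x - norm (center q)"]
      by (intro mult_left_mono) (auto simp: power2_sum power2_diff)
    finally show ?thesis by (simp add: algebra_simps)
  qed
  define m where "m = min (l / 2) (\<epsilon> * c / 2)"
  have m: "0 < m" "m \<le> l / 2" "m \<le> \<epsilon> * c / 2" using l(1) \<epsilon>(1) c(1) unfolding m_def by simp_all
  define G where "G = 1 + 2 * N\<^sup>2"
  \<comment> \<open>Scaled so that the decay dominates, with coefficient 1, both the squared
    distance to y* and the squared speed of r; these are the disturbances felt by the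
    agents.\<close>
  define s where "s = G / m"
  have G: "1 \<le> G" by (simp add: G_def)
  have s: "0 < s" "s * m = G" using m(1) G by (simp_all add: s_def)
  define V where "V r v = s * ((r - ys) \<bullet> (r - ys) / 2
      + \<epsilon> / 2 * (center (v - vs + (r - ys)) \<bullet> center (v - vs + (r - ys))))" for r v
  define D where "D r v = s * D0 (r - ys) (v - vs + (r - ys))" for r v
  have nonneg_V: "0 \<le> V r v" for r v using s \<epsilon> by (simp add: V_def)
  define w where "w = min (1/2) (\<epsilon> / 2)"
  have mm: "0 < w" "w \<le> 1/2" "w \<le> \<epsilon> / 2" using \<epsilon>(1) unfolding w_def by simp_all
  define C where "C = G / (s * w)"
  have Vlow: "s * w * ((norm (r - ys))\<^sup>2 + (norm (center (v - vs + (r - ys))))\<^sup>2) \<le> V r v" for r v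
  proof -
    have "w * (norm (r - ys))\<^sup>2 \<le> (1/2) * (norm (r - ys))\<^sup>2"
      "w * (norm (center (v - vs + (r - ys))))\<^sup>2 \<le> (\<epsilon>/2) * (norm (center (v - vs + (r - ys))))\<^sup>2"
      by (rule mult_right_mono[OF mm(2)] mult_right_mono[OF mm(3)], simp)+
    then have "w * ((norm (r - ys))\<^sup>2 + (norm (center (v - vs + (r - ys))))\<^sup>2)
       \<le> (1/2) * (norm (r - ys))\<^sup>2 + (\<epsilon>/2) * (norm (center (v - vs + (r - ys))))\<^sup>2"
      by (simp add: distrib_left)
    from mult_left_mono[OF this, of s] s show ?thesis by (simp add: V_def power2_norm_eq_inner mult.assoc)
  qed
  have tot: "(norm (r - ys))\<^sup>2 + (norm (R r v))\<^sup>2 \<le> G * ((norm (r - ys))\<^sup>2 + (norm (center (v - vs + (r - ys))))\<^sup>2)" for r v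
  proof -
    let ?A = "(norm (r - ys))\<^sup>2" and ?B = "(norm (center (v - vs + (r - ys))))\<^sup>2"
    have "(norm (R r v))\<^sup>2 \<le> 2 * N\<^sup>2 * (?A + ?B)"
      using Rbound[of "r - ys" "v - vs + (r - ys)"] by simp
    moreover have "G * (?A + ?B) = ?A + ?B + 2 * N\<^sup>2 * (?A + ?B)" unfolding G_def distrib_right by simp
    moreover have "0 \<le> ?B" by simp
    ultimately show ?thesis by linarith
  qed
  have c3: "(norm (r - ys))\<^sup>2 + (norm (R r v))\<^sup>2 \<le> C * V r v" for r v
  proof -
    have "C * (s * w) = G" using mm(1) s(1) by (simp add: C_def)
    moreover have "0 \<le> C" using mm(1) s(1) G by (simp add: C_def)
    ultimately have "G * ((norm (r - ys))\<^sup>2 + (norm (center (v - vs + (r - ys))))\<^sup>2) \<le> C * V r v"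
      using mult_left_mono[OF Vlow[of r v], of C] by (simp add: mult.assoc[symmetric])
    then show ?thesis using tot[of r v] by linarith
  qed
  have c4: "D r v \<le> - ((norm (r - ys))\<^sup>2 + (norm (R r v))\<^sup>2)" for r v
  proof -
    let ?A = "(norm (r - ys))\<^sup>2" and ?B = "(norm (center (v - vs + (r - ys))))\<^sup>2"
    have "D0 (r - ys) (v - vs + (r - ys)) \<le> - m * (?A + ?B)"
      using D0[of "r - ys" "v - vs + (r - ys)"] mult_right_mono[OF m(2), of ?A] mult_right_mono[OF m(3), of ?B]
      by (simp add: distrib_left)
    then have "D r v \<le> s * (- m * (?A + ?B))" unfolding D_def using s by (intro mult_left_mono) auto
    also have "\<dots> = - (G * (?A + ?B))" unfolding s(2)[symmetric] by (simp add: mult.assoc)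
    finally show ?thesis using tot[of r v] by linarith
  qed
  have c5: "((\<lambda>t. V (r t) (v t)) has_real_derivative D (r t) (v t)) (at t within S)"
    if r: "(r has_vector_derivative R (r t) (v t)) (at t within S)"
      and v: "(v has_vector_derivative \<beta> *\<^sub>R laplacian a (r t)) (at t within S)" for r v t S
  proof -
    have lc: "bounded_linear (center :: real^'n \<Rightarrow> _)" using linear_center by (simp add: linear_conv_bounded_linear)
    have 1: "((\<lambda>t. r t - ys) has_vector_derivative R (r t) (v t)) (at t within S)"
      using has_vector_derivative_diff[OF r has_vector_derivative_const[of ys]] by simp
    have vd: "((\<lambda>t. v t - vs) has_vector_derivative \<beta> *\<^sub>R laplacian a (r t)) (at t within S)"
      using has_vector_derivative_diff[OF v has_vector_derivative_const[of vs]] by simp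
    have 2: "((\<lambda>t. center (v t - vs + (r t - ys))) has_vector_derivative center (\<beta> *\<^sub>R laplacian a (r t) + R (r t) (v t))) (at t within S)"
      by (rule bounded_linear.has_vector_derivative[OF lc has_vector_derivative_add[OF vd 1]])
    have lap: "laplacian a (r t - ys) = laplacian a (r t)"
      by (simp add: linear_diff[OF linear_laplacian] ys_def laplacian_const)
    have "((\<lambda>t. V (r t) (v t)) has_real_derivative
        s * (2 * ((r t - ys) \<bullet> R (r t) (v t)) / 2
          + \<epsilon> / 2 * (2 * (center (v t - vs + (r t - ys)) \<bullet> center (\<beta> *\<^sub>R laplacian a (r t) + R (r t) (v t))))))
        (at t within S)"
      unfolding V_def
      by (intro DERIV_cmult DERIV_add DERIV_cdivide has_real_derivative_inner_self[OF 1] has_real_derivative_inner_self[OF 2])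
    moreover have "D (r t) (v t) = s * ((r t - ys) \<bullet> R (r t) (v t)
          + \<epsilon> * (center (v t - vs + (r t - ys)) \<bullet> center (\<beta> *\<^sub>R laplacian a (r t) + R (r t) (v t))))"
      unfolding D_def D0_def inner_center lap by simp
    ultimately show ?thesis by simp
  qed
  define B where "B = norm vs + 2 + norm one + 2 / (s * w) + \<bar>\<Sum>i\<in>UNIV. vs $ i\<bar> * norm one"
  have c6: "norm v \<le> B * (1 + V r v + \<bar>\<Sum>i\<in>UNIV. v $ i\<bar>)" for r v
  proof -
    let ?q = "v - vs + (r - ys)"
    let ?\<sigma> = "\<Sum>i\<in>UNIV. v $ i"
    define k where "k = 1 / (s * w)"
    have k: "0 < k" using s(1) mm(1) by (simp add: k_def)
    have kV: "(norm (r - ys))\<^sup>2 + (norm (center ?q))\<^sup>2 \<le> k * V r v"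
      using Vlow[of r v] s(1) mm(1) by (simp add: k_def field_simps)
    have sq: "x \<le> 1 + k * V r v" if "x\<^sup>2 \<le> k * V r v" "0 \<le> x" for x
      using that zero_le_power2[of "x - 1"] by (simp add: power2_eq_square algebra_simps)
    have "(norm (r - ys))\<^sup>2 \<le> k * V r v" "(norm (center ?q))\<^sup>2 \<le> k * V r v"
      using kV zero_le_power2[of "norm (center ?q)"] zero_le_power2[of "norm (r - ys)"] by linarith+
    then have n1: "norm (r - ys) \<le> 1 + k * V r v" and n2: "norm (center ?q) \<le> 1 + k * V r v"
      by (auto intro: sq)
    have cv: "v = vs + center (v - vs) + ((\<Sum>i\<in>UNIV. (v - vs) $ i) / CARD('n)) *\<^sub>R one"
      by (simp add: center_def one_def vec_eq_iff)
    have "center (v - vs) = center ?q - center (r - ys)"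
      by (simp add: linear_add[OF linear_center])
    then have "norm (center (v - vs)) \<le> norm (center ?q) + norm (center (r - ys))"
      by (simp add: norm_triangle_ineq4)
    then have n3: "norm (center (v - vs)) \<le> 2 + 2 * k * V r v"
      using n1 n2 norm_center_le[of "r - ys"] by linarith
    have "\<bar>(\<Sum>i\<in>UNIV. (v - vs) $ i) / CARD('n)\<bar> \<le> \<bar>\<Sum>i\<in>UNIV. (v - vs) $ i\<bar> / 1"
      unfolding abs_divide by (intro divide_left_mono) (auto simp: Suc_le_eq)
    also have "\<dots> \<le> \<bar>?\<sigma>\<bar> + \<bar>\<Sum>i\<in>UNIV. vs $ i\<bar>" by (simp add: sum_subtractf abs_triangle_ineq4)
    finally have n4: "norm (((\<Sum>i\<in>UNIV. (v - vs) $ i) / CARD('n)) *\<^sub>R one) \<le> (\<bar>?\<sigma>\<bar> + \<bar>\<Sum>i\<in>UNIV. vs $ i\<bar>) * norm one"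
      unfolding norm_scaleR by (rule mult_right_mono) simp
    have "norm v \<le> norm vs + norm (center (v - vs)) + norm (((\<Sum>i\<in>UNIV. (v - vs) $ i) / CARD('n)) *\<^sub>R one)"
    proof -
      have "norm (x + y + z) \<le> norm x + norm y + norm z" for x y z :: "real^'n"
        using norm_triangle_ineq[of "x + y" z] norm_triangle_ineq[of x y] by linarith
      then show ?thesis using arg_cong[OF cv, of norm] by metis
    qed
    also have "\<dots> \<le> norm vs + (2 + 2 * k * V r v) + (\<bar>?\<sigma>\<bar> + \<bar>\<Sum>i\<in>UNIV. vs $ i\<bar>) * norm one"
      using n3 n4 by linarith
    also have "\<dots> \<le> B * 1 + B * V r v + B * \<bar>?\<sigma>\<bar>"
    proof -
      have "B = norm vs + 2 + norm one + 2 * k + \<bar>\<Sum>i\<in>UNIV. vs $ i\<bar> * norm one"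
        by (simp add: B_def k_def)
      moreover have "0 \<le> norm vs" "0 \<le> norm one" "0 \<le> \<bar>\<Sum>i\<in>UNIV. vs $ i\<bar> * norm one" by simp_all
      ultimately have Bs: "2 * k \<le> B" "norm one \<le> B" "norm vs + 2 + \<bar>\<Sum>i\<in>UNIV. vs $ i\<bar> * norm one \<le> B"
        using k by linarith+
      have "2 * k * V r v \<le> B * V r v"
        by (rule mult_right_mono[OF Bs(1) nonneg_V])
      moreover have "norm one * \<bar>?\<sigma>\<bar> \<le> B * \<bar>?\<sigma>\<bar>"
        by (rule mult_right_mono[OF Bs(2)]) simp
      moreover note Bs(3)
      ultimately show ?thesis by (simp add: algebra_simps)
    qed
    finally show ?thesis by (simp add: distrib_left)
  qed
  show ?thesis
    by (rule that[OF \<beta>(1) nonneg_V c3[unfolded R_def ys_def] c4[unfolded R_def ys_def]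
          c5[unfolded R_def] c6])
qed

end

section \<open>A single agent\<close>

lemma class_K_inf_nonneg: "class_K_inf \<phi> \<Longrightarrow> 0 \<le> q \<Longrightarrow> 0 \<le> \<phi> q"
  unfolding class_K_inf_def strict_mono_on_def
  by (metis atLeast_iff less_eq_real_def order_refl)

lemma class_K_inf_less_iff: "class_K_inf \<phi> \<Longrightarrow> 0 \<le> p \<Longrightarrow> 0 \<le> q \<Longrightarrow> \<phi> p < \<phi> q \<longleftrightarrow> p < q"
  unfolding class_K_inf_def strict_mono_on_def by (metis atLeast_iff linorder_neqE_linordered_idom not_less_iff_gr_or_eq)

lemma class_K_inf_unbounded:
  assumes "class_K_inf \<phi>" obtains q where "0 \<le> q" "B < \<phi> q"
  using assms unfolding class_K_inf_def bdd_above_def by (auto simp: not_le)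

text \<open>Summing |B j| over the integers up to the ceiling of L gives a function that is monotone
  and still large enough.\<close>

lemma mono_majorant:
  fixes P :: "real \<Rightarrow> real \<Rightarrow> bool"
  assumes ex: "\<And>L. \<exists>B. P L B"
    and anti: "\<And>L L' B. P L B \<Longrightarrow> L' \<le> L \<Longrightarrow> P L' B"
    and mono: "\<And>L B B'. P L B \<Longrightarrow> B \<le> B' \<Longrightarrow> P L B'"
  obtains H where "\<And>s t. s \<le> t \<Longrightarrow> H s \<le> H t" "\<And>s. 0 \<le> H s" "\<And>L. P L (H L)"
proof -
  have "\<forall>j::nat. \<exists>B. P (real j) B" using ex by blast
  from choice[OF this] obtain B where B: "\<And>j::nat. P (real j) (B j)" by blast
  define H :: "real \<Rightarrow> real" where "H L = (\<Sum>j\<le>nat \<lceil>L\<rceil>. \<bar>B j\<bar>)" for L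
  have "H s \<le> H t" if "s \<le> t" for s t :: real
    unfolding H_def by (rule sum_mono2) (use nat_mono[OF ceiling_mono[OF that]] in auto)
  moreover have "0 \<le> H s" for s by (auto simp: H_def intro: sum_nonneg)
  moreover have "P L (H L)" for L
  proof -
    have "B (nat \<lceil>L\<rceil>) \<le> H L"
      unfolding H_def using member_le_sum[of "nat \<lceil>L\<rceil>" "{..nat \<lceil>L\<rceil>}" "\<lambda>j. \<bar>B j\<bar>"] by simp
    moreover have "L \<le> real (nat \<lceil>L\<rceil>)" by (rule real_nat_ceiling_ge)
    ultimately show ?thesis using B anti mono by blast
  qed
  ultimately show ?thesis using that by blast
qed

text \<open>Near 0 the limsup condition at s = sqrt(\<phi> q) reads q <= M sqrt(\<phi> q), that is,
  q^2 <= M^2 \<phi> q. Away from 0, \<phi> is bounded below while q is at most R.\<close>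

lemma quadratic_below_of_limsup:
  assumes K: "class_K_inf \<phi>"
    and lim: "Limsup (at_right 0) (\<lambda>s. ereal (the_inv_into {0..} \<phi> (s\<^sup>2) / s)) < \<infinity>"
  shows "\<exists>c>0. \<forall>q. 0 \<le> q \<longrightarrow> q \<le> R \<longrightarrow> c * q\<^sup>2 \<le> \<phi> q"
proof -
  obtain M :: real where M: "Limsup (at_right 0) (\<lambda>s. ereal (the_inv_into {0..} \<phi> (s\<^sup>2) / s)) < ereal M"
    using lim less_PInf_Ex_of_nat by (metis ereal_dense2 less_ereal.simps(4))
  then have "\<forall>\<^sub>F s in at_right 0. ereal (the_inv_into {0..} \<phi> (s\<^sup>2) / s) < ereal M"
    by (rule Limsup_lessD)
  then obtain s0 where s0: "0 < s0" "\<And>s. 0 < s \<Longrightarrow> s < s0 \<Longrightarrow> the_inv_into {0..} \<phi> (s\<^sup>2) / s < M"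
    unfolding eventually_at_right_field by auto
  define M' where "M' = max M 1"
  have M': "0 < M'" "M \<le> M'" by (auto simp: M'_def)
  have inj: "inj_on \<phi> {0..}" using K by (auto simp: class_K_inf_def intro: strict_mono_on_imp_inj_on)
  have small: "q\<^sup>2 \<le> M'\<^sup>2 * \<phi> q" if q: "0 < q" "\<phi> q < s0\<^sup>2" for q
  proof -
    have pos: "0 < \<phi> q" using class_K_inf_less_iff[OF K, of 0 q] q K by (auto simp: class_K_inf_def)
    have "sqrt (\<phi> q) < s0" using q s0(1) real_sqrt_less_mono[OF q(2)] by simp
    moreover have "0 < sqrt (\<phi> q)" using pos by simp
    ultimately have "the_inv_into {0..} \<phi> ((sqrt (\<phi> q))\<^sup>2) / sqrt (\<phi> q) < M" using s0(2) by blast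
    moreover have "the_inv_into {0..} \<phi> (\<phi> q) = q" using the_inv_into_f_f[OF inj] q by auto
    ultimately have "q / sqrt (\<phi> q) \<le> M'" using pos M' by simp
    then have "q \<le> M' * sqrt (\<phi> q)" using pos by (simp add: field_simps)
    then have "q\<^sup>2 \<le> (M' * sqrt (\<phi> q))\<^sup>2" using q by (intro power_mono) auto
    then show ?thesis using pos by (simp add: power_mult_distrib)
  qed
  define R' where "R' = \<bar>R\<bar> + 1"
  have R': "0 < R'" "R \<le> R'" by (auto simp: R'_def)
  define c where "c = min (1 / M'\<^sup>2) (s0\<^sup>2 / R'\<^sup>2)"
  have c: "0 < c" "c \<le> 1 / M'\<^sup>2" "c \<le> s0\<^sup>2 / R'\<^sup>2" using M' s0(1) R' unfolding c_def by simp_all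
  have "c * q\<^sup>2 \<le> \<phi> q" if "0 \<le> q" "q \<le> R" for q
  proof (cases "q = 0")
    case True
    then show ?thesis using K by (simp add: class_K_inf_def)
  next
    case False
    then have q: "0 < q" using that by simp
    show ?thesis
    proof (cases "\<phi> q < s0\<^sup>2")
      case True
      have "c * q\<^sup>2 \<le> (1 / M'\<^sup>2) * q\<^sup>2" using c by (intro mult_right_mono) auto
      also have "\<dots> \<le> \<phi> q" using small[OF q True] M' by (simp add: field_simps)
      finally show ?thesis .
    next
      case False
      have "c * q\<^sup>2 \<le> (s0\<^sup>2 / R'\<^sup>2) * R'\<^sup>2"
        using c s0 R' that by (intro mult_mono power_mono) auto
      also have "\<dots> = s0\<^sup>2" using R' by simp
      finally show ?thesis using False by simp
    qed
  qed
  then show ?thesis using c(1) by blast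
qed

lemma has_real_derivative_compose_vector:
  assumes "(V has_derivative DV) (at (f t))" "(f has_vector_derivative f') (at t within S)"
  shows "((\<lambda>t. V (f t)) has_real_derivative DV f') (at t within S)"
proof -
  have "(f has_derivative (\<lambda>h. h *\<^sub>R f')) (at t within S)"
    using assms(2) by (simp add: has_vector_derivative_def)
  from has_derivative_compose[OF this assms(1)]
  have "((\<lambda>t. V (f t)) has_derivative (\<lambda>h. DV (h *\<^sub>R f'))) (at t within S)" .
  moreover have "(\<lambda>h. DV (h *\<^sub>R f')) = (*) (DV f')"
    using linear_scale[OF has_derivative_linear[OF assms(1)]] by (auto simp: fun_eq_iff)
  ultimately show ?thesis by (simp add: has_field_derivative_def)
qed

text \<open>The three locales mirror the order of quantifiers. This one holds what the gain may
  depend on, including the Lyapunov function of the integrator chain.\<close>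

locale agent =
  fixes n m :: nat and k :: "nat \<Rightarrow> real"
    and g :: "'z::euclidean_space \<Rightarrow> 'x::euclidean_space \<Rightarrow> 'w::euclidean_space \<Rightarrow> real"
    and \<alpha>lo \<alpha>up \<alpha>d \<gamma>e :: "real \<Rightarrow> real"
    and Q :: "'x \<Rightarrow> real" and DQ :: "'x \<Rightarrow> 'x \<Rightarrow> real" and cQ CQ :: real
  assumes n: "1 \<le> n" "n \<le> DIM('x)"
    and K_inf: "class_K_inf \<alpha>lo" "class_K_inf \<alpha>up" "class_K_inf \<alpha>d"
    and \<alpha>d_quadratic: "\<exists>c>0. \<forall>q. 0 \<le> q \<longrightarrow> q \<le> R \<longrightarrow> c * q\<^sup>2 \<le> \<alpha>d q"
    and \<gamma>e: "continuous_on UNIV \<gamma>e" "0 \<le> \<gamma>e s"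
    and g_lip: "loc_lip (\<lambda>(z, x, w). g z x w)"
    and cQ: "0 < cQ" "0 < CQ"
    and Q_nonneg: "0 \<le> Q xa"
    and Q_deriv: "(Q has_derivative DQ xa) (at xa)"
    and Q_norm: "xa \<in> Rspace n \<Longrightarrow> norm xa \<le> CQ * (sqrt (Q xa) + \<bar>zlin n k xa\<bar>)"
    and Q_decay: "DQ xa (chain_A n xa + s *\<^sub>R unit_vec n) \<le> - cQ * Q xa + CQ * (zlin n k xa)\<^sup>2"

text \<open>Adds what is unknown to the design but constant along a trajectory. \<open>z0\<close> is
  the equilibrium of the inverse dynamics at output y*, and \<open>us\<close> is the input that
  holds the plant there.\<close>

locale agent_plant = agent n m k g \<alpha>lo \<alpha>up \<alpha>d \<gamma>e Q DQ cQ CQ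
  for n m k and g :: "'z::euclidean_space \<Rightarrow> 'x::euclidean_space \<Rightarrow> 'w::euclidean_space \<Rightarrow> real"
    and \<alpha>lo \<alpha>up \<alpha>d \<gamma>e Q DQ cQ CQ +
  fixes h :: "'z \<Rightarrow> real \<Rightarrow> 'w \<Rightarrow> 'z" and w :: 'w and b :: real and V :: "'z \<Rightarrow> real" and \<sigma> :: real
    and z0 :: 'z and ystar us :: real
  assumes b: "0 < b" and \<sigma>: "0 \<le> \<sigma>"
    and z0: "z0 \<in> Rspace m"
    and V_C1: "Ck_on 1 UNIV V"
    and V_bounds: "za \<in> Rspace m \<Longrightarrow> \<alpha>lo (norm za) \<le> V za" "za \<in> Rspace m \<Longrightarrow> V za \<le> \<alpha>up (norm za)"
    and V_decay: "za \<in> Rspace m \<Longrightarrow> frechet_derivative V (at za) (h (za + z0) (e + ystar) w)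
      \<le> - \<alpha>d (norm za) + \<sigma> * \<gamma>e e * e\<^sup>2"
    and us: "g z0 (ystar *\<^sub>R unit_vec 1) w + b * us = 0"

text \<open>Adds a trajectory on [0, T] in which r is an arbitrary differentiable signal, so that
  the agents decouple.\<close>

locale agent_run = agent_plant n m k g \<alpha>lo \<alpha>up \<alpha>d \<gamma>e Q DQ cQ CQ h w b V \<sigma> z0 ystar us
  for n m k and g :: "'z::euclidean_space \<Rightarrow> 'x::euclidean_space \<Rightarrow> 'w::euclidean_space \<Rightarrow> real"
    and \<alpha>lo \<alpha>up \<alpha>d \<gamma>e Q DQ cQ CQ and h :: "'z \<Rightarrow> real \<Rightarrow> 'w \<Rightarrow> 'z" and w b V \<sigma> z0 ystar us +
  fixes \<rho> :: "real \<Rightarrow> real" and T :: real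
    and z :: "real \<Rightarrow> 'z" and x :: "real \<Rightarrow> 'x" and \<eta> \<theta> r \<mu> :: "real \<Rightarrow> real"
  assumes \<rho>: "1 \<le> \<rho> s"
    and z_space: "0 \<le> t \<Longrightarrow> t \<le> T \<Longrightarrow> z t \<in> Rspace m"
    and x_space: "0 \<le> t \<Longrightarrow> t \<le> T \<Longrightarrow> x t \<in> Rspace n"
    and z_deriv: "0 \<le> t \<Longrightarrow> t \<le> T \<Longrightarrow>
      (z has_vector_derivative h (z t) (x t \<bullet> unit_vec 1) w) (at t within {0..})"
    and x_deriv: "0 \<le> t \<Longrightarrow> t \<le> T \<Longrightarrow>
      (x has_vector_derivative chain_A n (x t) + (g (z t) (x t) w
        + b * (- \<theta> t * \<rho> (zeta n k (x t) (r t)) * zeta n k (x t) (r t) + \<eta> t)) *\<^sub>R unit_vec n)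
      (at t within {0..})"
    and \<eta>_deriv: "0 \<le> t \<Longrightarrow> t \<le> T \<Longrightarrow>
      (\<eta> has_real_derivative - \<theta> t * \<rho> (zeta n k (x t) (r t)) * zeta n k (x t) (r t)) (at t within {0..})"
    and \<theta>_deriv: "0 \<le> t \<Longrightarrow> t \<le> T \<Longrightarrow>
      (\<theta> has_real_derivative \<rho> (zeta n k (x t) (r t)) * (zeta n k (x t) (r t))\<^sup>2) (at t within {0..})"
    and r_deriv: "0 \<le> t \<Longrightarrow> t \<le> T \<Longrightarrow> (r has_real_derivative \<mu> t) (at t within {0..})"

context agent_run
begin

abbreviation "u1 \<equiv> unit_vec 1 :: 'x"

definition "\<zeta> t = zeta n k (x t) (r t)"
definition "zh t = z t - z0"
definition "xh t = x t - ystar *\<^sub>R u1"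
text \<open>\<zeta> is formed with r, the error state with y*; this is the discrepancy.\<close>

definition "\<delta> t = zlin n k u1 * (r t - ystar)"
text \<open>The part of the derivative of \<zeta> without \<theta> and \<eta>. Subtracting the
  equilibrium value of g makes it vanish together with the errors and \<mu>.\<close>

definition "\<Delta> t = zlin n k (chain_A n (xh t)) + (g (z t) (x t) w - g z0 (ystar *\<^sub>R u1) w)
   - zlin n k u1 * \<mu> t"
text \<open>Subtracting \<zeta> / b removes \<theta> from the dynamics of this error.\<close>

definition "\<eta>h t = \<eta> t - us - \<zeta> t / b"

lemma zlin_xh: "zlin n k (xh t) = \<zeta> t + \<delta> t"
  unfolding xh_def \<zeta>_def \<delta>_def zeta_eq
  by (simp add: linear_diff[OF linear_zlin] linear_scale[OF linear_zlin] algebra_simps)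

lemma chain_A_xh: "chain_A n (x t) = chain_A n (xh t)"
proof -
  have "chain_A n u1 = 0"
    unfolding chain_A_def
  proof (rule sum.neutral, intro ballI)
    fix j assume j: "j \<in> {1..<n}"
    then have "u1 \<bullet> (unit_vec (j + 1) :: 'x) = 0" using n by (subst inner_unit_vec) auto
    then show "(u1 \<bullet> unit_vec (j + 1)) *\<^sub>R (unit_vec j :: 'x) = 0" by simp
  qed
  then show ?thesis unfolding xh_def by (simp add: linear_diff[OF linear_chain_A] linear_scale[OF linear_chain_A])
qed

lemma xh_space: "0 \<le> t \<Longrightarrow> t \<le> T \<Longrightarrow> xh t \<in> Rspace n"
  unfolding xh_def
  by (intro subspace_diff[OF subspace_Rspace] x_space subspace_scale[OF subspace_Rspace] unit_vec_in_Rspace)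
    (use n in auto)

lemma zh_space: "0 \<le> t \<Longrightarrow> t \<le> T \<Longrightarrow> zh t \<in> Rspace m"
  unfolding zh_def by (intro subspace_diff[OF subspace_Rspace] z_space z0)

lemma inner_xh: "x t \<bullet> u1 = xh t \<bullet> u1 + ystar"
  using n by (simp add: xh_def inner_diff_left inner_unit_vec)

lemma abs_inner_xh: "\<bar>xh t \<bullet> u1\<bar> \<le> norm (xh t)"
  using Cauchy_Schwarz_ineq2[of "xh t" u1] n by (simp add: norm_unit_vec)

lemma xh_deriv:
  assumes "0 \<le> t" "t \<le> T"
  shows "(xh has_vector_derivative chain_A n (xh t) + (g (z t) (x t) w
        + b * (- \<theta> t * \<rho> (\<zeta> t) * \<zeta> t + \<eta> t)) *\<^sub>R unit_vec n) (at t within {0..})"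
  using has_vector_derivative_diff[OF x_deriv[OF assms] has_vector_derivative_const[of "ystar *\<^sub>R u1"]]
  unfolding xh_def[abs_def, symmetric] \<zeta>_def[symmetric] chain_A_xh by simp

lemma zh_deriv:
  assumes "0 \<le> t" "t \<le> T"
  shows "(zh has_vector_derivative h (zh t + z0) (xh t \<bullet> u1 + ystar) w) (at t within {0..})"
  using has_vector_derivative_diff[OF z_deriv[OF assms] has_vector_derivative_const[of z0]]
  unfolding zh_def[abs_def, symmetric] inner_xh by (simp add: zh_def)

text \<open>Writing \<eta> as \<open>\<eta>h\<close> + us + \<zeta>/b produces the isolated \<zeta>,
  and b us compensates the equilibrium value of g.\<close>

lemma \<zeta>_deriv:
  assumes "0 \<le> t" "t \<le> T"
  shows "(\<zeta> has_real_derivative \<Delta> t + \<zeta> t + b * \<eta>h t - b * \<theta> t * \<rho> (\<zeta> t) * \<zeta> t) (at t within {0..})"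
proof -
  have lz: "bounded_linear (zlin n k :: 'x \<Rightarrow> real)"
    using linear_zlin by (simp add: linear_conv_bounded_linear)
  have eq: "\<zeta> = (\<lambda>t. zlin n k (xh t) - zlin n k u1 * (r t - ystar))"
    using zlin_xh by (simp add: fun_eq_iff \<delta>_def)
  have 1: "((\<lambda>t. zlin n k (xh t)) has_real_derivative zlin n k (chain_A n (xh t) + (g (z t) (x t) w
        + b * (- \<theta> t * \<rho> (\<zeta> t) * \<zeta> t + \<eta> t)) *\<^sub>R unit_vec n)) (at t within {0..})"
    using bounded_linear.has_vector_derivative[OF lz xh_deriv[OF assms]]
    by (simp only: has_real_derivative_iff_has_vector_derivative)
  have 2: "((\<lambda>t. zlin n k u1 * (r t - ystar)) has_real_derivative zlin n k u1 * \<mu> t) (at t within {0..})"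
    using DERIV_cmult[OF DERIV_diff[OF r_deriv[OF assms] DERIV_const[of ystar]]] by simp
  have "zlin n k (chain_A n (xh t) + (g (z t) (x t) w
        + b * (- \<theta> t * \<rho> (\<zeta> t) * \<zeta> t + \<eta> t)) *\<^sub>R unit_vec n) - zlin n k u1 * \<mu> t
      = \<Delta> t + \<zeta> t + b * \<eta>h t - b * \<theta> t * \<rho> (\<zeta> t) * \<zeta> t"
  proof -
    have zl: "zlin n k (y + s *\<^sub>R unit_vec n) = zlin n k y + s" for y :: 'x and s
      using n by (simp add: linear_add[OF linear_zlin] linear_scale[OF linear_zlin] zlin_unit_vec)
    have "g z0 (ystar *\<^sub>R u1) w = - b * us" using us by simp
    then show ?thesis using b unfolding zl \<Delta>_def \<eta>h_def by (simp add: algebra_simps)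
  qed
  then show ?thesis using DERIV_diff[OF 1 2] unfolding eq[symmetric] by simp
qed

text \<open>A stable filter driven by \<zeta> and \<Delta>: the damping is the influence of \<eta>
  on \<zeta>, divided by -b, and the terms with \<theta> cancel.\<close>

lemma \<eta>h_deriv:
  assumes "0 \<le> t" "t \<le> T"
  shows "(\<eta>h has_real_derivative - \<eta>h t - (\<zeta> t + \<Delta> t) / b) (at t within {0..})"
proof -
  have "(\<eta>h has_real_derivative (- \<theta> t * \<rho> (\<zeta> t) * \<zeta> t) - 0 - (\<Delta> t + \<zeta> t + b * \<eta>h t - b * \<theta> t * \<rho> (\<zeta> t) * \<zeta> t) / b)
      (at t within {0..})"
    unfolding \<eta>h_def[abs_def] \<zeta>_def[symmetric]
    using \<eta>_deriv[OF assms] \<zeta>_deriv[OF assms] unfolding \<zeta>_def[symmetric] \<eta>h_def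
    by (intro DERIV_diff DERIV_const DERIV_cdivide)
  moreover have "(- \<theta> t * \<rho> (\<zeta> t) * \<zeta> t) - 0 - (\<Delta> t + \<zeta> t + b * \<eta>h t - b * \<theta> t * \<rho> (\<zeta> t) * \<zeta> t) / b
      = - \<eta>h t - (\<zeta> t + \<Delta> t) / b"
    using b by (simp add: field_simps)
  ultimately show ?thesis by simp
qed

lemma \<theta>_deriv': "0 \<le> t \<Longrightarrow> t \<le> T \<Longrightarrow> (\<theta> has_real_derivative \<rho> (\<zeta> t) * (\<zeta> t)\<^sup>2) (at t within {0..})"
  using \<theta>_deriv unfolding \<zeta>_def .

lemma \<theta>_mono: "0 \<le> s \<Longrightarrow> s \<le> t \<Longrightarrow> t \<le> T \<Longrightarrow> \<theta> s \<le> \<theta> t"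
proof -
  assume st: "0 \<le> s" "s \<le> t" "t \<le> T"
  have "- \<theta> t \<le> - \<theta> s"
  proof (rule nonincreasing_of_derivative_nonpos[where f = "\<lambda>t. - \<theta> t" and T = T])
    show "((\<lambda>t. - \<theta> t) has_real_derivative - (\<rho> (\<zeta> t) * (\<zeta> t)\<^sup>2)) (at t within {0..})" if "0 \<le> t" "t \<le> T" for t
      by (rule DERIV_minus[OF \<theta>_deriv'[OF that]])
    show "- (\<rho> (\<zeta> u) * (\<zeta> u)\<^sup>2) \<le> 0" for u using \<rho>[of "\<zeta> u"] by simp
  qed (use st in auto)
  then show ?thesis by simp
qed

definition "dQ t = DQ (xh t) (chain_A n (xh t) + (g (z t) (x t) w
    + b * (- \<theta> t * \<rho> (\<zeta> t) * \<zeta> t + \<eta> t)) *\<^sub>R unit_vec n)"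

lemma Q_xh_deriv: "0 \<le> t \<Longrightarrow> t \<le> T \<Longrightarrow> ((\<lambda>t. Q (xh t)) has_real_derivative dQ t) (at t within {0..})"
  unfolding dQ_def by (rule has_real_derivative_compose_vector[OF Q_deriv xh_deriv])

lemma dQ_le: "dQ t \<le> - cQ * Q (xh t) + CQ * (\<zeta> t + \<delta> t)\<^sup>2"
  unfolding dQ_def zlin_xh[symmetric] by (rule Q_decay)

definition "dV t = frechet_derivative V (at (zh t)) (h (zh t + z0) (xh t \<bullet> u1 + ystar) w)"

lemma V_zh_deriv:
  assumes "0 \<le> t" "t \<le> T"
  shows "((\<lambda>t. V (zh t)) has_real_derivative dV t) (at t within {0..})"
proof -
  have "(V has_derivative frechet_derivative V (at (zh t))) (at (zh t))"
    using V_C1 by (auto simp: frechet_derivative_works[symmetric] differentiable_on_def)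
  from has_real_derivative_compose_vector[OF this zh_deriv[OF assms]]
  show ?thesis unfolding dV_def .
qed

lemma dV_le:
  "0 \<le> t \<Longrightarrow> t \<le> T \<Longrightarrow> dV t \<le> - \<alpha>d (norm (zh t)) + \<sigma> * \<gamma>e (xh t \<bullet> u1) * (xh t \<bullet> u1)\<^sup>2"
  unfolding dV_def by (rule V_decay[OF zh_space])

lemma Q_xh_bound:
  assumes R: "\<And>t. 0 \<le> t \<Longrightarrow> t \<le> T \<Longrightarrow> \<bar>\<zeta> t + \<delta> t\<bar> \<le> R" and Q0: "Q (xh 0) \<le> R'" "0 \<le> R'" and t: "0 \<le> t" "t \<le> T"
  shows "Q (xh t) \<le> R' + CQ * R\<^sup>2 / cQ"
proof (rule barrier_le[OF Q_xh_deriv _ _ t])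
    have "0 \<le> CQ * R\<^sup>2 / cQ" using cQ by simp
    then show "Q (xh 0) \<le> R' + CQ * R\<^sup>2 / cQ" using Q0 by simp
    fix s assume s: "0 \<le> s" "s \<le> T" and gt: "R' + CQ * R\<^sup>2 / cQ < Q (xh s)"
    have "(\<zeta> s + \<delta> s)\<^sup>2 \<le> R\<^sup>2" using R[OF s] abs_le_square_iff[of "\<zeta> s + \<delta> s" R] by simp
    then have "CQ * (\<zeta> s + \<delta> s)\<^sup>2 \<le> CQ * R\<^sup>2" using cQ by simp
    moreover have "cQ * (CQ * R\<^sup>2 / cQ) \<le> cQ * Q (xh s)" using gt Q0 cQ by (intro mult_left_mono) auto
    moreover have "cQ * (CQ * R\<^sup>2 / cQ) = CQ * R\<^sup>2" using cQ by simp
    ultimately show "dQ s \<le> 0" using dQ_le[of s] by linarith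
qed

text \<open>Above this level the upper bound on V forces the norm of \<open>zh\<close> beyond
  \<open>q\<close>, and there \<open>\<alpha>d\<close> outweighs the input term.\<close>

lemma V_zh_bound:
  assumes e: "\<And>t. 0 \<le> t \<Longrightarrow> t \<le> T \<Longrightarrow> \<sigma> * \<gamma>e (xh t \<bullet> u1) * (xh t \<bullet> u1)\<^sup>2 \<le> \<alpha>d q" and q: "0 \<le> q"
    and V0: "V (zh 0) \<le> R'" "0 \<le> R'" and t: "0 \<le> t" "t \<le> T"
  shows "V (zh t) \<le> R' + \<alpha>up q"
proof (rule barrier_le[OF V_zh_deriv _ _ t])
    show "V (zh 0) \<le> R' + \<alpha>up q" using V0 class_K_inf_nonneg[OF K_inf(2) q] by simp
    fix s assume s: "0 \<le> s" "s \<le> T" and gt: "R' + \<alpha>up q < V (zh s)"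
    then have "\<alpha>up q < \<alpha>up (norm (zh s))" using V_bounds(2)[OF zh_space[OF s]] V0 by simp
    then have "q < norm (zh s)" using class_K_inf_less_iff[OF K_inf(2) q] by simp
    then have "\<alpha>d q < \<alpha>d (norm (zh s))" using class_K_inf_less_iff[OF K_inf(3) q] by simp
    then show "dV s \<le> 0" using dV_le[OF s] e[OF s] by simp
qed

lemma \<eta>h_bound:
  assumes R: "\<And>t. 0 \<le> t \<Longrightarrow> t \<le> T \<Longrightarrow> \<bar>(\<zeta> t + \<Delta> t) / b\<bar> \<le> R" and 0: "\<bar>\<eta>h 0\<bar> \<le> R" and t: "0 \<le> t" "t \<le> T"
  shows "\<bar>\<eta>h t\<bar> \<le> R"
proof -
  have R0: "0 \<le> R" using 0 by simp
  have "(\<eta>h t)\<^sup>2 \<le> R\<^sup>2"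
  proof (rule barrier_le[OF _ _ _ t])
    show "((\<lambda>t. (\<eta>h t)\<^sup>2) has_real_derivative 2 * \<eta>h t * (- \<eta>h t - (\<zeta> t + \<Delta> t) / b)) (at t within {0..})"
      if "0 \<le> t" "t \<le> T" for t
      using DERIV_power[OF \<eta>h_deriv[OF that], of 2] by (simp add: ac_simps)
    show "(\<eta>h 0)\<^sup>2 \<le> R\<^sup>2" using 0 R0 abs_le_square_iff[of "\<eta>h 0" R] by simp
    fix s assume s: "0 \<le> s" "s \<le> T" and "R\<^sup>2 < (\<eta>h s)\<^sup>2"
    then have gt: "R < \<bar>\<eta>h s\<bar>" using R0 abs_le_square_iff[of "\<eta>h s" R] by (auto simp: not_le[symmetric])
    define Y where "Y = (\<zeta> s + \<Delta> s) / b"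
    have "- (\<eta>h s * Y) \<le> \<bar>\<eta>h s\<bar> * \<bar>Y\<bar>"
      using abs_ge_minus_self[of "\<eta>h s * Y"] by (simp add: abs_mult)
    also have "\<dots> \<le> \<bar>\<eta>h s\<bar> * \<bar>\<eta>h s\<bar>"
      using gt R[OF s] by (intro mult_left_mono) (auto simp: Y_def)
    finally have "- (\<eta>h s * Y) \<le> \<eta>h s * \<eta>h s" by simp
    then show "2 * \<eta>h s * (- \<eta>h s - (\<zeta> s + \<Delta> s) / b) \<le> 0"
      unfolding Y_def[symmetric] by (simp add: algebra_simps)
  qed
  then show ?thesis using R0 abs_le_square_iff[of "\<eta>h t" R] by simp
qed

end

section \<open>Known growth bounds for a run in terms of \<zeta>\<close>

context agent_run
begin

text \<open>Collects the constants, initial data and exogenous signals on which the known growth function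
  may depend only through the single number \<open>L\<close>.\<close>

definition "data_le L \<longleftrightarrow> norm w \<le> L \<and> \<bar>ystar\<bar> \<le> L \<and> norm z0 \<le> L \<and> \<sigma> \<le> L \<and> b \<le> L \<and> 1 / b \<le> L
  \<and> Q (xh 0) \<le> L \<and> V (zh 0) \<le> L \<and> \<bar>\<eta>h 0\<bar> \<le> L \<and> (\<forall>t. 0 \<le> t \<longrightarrow> t \<le> T \<longrightarrow> \<bar>\<delta> t\<bar> \<le> L \<and> \<bar>\<mu> t\<bar> \<le> L)"

definition "zeta_le L \<longleftrightarrow> (\<forall>t. 0 \<le> t \<longrightarrow> t \<le> T \<longrightarrow> \<bar>\<zeta> t\<bar> \<le> L)"

definition "state_le B \<longleftrightarrow> (\<forall>t. 0 \<le> t \<longrightarrow> t \<le> T \<longrightarrow> norm (zh t) \<le> B \<and> norm (xh t) \<le> B \<and> \<bar>\<eta>h t\<bar> \<le> B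
  \<and> \<bar>\<Delta> t + \<zeta> t + b * \<eta>h t\<bar> \<le> B)"

lemma data_le_mono: "data_le L \<Longrightarrow> L \<le> L' \<Longrightarrow> data_le L'"
  unfolding data_le_def by (auto intro: order_trans)

lemma zeta_le_mono: "zeta_le L \<Longrightarrow> L \<le> L' \<Longrightarrow> zeta_le L'"
  unfolding zeta_le_def by (auto intro: order_trans)

lemma state_le_mono: "state_le B \<Longrightarrow> B \<le> B' \<Longrightarrow> state_le B'"
  unfolding state_le_def by (auto intro: order_trans)

text \<open>The bounds propagate along the cascade \<zeta>, Q, x, V, z, \<Delta>,
  \<open>\<eta>h\<close>, each barrier using the previous bound. The constants are tied to L and the
  known data only, never to the run; this makes the resulting growth function available to the
  design.\<close>

lemma state_le_explicit:
  assumes data: "data_le L" and zet: "zeta_le L"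
    and B2: "CQ * (sqrt (L + CQ * (2 * L)\<^sup>2 / cQ) + 2 * L) \<le> B2"
    and q1: "0 \<le> q1" "\<And>e. \<bar>e\<bar> \<le> B2 \<Longrightarrow> L * \<gamma>e e * B2\<^sup>2 \<le> \<alpha>d q1"
    and q2: "0 \<le> q2" "L + \<alpha>up q1 < \<alpha>lo q2"
    and B4: "\<And>z x w. norm z \<le> q2 + L \<Longrightarrow> norm x \<le> B2 + L \<Longrightarrow> norm w \<le> L \<Longrightarrow> \<bar>g z x w\<bar> \<le> B4"
    and Ka: "\<And>y :: 'x. \<bar>zlin n k (chain_A n y)\<bar> \<le> Ka * norm y" "0 \<le> Ka"
    and B5: "Ka * B2 + 2 * B4 + \<bar>zlin n k u1\<bar> * L \<le> B5"
    and B6: "L + (L + B5) * L \<le> B6"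
    and B: "q2 \<le> B" "B2 \<le> B" "B6 \<le> B" "B5 + L + L * B6 \<le> B"
  shows "state_le B"
proof -
  note dat = data[unfolded data_le_def]
  have L0: "0 \<le> L" using dat norm_ge_zero[of w] by linarith
  have zd: "\<bar>\<zeta> t + \<delta> t\<bar> \<le> 2 * L" if "0 \<le> t" "t \<le> T" for t
    using dat zet that unfolding zeta_le_def by (smt (verit))
  have Qb: "Q (xh t) \<le> L + CQ * (2 * L)\<^sup>2 / cQ" if "0 \<le> t" "t \<le> T" for t
    by (rule Q_xh_bound[OF zd _ L0 that]) (use dat in auto)
  have xb: "norm (xh t) \<le> B2" if t: "0 \<le> t" "t \<le> T" for t
  proof -
    have "norm (xh t) \<le> CQ * (sqrt (Q (xh t)) + \<bar>zlin n k (xh t)\<bar>)" by (rule Q_norm[OF xh_space[OF t]])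
    also have "\<dots> \<le> CQ * (sqrt (L + CQ * (2 * L)\<^sup>2 / cQ) + 2 * L)"
      using cQ Qb[OF t] zd[OF t] by (intro mult_left_mono add_mono real_sqrt_le_mono) (auto simp: zlin_xh)
    finally show ?thesis using B2 by simp
  qed
  have eb: "\<bar>xh t \<bullet> u1\<bar> \<le> B2" if t: "0 \<le> t" "t \<le> T" for t
    using abs_inner_xh[of t] xb[OF t] by linarith
  have in_le: "\<sigma> * \<gamma>e (xh t \<bullet> u1) * (xh t \<bullet> u1)\<^sup>2 \<le> \<alpha>d q1" if t: "0 \<le> t" "t \<le> T" for t
  proof -
    have "(xh t \<bullet> u1)\<^sup>2 \<le> B2\<^sup>2" using eb[OF t] power_mono[of "\<bar>xh t \<bullet> u1\<bar>" B2 2] by simp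
    then have "\<sigma> * \<gamma>e (xh t \<bullet> u1) * (xh t \<bullet> u1)\<^sup>2 \<le> L * \<gamma>e (xh t \<bullet> u1) * B2\<^sup>2"
      using dat \<sigma> \<gamma>e(2) L0 by (intro mult_mono mult_nonneg_nonneg) auto
    then show ?thesis using q1(2)[OF eb[OF t]] by linarith
  qed
  have zb: "norm (zh t) \<le> q2" if t: "0 \<le> t" "t \<le> T" for t
  proof -
    have "V (zh t) \<le> L + \<alpha>up q1"
      by (rule V_zh_bound[OF in_le q1(1) _ L0 t]) (use dat in auto)
    then have "\<alpha>lo (norm (zh t)) < \<alpha>lo q2" using V_bounds(1)[OF zh_space[OF t]] q2(2) by linarith
    then show ?thesis using class_K_inf_less_iff[OF K_inf(1) _ q2(1)] by simp
  qed
  have \<Delta>b: "\<bar>\<Delta> t\<bar> \<le> B5" if t: "0 \<le> t" "t \<le> T" for t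
  proof -
    have nz: "norm (z t) \<le> q2 + L"
      using zb[OF t] dat norm_triangle_ineq[of "zh t" z0] by (simp add: zh_def)
    have nu: "norm (ystar *\<^sub>R u1) \<le> L" using dat n by (simp add: norm_unit_vec)
    have nx: "norm (x t) \<le> B2 + L"
      using xb[OF t] nu norm_triangle_ineq[of "xh t" "ystar *\<^sub>R u1"] by (simp add: xh_def)
    have B2_0: "0 \<le> B2" using xb[OF t] norm_ge_zero[of "xh t"] by linarith
    have g1: "\<bar>g (z t) (x t) w\<bar> \<le> B4" by (rule B4[OF nz nx]) (use dat in auto)
    have g2: "\<bar>g z0 (ystar *\<^sub>R u1) w\<bar> \<le> B4" by (rule B4) (use dat nu q2(1) B2_0 in auto)
    have l1: "\<bar>zlin n k (chain_A n (xh t))\<bar> \<le> Ka * B2"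
      using Ka(1)[of "xh t"] mult_left_mono[OF xb[OF t] Ka(2)] by linarith
    have l2: "\<bar>zlin n k u1 * \<mu> t\<bar> \<le> \<bar>zlin n k u1\<bar> * L"
      unfolding abs_mult using dat t by (intro mult_left_mono) auto
    show ?thesis using g1 g2 l1 l2 B5 unfolding \<Delta>_def by linarith
  qed
  have zD: "\<bar>(\<zeta> t + \<Delta> t) / b\<bar> \<le> B6" if t: "0 \<le> t" "t \<le> T" for t
  proof -
    have "\<bar>(\<zeta> t + \<Delta> t) / b\<bar> = \<bar>\<zeta> t + \<Delta> t\<bar> * (1 / b)" using b by (simp add: abs_mult)
    also have "\<dots> \<le> (L + B5) * L"
    proof (rule mult_mono)
      show "\<bar>\<zeta> t + \<Delta> t\<bar> \<le> L + B5" using \<Delta>b[OF t] zet t unfolding zeta_le_def by (smt (verit))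
      then show "0 \<le> L + B5" by linarith
    qed (use dat b in auto)
    finally show ?thesis using B6 L0 by linarith
  qed
  have B6_L: "L \<le> B6" if t: "0 \<le> t" "t \<le> T" for t
  proof -
    have "0 \<le> (L + B5) * L" using \<Delta>b[OF t] L0 by (intro mult_nonneg_nonneg) auto
    then show ?thesis using B6 by linarith
  qed
  have eb: "\<bar>\<eta>h t\<bar> \<le> B6" if t: "0 \<le> t" "t \<le> T" for t
    by (rule \<eta>h_bound[OF zD _ t]) (use dat B6_L[OF t] in auto)
  show ?thesis
    unfolding state_le_def
  proof (intro allI impI conjI)
    fix t assume t: "0 \<le> t" "t \<le> T"
    show "norm (zh t) \<le> B" "norm (xh t) \<le> B" "\<bar>\<eta>h t\<bar> \<le> B" using zb[OF t] xb[OF t] eb[OF t] B by linarith+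
    have "\<bar>b * \<eta>h t\<bar> \<le> L * B6"
      unfolding abs_mult using eb[OF t] dat b L0 by (intro mult_mono) auto
    moreover have "\<bar>\<zeta> t\<bar> \<le> L" using zet t unfolding zeta_le_def by blast
    ultimately show "\<bar>\<Delta> t + \<zeta> t + b * \<eta>h t\<bar> \<le> B" using \<Delta>b[OF t] B(4) by linarith
  qed
qed

text \<open>Allows the bounds to be applied on [0, s] with the maximum of |\<zeta>| up to time
  s.\<close>

lemma run_restrict: "s \<le> T \<Longrightarrow> agent_run n m k g \<alpha>lo \<alpha>up \<alpha>d \<gamma>e Q DQ cQ CQ h w b V \<sigma> z0 ystar us \<rho> s z x \<eta> \<theta> r \<mu>"
  by unfold_locales
    (use \<rho> z_space x_space z_deriv x_deriv \<eta>_deriv \<theta>_deriv r_deriv in \<open>auto intro: order_trans\<close>)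

end

context agent
begin

text \<open>The plant, the gain \<rho> and the run are all quantified inside. In particular the
  bound can be fixed before \<rho>, which is later built from it.\<close>

definition "dominated L B \<longleftrightarrow> (\<forall>h w b V \<sigma> z0 ystar us \<rho> T z x \<eta> \<theta> r \<mu>.
    agent_run n m k g \<alpha>lo \<alpha>up \<alpha>d \<gamma>e Q DQ cQ CQ h w b V \<sigma> z0 ystar us \<rho> T z x \<eta> \<theta> r \<mu> \<longrightarrow>
    agent_run.data_le n k Q w b V \<sigma> z0 ystar us T z x \<eta> r \<mu> L \<longrightarrow>
    agent_run.zeta_le n k T x r L \<longrightarrow>
    agent_run.state_le n k g w b z0 ystar us T z x \<eta> r \<mu> B)"

definition "growth_function H \<longleftrightarrow>
    (\<forall>s t. s \<le> t \<longrightarrow> H s \<le> H t) \<and> (\<forall>s. 0 \<le> H s) \<and> (\<forall>L. dominated L (H L))"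

text \<open>The constants of \<open>state_le_explicit\<close> are chosen before a run is introduced;
  \<open>mono_majorant\<close> then makes them monotone in L.\<close>

lemma ex_growth_function: "\<exists>H. growth_function H"
proof -
  have "\<exists>B. dominated L B" for L
  proof -
    define B2 where "B2 = CQ * (sqrt (L + CQ * (2 * L)\<^sup>2 / cQ) + 2 * L)"
    have "compact (\<gamma>e ` {-B2..B2})"
      by (intro compact_continuous_image continuous_on_subset[OF \<gamma>e(1)]) auto
    from compact_imp_bounded[OF this] obtain G where G: "\<forall>e\<in>{-B2..B2}. \<bar>\<gamma>e e\<bar> \<le> G"
      by (auto simp: bounded_iff)
    obtain q1 where q1: "0 \<le> q1" "\<bar>L\<bar> * G * B2\<^sup>2 < \<alpha>d q1"
      using class_K_inf_unbounded[OF K_inf(3)] by blast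
    have q1': "L * \<gamma>e e * B2\<^sup>2 \<le> \<alpha>d q1" if "\<bar>e\<bar> \<le> B2" for e
    proof -
      have "\<bar>\<gamma>e e\<bar> \<le> G" using G that by (auto simp: abs_le_iff)
      then have "L * \<gamma>e e \<le> \<bar>L\<bar> * G"
        using \<gamma>e(2)[of e] mult_mono[of L "\<bar>L\<bar>" "\<gamma>e e" G] by auto
      then have "L * \<gamma>e e * B2\<^sup>2 \<le> \<bar>L\<bar> * G * B2\<^sup>2" by (rule mult_right_mono) simp
      then show ?thesis using q1 by linarith
    qed
    obtain q2 where q2: "0 \<le> q2" "L + \<alpha>up q1 < \<alpha>lo q2"
      using class_K_inf_unbounded[OF K_inf(1)] by blast
    obtain B4 where B4: "\<And>p. norm p \<le> (q2 + L) + ((B2 + L) + L) \<Longrightarrow> norm ((\<lambda>(z, x, w). g z x w) p) \<le> B4"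
      using loc_lip_bounded[OF g_lip] by blast
    have B4': "\<bar>g z x w\<bar> \<le> B4" if "norm z \<le> q2 + L" "norm x \<le> B2 + L" "norm w \<le> L" for z x w
    proof -
      have "norm (z, x, w) \<le> norm z + (norm x + norm w)"
        using norm_Pair_le[of z "(x, w)"] norm_Pair_le[of x w] by linarith
      then show ?thesis using B4[of "(z, x, w)"] that by simp
    qed
    have "linear (\<lambda>y :: 'x. zlin n k (chain_A n y))"
      using linear_compose[OF linear_chain_A linear_zlin] by (simp add: o_def)
    from linear_bounded_pos[OF this] obtain Ka where
      Ka: "0 < Ka" "\<And>y :: 'x. norm (zlin n k (chain_A n y)) \<le> Ka * norm y" by blast
    define B5 where "B5 = Ka * B2 + 2 * B4 + \<bar>zlin n k (unit_vec 1 :: 'x)\<bar> * L"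
    define B6 where "B6 = L + (L + B5) * L"
    define B where "B = max (max q2 B2) (max B6 (B5 + L + L * B6))"
    have B: "q2 \<le> B" "B2 \<le> B" "B6 \<le> B" "B5 + L + L * B6 \<le> B" unfolding B_def by linarith+
    have "dominated L B"
      unfolding dominated_def
    proof (intro allI impI)
      fix h w b V \<sigma> z0 ystar us \<rho> T z x \<eta> \<theta> r \<mu>
      assume "agent_run n m k g \<alpha>lo \<alpha>up \<alpha>d \<gamma>e Q DQ cQ CQ h w b V \<sigma> z0 ystar us \<rho> T z x \<eta> \<theta> r \<mu>"
      then interpret agent_run n m k g \<alpha>lo \<alpha>up \<alpha>d \<gamma>e Q DQ cQ CQ h w b V \<sigma> z0 ystar us \<rho> T z x \<eta> \<theta> r \<mu> .
      assume "data_le L" "zeta_le L"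
      then show "state_le B"
        using B2_def B5_def B6_def q1(1) q1' q2 B4' Ka B
        by (intro state_le_explicit[of L B2 q1 q2 B4 Ka B5 B6 B]) auto
    qed
    then show ?thesis by blast
  qed
  moreover have "dominated L' B" if "dominated L B" "L' \<le> L" for L L' B
    unfolding dominated_def
  proof (intro allI impI)
    fix h w b V \<sigma> z0 ystar us \<rho> T z x \<eta> \<theta> r \<mu>
    assume run: "agent_run n m k g \<alpha>lo \<alpha>up \<alpha>d \<gamma>e Q DQ cQ CQ h w b V \<sigma> z0 ystar us \<rho> T z x \<eta> \<theta> r \<mu>"
    then interpret agent_run n m k g \<alpha>lo \<alpha>up \<alpha>d \<gamma>e Q DQ cQ CQ h w b V \<sigma> z0 ystar us \<rho> T z x \<eta> \<theta> r \<mu> .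
    assume "data_le L'" "zeta_le L'"
    then have "data_le L" "zeta_le L" using data_le_mono zeta_le_mono that(2) by blast+
    then show "state_le B" using that(1) run unfolding dominated_def by blast
  qed
  moreover have "dominated L B'" if "dominated L B" "B \<le> B'" for L B B'
    unfolding dominated_def
  proof (intro allI impI)
    fix h w b V \<sigma> z0 ystar us \<rho> T z x \<eta> \<theta> r \<mu>
    assume run: "agent_run n m k g \<alpha>lo \<alpha>up \<alpha>d \<gamma>e Q DQ cQ CQ h w b V \<sigma> z0 ystar us \<rho> T z x \<eta> \<theta> r \<mu>"
    then interpret agent_run n m k g \<alpha>lo \<alpha>up \<alpha>d \<gamma>e Q DQ cQ CQ h w b V \<sigma> z0 ystar us \<rho> T z x \<eta> \<theta> r \<mu> .
    assume "data_le L" "zeta_le L"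
    then have "state_le B" using that(1) run unfolding dominated_def by blast
    then show "state_le B'" using state_le_mono that(2) by blast
  qed
  ultimately obtain H where "\<And>s t. s \<le> t \<Longrightarrow> H s \<le> H t" "\<And>s. 0 \<le> H s" "\<And>L. dominated L (H L)"
    using mono_majorant[of dominated] by blast
  then show ?thesis unfolding growth_function_def by blast
qed

end

text \<open>The level 1 + 2 \<open>Bz\<close> of the next argument, written as a function of initial
  data so that it can be used before a run is given.\<close>

definition gain_bound :: "(real \<Rightarrow> real) \<Rightarrow> real \<Rightarrow> real \<Rightarrow> real \<Rightarrow> real \<Rightarrow> real" where
  "gain_bound H b C \<zeta>0 \<theta>0 =
    (let p = \<bar>2 + H (4 * C\<^sup>2) - b * \<theta>0\<bar> in 3 + max 1 (\<zeta>0\<^sup>2) + 2 * (p * exp (p / b)))"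

context agent_run
begin

text \<open>At a time where \<open>\<bar>\<zeta>\<bar>\<close> attains its running maximum, all other states are bounded in terms of
  \<open>\<bar>\<zeta>\<bar>\<close>. There the growth of \<open>\<zeta>\<^sup>2\<close> per unit of \<open>\<theta>\<close> is at most \<open>A - b \<theta>\<close>, whose positive part has a
  finite integral over \<open>\<theta>\<close>; the function \<open>K exp (\<theta>0 - \<theta>)\<close> dominates that integral.\<close>

lemma zeta_le_gain_bound:
  assumes H: "\<And>s t. s \<le> t \<Longrightarrow> H s \<le> H t" "\<And>s. 0 \<le> H s"
    and growth: "\<And>s L. 0 \<le> s \<Longrightarrow> s \<le> T \<Longrightarrow> data_le L \<Longrightarrow> (\<And>u. 0 \<le> u \<Longrightarrow> u \<le> s \<Longrightarrow> \<bar>\<zeta> u\<bar> \<le> L) \<Longrightarrow>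
      \<bar>\<Delta> s + \<zeta> s + b * \<eta>h s\<bar> \<le> H L"
    and \<rho>H: "\<And>y. 1 + H (y\<^sup>2) \<le> \<rho> y"
    and C: "data_le C" "1 \<le> C"
  shows "zeta_le (gain_bound H b C (\<zeta> 0) (\<theta> 0))"
proof -
  \<comment> \<open>1 + H(4 C^2) is the factor left after \<rho> is split off; one more unit makes
    the final inequality strict.\<close>
  define A where "A = 2 + H (4 * C\<^sup>2)"
  define p where "p = \<bar>A - b * \<theta> 0\<bar>"
  \<comment> \<open>A - b \<theta> is positive only while \<theta> has risen by less than p / b;
    during that time K exp(\<theta> 0 - \<theta>) is still at least p.\<close>
  define K where "K = p * exp (p / b)"
  \<comment> \<open>Above \<open>G 0\<close>, and so high that \<zeta>^2 >= 1 at a crossing even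
    after the exponential term has been deducted.\<close>
  define Bz where "Bz = max 1 ((\<zeta> 0)\<^sup>2) / 2 + 1 + K"
  have p: "0 \<le> p" "A - b * \<theta> 0 \<le> p" by (auto simp: p_def)
  have K: "0 \<le> K" using p by (simp add: K_def)
  define G where "G t = (\<zeta> t)\<^sup>2 / 2 + K * exp (\<theta> 0 - \<theta> t)" for t
  define G' where "G' t = \<zeta> t * (\<Delta> t + \<zeta> t + b * \<eta>h t - b * \<theta> t * \<rho> (\<zeta> t) * \<zeta> t)
    - K * exp (\<theta> 0 - \<theta> t) * (\<rho> (\<zeta> t) * (\<zeta> t)\<^sup>2)" for t
  have derG: "(G has_real_derivative G' t) (at t within {0..})" if t: "0 \<le> t" "t \<le> T" for t
  proof -
    have "((\<lambda>t. (\<zeta> t)\<^sup>2 / 2) has_real_derivative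
        \<zeta> t * (\<Delta> t + \<zeta> t + b * \<eta>h t - b * \<theta> t * \<rho> (\<zeta> t) * \<zeta> t)) (at t within {0..})"
      using DERIV_cdivide[OF DERIV_power[OF \<zeta>_deriv[OF t], of 2], of 2] by (simp add: ac_simps)
    moreover have "((\<lambda>t. K * exp (\<theta> 0 - \<theta> t)) has_real_derivative
        - (K * exp (\<theta> 0 - \<theta> t) * (\<rho> (\<zeta> t) * (\<zeta> t)\<^sup>2))) (at t within {0..})"
      by (auto intro!: derivative_eq_intros \<theta>_deriv'[OF t])
    ultimately show ?thesis
      unfolding G_def[abs_def] G'_def using DERIV_add by fastforce
  qed
  have G_less: "G t < Bz" if t: "0 \<le> t" "t \<le> T" for t
  proof (rule first_crossing[OF derG _ _ t])
    show "G 0 < Bz" by (simp add: G_def Bz_def)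
    fix s assume s: "0 < s" "s \<le> T" and eq: "G s = Bz" and before: "\<And>u. 0 \<le> u \<Longrightarrow> u < s \<Longrightarrow> G u < Bz"
    \<comment> \<open>Since \<theta> never decreases, neither does minus the exponential term; a
      first crossing by G is thus also a maximum of |\<zeta>| so far.\<close>
    have run_max: "\<bar>\<zeta> u\<bar> \<le> \<bar>\<zeta> s\<bar>" if u: "0 \<le> u" "u \<le> s" for u
    proof (cases "u = s")
      case False
      then have "G u < Bz" using before u by simp
      moreover have "exp (\<theta> 0 - \<theta> s) \<le> exp (\<theta> 0 - \<theta> u)" using \<theta>_mono[of u s] u s by simp
      then have "K * exp (\<theta> 0 - \<theta> s) \<le> K * exp (\<theta> 0 - \<theta> u)" using K by (rule mult_left_mono)
      ultimately have "(\<zeta> u)\<^sup>2 \<le> (\<zeta> s)\<^sup>2" using eq unfolding G_def by linarith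
      then show ?thesis by (simp add: abs_le_square_iff)
    qed simp
    have x0: "0 \<le> \<theta> s - \<theta> 0" using \<theta>_mono[of 0 s] s by simp
    have "K * exp (\<theta> 0 - \<theta> s) \<le> K * 1" using x0 K by (intro mult_left_mono) auto
    then have "1 \<le> (\<zeta> s)\<^sup>2" using eq unfolding G_def Bz_def by linarith
    then have z1: "1 \<le> \<bar>\<zeta> s\<bar>" using abs_le_square_iff[of 1 "\<zeta> s"] by simp
    define L where "L = 2 * C * \<bar>\<zeta> s\<bar>"
    have "C * 1 \<le> C * \<bar>\<zeta> s\<bar>" using C z1 by (intro mult_left_mono) auto
    then have CL: "C \<le> L" using C by (simp add: L_def)
    have "1 * \<bar>\<zeta> s\<bar> \<le> (2 * C) * \<bar>\<zeta> s\<bar>" using C by (intro mult_right_mono) auto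
    then have zL: "\<bar>\<zeta> s\<bar> \<le> L" by (simp add: L_def)
    have F: "\<bar>\<Delta> s + \<zeta> s + b * \<eta>h s\<bar> \<le> H L"
      using s run_max zL by (intro growth data_le_mono[OF C(1) CL]) (auto intro: order_trans)
    \<comment> \<open>The unknown factor 2 C is bounded either by a constant or by |\<zeta>| itself.
      Majorizing H at \<zeta>^2 is therefore enough, up to a factor that \<theta> overcomes.\<close>
    have "H L \<le> H (4 * C\<^sup>2) + H ((\<zeta> s)\<^sup>2)"
    proof (cases "\<bar>\<zeta> s\<bar> \<le> 2 * C")
      case True
      then have "2 * C * \<bar>\<zeta> s\<bar> \<le> 2 * C * (2 * C)" using C by (intro mult_left_mono) auto
      then have "H L \<le> H (4 * C\<^sup>2)" by (intro H) (simp add: L_def power2_eq_square)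
      then show ?thesis using H(2)[of "(\<zeta> s)\<^sup>2"] by linarith
    next
      case False
      then have "2 * C * \<bar>\<zeta> s\<bar> \<le> \<bar>\<zeta> s\<bar> * \<bar>\<zeta> s\<bar>" by (intro mult_right_mono) auto
      then have "H L \<le> H ((\<zeta> s)\<^sup>2)" by (intro H) (simp add: L_def power2_eq_square)
      then show ?thesis using H(2)[of "4 * C\<^sup>2"] by linarith
    qed
    also have "\<dots> \<le> (1 + H (4 * C\<^sup>2)) * (1 + H ((\<zeta> s)\<^sup>2))"
      using H(2)[of "(\<zeta> s)\<^sup>2"] H(2)[of "4 * C\<^sup>2"] by (simp add: algebra_simps)
    also have "\<dots> \<le> (1 + H (4 * C\<^sup>2)) * \<rho> (\<zeta> s)"
      using \<rho>H H(2)[of "4 * C\<^sup>2"] by (intro mult_left_mono) auto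
    finally have F': "\<bar>\<Delta> s + \<zeta> s + b * \<eta>h s\<bar> \<le> (A - 1) * \<rho> (\<zeta> s)" using F by (simp add: A_def)
    define N where "N = \<rho> (\<zeta> s) * (\<zeta> s)\<^sup>2"
    have "1 * 1 \<le> N" unfolding N_def using \<rho>[of "\<zeta> s"] \<open>1 \<le> (\<zeta> s)\<^sup>2\<close> by (intro mult_mono) auto
    then have N: "0 < N" by simp
    have A1: "1 \<le> A" using H(2)[of "4 * C\<^sup>2"] by (simp add: A_def)
    have "\<zeta> s * (\<Delta> s + \<zeta> s + b * \<eta>h s) \<le> \<bar>\<zeta> s\<bar> * \<bar>\<Delta> s + \<zeta> s + b * \<eta>h s\<bar>"
      by (simp add: abs_mult[symmetric])
    also have "\<dots> \<le> \<bar>\<zeta> s\<bar> * ((A - 1) * \<rho> (\<zeta> s))" by (intro mult_left_mono F') simp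
    also have "\<dots> \<le> (\<zeta> s)\<^sup>2 * ((A - 1) * \<rho> (\<zeta> s))"
    proof (rule mult_right_mono)
      show "\<bar>\<zeta> s\<bar> \<le> (\<zeta> s)\<^sup>2" using mult_right_mono[OF z1, of "\<bar>\<zeta> s\<bar>"] by (simp add: power2_eq_square)
      show "0 \<le> (A - 1) * \<rho> (\<zeta> s)" using A1 \<rho>[of "\<zeta> s"] by simp
    qed
    finally have 1: "\<zeta> s * (\<Delta> s + \<zeta> s + b * \<eta>h s) \<le> (A - 1) * N" by (simp add: N_def ac_simps)
    have "A - b * \<theta> s \<le> K * exp (\<theta> 0 - \<theta> s)"
    proof (cases "\<theta> s - \<theta> 0 \<le> p / b")
      case True
      have "p * 1 \<le> p * exp (p / b + (\<theta> 0 - \<theta> s))" using p True by (intro mult_left_mono) auto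
      then have "p \<le> K * exp (\<theta> 0 - \<theta> s)" by (simp add: K_def exp_add mult.assoc)
      moreover have "b * \<theta> 0 \<le> b * \<theta> s" using x0 b by simp
      ultimately show ?thesis using p by linarith
    next
      case False
      then have "p < b * (\<theta> s - \<theta> 0)" using b by (simp add: field_simps)
      then have "A - b * \<theta> s < 0" using p(2) by (simp add: algebra_simps)
      moreover have "0 \<le> K * exp (\<theta> 0 - \<theta> s)" using K by simp
      ultimately show ?thesis by linarith
    qed
    then have 2: "(A - b * \<theta> s) * N \<le> K * exp (\<theta> 0 - \<theta> s) * N" using N by (intro mult_right_mono) auto
    have "G' s = \<zeta> s * (\<Delta> s + \<zeta> s + b * \<eta>h s) - b * \<theta> s * N - K * exp (\<theta> 0 - \<theta> s) * N"
      by (simp add: G'_def N_def algebra_simps power2_eq_square)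
    then show "G' s < 0" using 1 2 N by (simp add: algebra_simps)
  qed
  show ?thesis
    unfolding zeta_le_def
  proof (intro allI impI)
    fix t assume t: "0 \<le> t" "t \<le> T"
    have "0 \<le> K * exp (\<theta> 0 - \<theta> t)" using K by simp
    then have "(\<zeta> t)\<^sup>2 \<le> 2 * Bz" using G_less[OF t] unfolding G_def by linarith
    moreover have "\<bar>\<zeta> t\<bar> \<le> 1 + (\<zeta> t)\<^sup>2" using zero_le_power2[of "\<bar>\<zeta> t\<bar> - 1"] by (simp add: power2_diff)
    moreover have "gain_bound H b C (\<zeta> 0) (\<theta> 0) = 1 + 2 * Bz"
      by (simp add: gain_bound_def Let_def Bz_def K_def p_def A_def)
    ultimately show "\<bar>\<zeta> t\<bar> \<le> gain_bound H b C (\<zeta> 0) (\<theta> 0)" by linarith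
  qed
qed

text \<open>The cross terms are quadratic with constants that depend on the state bound. The weights
  form a triangular scheme: \<open>p1\<close> pays for z, \<open>p2\<close> for the chain, including
  what \<open>p1\<close> costs, and \<open>p4\<close> for \<zeta> and the reference signals. The
  squares of \<open>\<eta>h\<close> from its own equation and from that of \<zeta> cancel. The term
  -p4 \<theta> supplies arbitrarily strong damping in \<zeta>, since the derivative of \<theta> is
  at least \<zeta>^2; the price is that the function is no longer nonnegative.\<close>

lemma lyapunov_decrease:
  assumes state: "state_le B"
    and c: "0 < c" "\<And>q. 0 \<le> q \<Longrightarrow> q \<le> B \<Longrightarrow> c * q\<^sup>2 \<le> \<alpha>d q"
    and \<Gamma>: "\<And>e. \<bar>e\<bar> \<le> B \<Longrightarrow> \<gamma>e e \<le> \<Gamma>"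
    and R: "B + norm z0 \<le> R" "B + \<bar>ystar\<bar> \<le> R"
    and Lg: "\<And>z x z' x'. norm z \<le> R \<Longrightarrow> norm x \<le> R \<Longrightarrow> norm z' \<le> R \<Longrightarrow> norm x' \<le> R \<Longrightarrow>
      \<bar>g z x w - g z' x' w\<bar> \<le> Lg * (norm (z - z') + norm (x - x'))" "0 \<le> Lg"
    and Ka: "\<And>y :: 'x. \<bar>zlin n k (chain_A n y)\<bar> \<le> Ka * norm y" "0 \<le> Ka"
    and KX: "KX = 4 * CQ\<^sup>2 * (1 + (zlin n k u1)\<^sup>2)"
    and KD: "KD = 3 * (Ka + Lg)\<^sup>2 * KX + 3 * Lg\<^sup>2 + 3 * (zlin n k u1)\<^sup>2"
    and K: "\<sigma> * \<Gamma> * KX \<le> K" "2 * CQ \<le> K" "2 * CQ * (zlin n k u1)\<^sup>2 \<le> K" "(1 + KD) / b\<^sup>2 \<le> K"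
      "KD / 2 + 3 / 2 + b\<^sup>2 / 2 \<le> K" "KX \<le> K"
    and p: "p1 = 2 * K / c" "p2 = (3 * K + p1 * K) / cQ" "p4 = 3 * K + p1 * K + p2 * K"
    and vr: "(vr has_real_derivative dvr) (at t within {0..})" "dvr \<le> - ((r t - ystar)\<^sup>2 + (\<mu> t)\<^sup>2)"
    and t: "0 \<le> t" "t \<le> T"
  shows "\<exists>d \<le> - (xh t \<bullet> u1)\<^sup>2. ((\<lambda>t. (\<zeta> t)\<^sup>2 / 2 + b * (\<theta> t)\<^sup>2 / 2 + (\<eta>h t)\<^sup>2 / 2
      + p1 * V (zh t) + p2 * Q (xh t) + p4 * vr t - p4 * \<theta> t) has_real_derivative d) (at t within {0..})"
proof -
  define \<kappa> where "\<kappa> = zlin n k u1"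
  define a1 a3 a5 X where "a1 = (norm (zh t))\<^sup>2" "a3 = (\<eta>h t)\<^sup>2" "a5 = (r t - ystar)\<^sup>2 + (\<mu> t)\<^sup>2" "X = norm (xh t)"
  note defs = a1_a3_a5_X_def
  define aq az where "aq = Q (xh t)" "az = (\<zeta> t)\<^sup>2"
  note defs' = aq_az_def
  have nonneg: "0 \<le> a1" "0 \<le> a3" "0 \<le> a5" "0 \<le> aq" "0 \<le> az" "0 \<le> X"
    by (simp_all add: defs defs' Q_nonneg)
  have KX0: "0 \<le> KX" by (simp add: KX)
  have KD0: "0 \<le> KD" using KX0 by (simp add: KD)
  have st: "norm (zh t) \<le> B" "X \<le> B" using state t by (auto simp: state_le_def defs)
  have \<delta>2: "(\<delta> t)\<^sup>2 \<le> \<kappa>\<^sup>2 * a5"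
    by (simp add: \<delta>_def \<kappa>_def defs power_mult_distrib mult_left_mono)
  have sum2: "(u + v)\<^sup>2 \<le> 2 * u\<^sup>2 + 2 * v\<^sup>2" for u v :: real
    using zero_le_power2[of "u - v"] by (simp add: power2_sum power2_diff)
  have zd2: "(\<zeta> t + \<delta> t)\<^sup>2 \<le> 2 * az + 2 * \<kappa>\<^sup>2 * a5"
    using sum2[of "\<zeta> t" "\<delta> t"] \<delta>2 by (simp add: defs')
  \<comment> \<open>Here a1, a3, a5, aq, az are the squared sizes of z-error, \<open>\<eta>h\<close>
    and reference mismatch with its speed, the value of Q, and \<zeta>^2.\<close>
  have X2: "X\<^sup>2 \<le> KX * (aq + az + a5)"
  proof -
    have "X\<^sup>2 \<le> (CQ * (sqrt aq + \<bar>\<zeta> t + \<delta> t\<bar>))\<^sup>2"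
      using Q_norm[OF xh_space[OF t]] nonneg by (intro power_mono) (auto simp: defs defs' zlin_xh)
    also have "\<dots> \<le> CQ\<^sup>2 * (2 * aq + 2 * (\<zeta> t + \<delta> t)\<^sup>2)"
      using sum2[of "sqrt aq" "\<bar>\<zeta> t + \<delta> t\<bar>"] nonneg
      by (simp add: power_mult_distrib mult_left_mono)
    also have "\<dots> \<le> CQ\<^sup>2 * (4 * (1 + \<kappa>\<^sup>2) * (aq + az + a5))"
    proof (rule mult_left_mono)
      have "0 \<le> \<kappa>\<^sup>2 * aq" "0 \<le> \<kappa>\<^sup>2 * az" using nonneg by simp_all
      then have "2 * aq + 2 * (2 * az + 2 * \<kappa>\<^sup>2 * a5) \<le> 4 * (1 + \<kappa>\<^sup>2) * (aq + az + a5)"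
        using nonneg by (simp add: algebra_simps)
      moreover have "2 * (\<zeta> t + \<delta> t)\<^sup>2 \<le> 2 * (2 * az + 2 * \<kappa>\<^sup>2 * a5)"
        using zd2 by (intro mult_left_mono) auto
      ultimately show "2 * aq + 2 * (\<zeta> t + \<delta> t)\<^sup>2 \<le> 4 * (1 + \<kappa>\<^sup>2) * (aq + az + a5)"
        by (meson add_left_mono order_trans)
    qed simp
    also have "\<dots> = KX * (aq + az + a5)" unfolding KX \<kappa>_def by (simp only: mult_ac)
    finally show ?thesis .
  qed
  have e2: "(xh t \<bullet> u1)\<^sup>2 \<le> X\<^sup>2"
    using abs_inner_xh[of t] power_mono[of "\<bar>xh t \<bullet> u1\<bar>" X 2] by (simp add: defs)
  have S0: "0 \<le> aq + az + a5" "0 \<le> a1 + (aq + az + a5)" using nonneg by auto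
  have K0: "0 \<le> K" using K(6) KX0 by linarith
  have iV: "dV t \<le> - c * a1 + K * (aq + az + a5)"
  proof -
    have e_B: "\<bar>xh t \<bullet> u1\<bar> \<le> B" using abs_inner_xh[of t] st(2) by (simp add: defs)
    have "0 \<le> \<Gamma>" using \<Gamma>[OF e_B] \<gamma>e(2)[of "xh t \<bullet> u1"] by linarith
    have "\<sigma> * \<gamma>e (xh t \<bullet> u1) * (xh t \<bullet> u1)\<^sup>2 \<le> \<sigma> * \<Gamma> * (KX * (aq + az + a5))"
      using \<Gamma>[OF e_B] \<gamma>e(2) \<sigma> e2 X2 \<open>0 \<le> \<Gamma>\<close> by (intro mult_mono mult_nonneg_nonneg) auto
    also have "\<dots> = \<sigma> * \<Gamma> * KX * (aq + az + a5)" by simp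
    also have "\<dots> \<le> K * (aq + az + a5)" by (rule mult_right_mono[OF K(1) S0(1)])
    finally show ?thesis using dV_le[OF t] c(2)[OF norm_ge_zero st(1)] by (simp add: defs)
  qed
  have iQ: "dQ t \<le> - cQ * aq + K * (az + a5)"
  proof -
    have "CQ * (\<zeta> t + \<delta> t)\<^sup>2 \<le> CQ * (2 * az + 2 * \<kappa>\<^sup>2 * a5)" using cQ zd2 by (intro mult_left_mono) auto
    also have "\<dots> = (2 * CQ) * az + (2 * CQ * \<kappa>\<^sup>2) * a5" by (simp add: algebra_simps)
    also have "\<dots> \<le> K * az + K * a5"
      using K(2,3) nonneg by (intro add_mono mult_right_mono) (auto simp: \<kappa>_def)
    finally show ?thesis using dQ_le[of t] by (simp add: defs' algebra_simps)
  qed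
  have D2: "(\<Delta> t)\<^sup>2 \<le> KD * (a1 + (aq + az + a5))"
  proof -
    have nz: "norm (z t) \<le> R" using norm_triangle_ineq[of "zh t" z0] st(1) R by (simp add: zh_def)
    have nu: "norm (ystar *\<^sub>R u1) = \<bar>ystar\<bar>" using n by (simp add: norm_unit_vec)
    have "norm (x t) \<le> norm (xh t) + norm (ystar *\<^sub>R u1)"
      using norm_triangle_ineq[of "xh t" "ystar *\<^sub>R u1"] by (simp add: xh_def)
    then have nx: "norm (x t) \<le> R" using st(2) R(2) nu unfolding defs by linarith
    have B0: "0 \<le> B" using st(1) norm_ge_zero[of "zh t"] by linarith
    have "\<bar>g (z t) (x t) w - g z0 (ystar *\<^sub>R u1) w\<bar> \<le> Lg * (norm (z t - z0) + norm (x t - ystar *\<^sub>R u1))"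
      by (rule Lg(1)) (use nz nx nu R B0 in auto)
    then have "\<bar>g (z t) (x t) w - g z0 (ystar *\<^sub>R u1) w\<bar> \<le> Lg * norm (zh t) + Lg * X"
      by (simp add: zh_def xh_def defs distrib_left)
    moreover have "\<bar>zlin n k (chain_A n (xh t))\<bar> \<le> Ka * X" using Ka(1) by (simp add: defs)
    ultimately have "\<bar>\<Delta> t\<bar> \<le> (Ka + Lg) * X + Lg * norm (zh t) + \<bar>\<kappa> * \<mu> t\<bar>"
      unfolding \<Delta>_def \<kappa>_def by (simp add: distrib_right)
    then have "\<bar>\<Delta> t\<bar>\<^sup>2 \<le> ((Ka + Lg) * X + Lg * norm (zh t) + \<bar>\<kappa> * \<mu> t\<bar>)\<^sup>2"
      by (rule power_mono) simp
    also have "\<dots> \<le> 3 * ((Ka + Lg) * X)\<^sup>2 + 3 * (Lg * norm (zh t))\<^sup>2 + 3 * \<bar>\<kappa> * \<mu> t\<bar>\<^sup>2"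
    proof -
      have "(u + v + y)\<^sup>2 \<le> 3 * u\<^sup>2 + 3 * v\<^sup>2 + 3 * y\<^sup>2" for u v y :: real
        using zero_le_power2[of "u - v"] zero_le_power2[of "v - y"] zero_le_power2[of "u - y"]
        by (simp add: power2_eq_square algebra_simps)
      then show ?thesis .
    qed
    also have "\<dots> = 3 * (Ka + Lg)\<^sup>2 * X\<^sup>2 + 3 * Lg\<^sup>2 * a1 + 3 * \<kappa>\<^sup>2 * (\<mu> t)\<^sup>2"
      by (simp add: power_mult_distrib defs)
    also have "\<dots> \<le> 3 * (Ka + Lg)\<^sup>2 * (KX * (a1 + (aq + az + a5))) + 3 * Lg\<^sup>2 * (a1 + (aq + az + a5)) + 3 * \<kappa>\<^sup>2 * (a1 + (aq + az + a5))"
    proof (intro add_mono mult_left_mono)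
      have "KX * (aq + az + a5) \<le> KX * (a1 + (aq + az + a5))" using KX0 nonneg by (intro mult_left_mono) auto
      then show "X\<^sup>2 \<le> KX * (a1 + (aq + az + a5))" using X2 by linarith
      show "a1 \<le> a1 + (aq + az + a5)" using S0 by simp
      have "(\<mu> t)\<^sup>2 \<le> a5" by (simp add: defs)
      then show "(\<mu> t)\<^sup>2 \<le> a1 + (aq + az + a5)" using nonneg by linarith
    qed simp_all
    also have "\<dots> = KD * (a1 + (aq + az + a5))" by (simp add: KD \<kappa>_def algebra_simps)
    finally show ?thesis by simp
  qed
  have az_S: "az \<le> a1 + (aq + az + a5)" using nonneg by linarith
  have i\<eta>: "\<eta>h t * (- \<eta>h t - (\<zeta> t + \<Delta> t) / b) \<le> - a3 / 2 + K * (a1 + (aq + az + a5))"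
  proof -
    define Y where "Y = (\<zeta> t + \<Delta> t) / b"
    have "- (\<eta>h t * Y) \<le> a3 / 2 + Y\<^sup>2 / 2"
      using zero_le_power2[of "\<eta>h t + Y"] by (simp add: defs power2_sum)
    moreover have "Y\<^sup>2 / 2 \<le> ((\<zeta> t)\<^sup>2 + (\<Delta> t)\<^sup>2) / b\<^sup>2"
    proof -
      have "Y\<^sup>2 / 2 = (\<zeta> t + \<Delta> t)\<^sup>2 / (2 * b\<^sup>2)" by (simp add: Y_def power_divide)
      also have "\<dots> \<le> (2 * (\<zeta> t)\<^sup>2 + 2 * (\<Delta> t)\<^sup>2) / (2 * b\<^sup>2)"
        by (rule divide_right_mono[OF sum2]) simp
      also have "\<dots> = ((\<zeta> t)\<^sup>2 + (\<Delta> t)\<^sup>2) / b\<^sup>2" using b by (simp add: field_simps)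
      finally show ?thesis .
    qed
    moreover have "((\<zeta> t)\<^sup>2 + (\<Delta> t)\<^sup>2) / b\<^sup>2 \<le> ((a1 + (aq + az + a5)) + KD * (a1 + (aq + az + a5))) / b\<^sup>2"
      using az_S D2 by (intro divide_right_mono add_mono) (auto simp: defs')
    moreover have "\<dots> = (1 + KD) / b\<^sup>2 * (a1 + (aq + az + a5))" by (simp add: distrib_right)
    moreover have "\<dots> \<le> K * (a1 + (aq + az + a5))" by (rule mult_right_mono[OF K(4) S0(2)])
    moreover have "\<eta>h t * (- \<eta>h t - Y) = - a3 - \<eta>h t * Y" by (simp add: defs power2_eq_square algebra_simps)
    ultimately show ?thesis unfolding Y_def[symmetric] by linarith
  qed
  have i\<zeta>: "\<zeta> t * (\<Delta> t + \<zeta> t + b * \<eta>h t) \<le> a3 / 2 + K * (a1 + (aq + az + a5))"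
  proof -
    have "\<zeta> t * \<Delta> t \<le> az / 2 + (\<Delta> t)\<^sup>2 / 2"
      using zero_le_power2[of "\<zeta> t - \<Delta> t"] by (simp add: defs' power2_diff)
    moreover have "(b * \<zeta> t) * \<eta>h t \<le> b\<^sup>2 * az / 2 + a3 / 2"
      using zero_le_power2[of "b * \<zeta> t - \<eta>h t"] by (simp add: defs defs' power2_diff power_mult_distrib)
    moreover have "\<zeta> t * (\<Delta> t + \<zeta> t + b * \<eta>h t) = \<zeta> t * \<Delta> t + az + (b * \<zeta> t) * \<eta>h t"
      by (simp add: defs' power2_eq_square algebra_simps)
    moreover have "3 / 2 * az + b\<^sup>2 * az / 2 \<le> (3 / 2 + b\<^sup>2 / 2) * (a1 + (aq + az + a5))"
    proof -
      have "3 / 2 * az + b\<^sup>2 * az / 2 = (3 / 2 + b\<^sup>2 / 2) * az" by (simp add: algebra_simps)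
      then show ?thesis using mult_left_mono[OF az_S, of "3 / 2 + b\<^sup>2 / 2"] by simp
    qed
    moreover have "KD * (a1 + (aq + az + a5)) / 2 + (3 / 2 + b\<^sup>2 / 2) * (a1 + (aq + az + a5))
        \<le> K * (a1 + (aq + az + a5))"
    proof -
      have "KD * y / 2 + (3 / 2 + b\<^sup>2 / 2) * y = (KD / 2 + 3 / 2 + b\<^sup>2 / 2) * y" for y :: real
        by (simp add: algebra_simps)
      then show ?thesis using mult_right_mono[OF K(5) S0(2)] by simp
    qed
    ultimately show ?thesis using D2 by linarith
  qed
  define N where "N = \<rho> (\<zeta> t) * (\<zeta> t)\<^sup>2"
  have N: "az \<le> N" using mult_right_mono[OF \<rho>[of "\<zeta> t"], of az] nonneg by (simp add: N_def defs')
  \<comment> \<open>K also dominates \<open>KX\<close>, so the surplus left by the weights controls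
    the squared output error.\<close>
  have K2: "K * (aq + az + a5) \<ge> (xh t \<bullet> u1)\<^sup>2"
    using mult_right_mono[OF K(6) S0(1)] X2 e2 by linarith
  have p1: "0 \<le> p1" "p1 * c = 2 * K" using K0 c by (simp_all add: p)
  have p2: "0 \<le> p2" "p2 * cQ = 3 * K + p1 * K" using K0 p1 cQ by (simp_all add: p(2))
  have p4: "0 \<le> p4" using K0 p1 p2 by (simp add: p(3))
  define d where "d = \<zeta> t * (\<Delta> t + \<zeta> t + b * \<eta>h t - b * \<theta> t * \<rho> (\<zeta> t) * \<zeta> t) + b * \<theta> t * N
    + \<eta>h t * (- \<eta>h t - (\<zeta> t + \<Delta> t) / b) + p1 * dV t + p2 * dQ t + p4 * dvr - p4 * N"
  \<comment> \<open>The derivative of b \<theta>^2 / 2 cancels the adaptive feedback term of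
    \<zeta>^2 / 2.\<close>
  have "d = \<zeta> t * (\<Delta> t + \<zeta> t + b * \<eta>h t) + \<eta>h t * (- \<eta>h t - (\<zeta> t + \<Delta> t) / b) + p1 * dV t + p2 * dQ t + p4 * dvr - p4 * N"
    by (simp add: d_def N_def power2_eq_square algebra_simps)
  also have "\<dots> \<le> (a3 / 2 + K * (a1 + (aq + az + a5))) + (- a3 / 2 + K * (a1 + (aq + az + a5)))
    + p1 * (- c * a1 + K * (aq + az + a5)) + p2 * (- cQ * aq + K * (az + a5)) + p4 * (- a5) - p4 * az"
    using i\<zeta> i\<eta> mult_left_mono[OF iV p1(1)] mult_left_mono[OF iQ p2(1)] mult_left_mono[OF N p4]
      mult_left_mono[OF vr(2) p4] unfolding defs(3) by linarith
  also have "\<dots> = 2 * K * (a1 + (aq + az + a5)) - (p1 * c) * a1 + p1 * K * (aq + az + a5) - (p2 * cQ) * aq + p2 * K * (az + a5)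
      - p4 * a5 - p4 * az"
    by (simp add: algebra_simps)
  also have "\<dots> = - (K * (aq + az + a5))"
    unfolding p1(2) p2(2) p(3) by (simp add: algebra_simps)
  finally have "d \<le> - (xh t \<bullet> u1)\<^sup>2" using K2 by linarith
  moreover have "((\<lambda>t. (\<zeta> t)\<^sup>2 / 2 + b * (\<theta> t)\<^sup>2 / 2 + (\<eta>h t)\<^sup>2 / 2
      + p1 * V (zh t) + p2 * Q (xh t) + p4 * vr t - p4 * \<theta> t) has_real_derivative d) (at t within {0..})"
  proof -
    have sq: "((\<lambda>t. (f t)\<^sup>2 / 2) has_real_derivative f t * f') (at t within {0..})"
      and sqb: "((\<lambda>t. b * (f t)\<^sup>2 / 2) has_real_derivative b * f t * f') (at t within {0..})"
      if "(f has_real_derivative f') (at t within {0..})" for f f'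
      using DERIV_cdivide[OF DERIV_power[OF that, of 2], of 2]
        DERIV_cdivide[OF DERIV_cmult[OF DERIV_power[OF that, of 2], of b], of 2] by (simp_all add: ac_simps)
    show ?thesis
      unfolding d_def N_def
      by (intro DERIV_add DERIV_diff DERIV_cmult sq sqb \<zeta>_deriv[OF t] \<theta>_deriv'[OF t] \<eta>h_deriv[OF t]
          V_zh_deriv[OF t] Q_xh_deriv[OF t] vr(1))
  qed
  ultimately show ?thesis by blast
qed

end

text \<open>\<open>vr\<close> stands for the Lyapunov function of the reference generator along the trajectory.\<close>

definition run_bounded where
  "run_bounded n m k g \<alpha>lo \<alpha>up \<alpha>d \<gamma>e Q DQ cQ CQ h w b V \<sigma> z0 ystar us \<rho>
      (zi :: 'z::euclidean_space) (xi :: 'x::euclidean_space) \<eta>i \<theta>i ri vi R Bd Wf \<longleftrightarrow>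
    (\<forall>T z x \<eta> \<theta> r \<mu> vr dvr t.
      agent_run n m k g \<alpha>lo \<alpha>up \<alpha>d \<gamma>e Q DQ cQ CQ h w b V \<sigma> z0 ystar us \<rho> T z x \<eta> \<theta> r \<mu> \<longrightarrow>
      z 0 = zi \<longrightarrow> x 0 = xi \<longrightarrow> \<eta> 0 = \<eta>i \<longrightarrow> \<theta> 0 = \<theta>i \<longrightarrow> r 0 = ri \<longrightarrow> vr 0 = vi \<longrightarrow>
      (\<forall>s. 0 \<le> s \<longrightarrow> s \<le> T \<longrightarrow> \<bar>r s - ystar\<bar> \<le> R \<and> \<bar>\<mu> s\<bar> \<le> R) \<longrightarrow>
      (\<forall>s. 0 \<le> s \<longrightarrow> s \<le> T \<longrightarrow> 0 \<le> vr s \<and> (vr has_real_derivative dvr s) (at s within {0..})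
        \<and> dvr s \<le> - ((r s - ystar)\<^sup>2 + (\<mu> s)\<^sup>2)) \<longrightarrow>
      0 \<le> t \<longrightarrow> t \<le> T \<longrightarrow>
      norm (z t) \<le> Bd \<and> norm (x t) \<le> Bd \<and> \<bar>\<eta> t\<bar> \<le> Bd \<and> \<bar>\<theta> t\<bar> \<le> Bd \<and> - Bd \<le> Wf z x \<eta> \<theta> r vr t
      \<and> (\<exists>d \<le> - (x t \<bullet> unit_vec 1 - ystar)\<^sup>2. (Wf z x \<eta> \<theta> r vr has_real_derivative d) (at t within {0..})))"

text \<open>All constants come from the plant, the initial data and the bound R on the reference
  signals, before a run is considered: the \<zeta> bound gives a ball, the ball gives Lipschitz and
  quadratic constants, and these give the weights. The decrease of the Lyapunov function then bounds
  \<theta>.\<close>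

lemma (in agent_plant) ex_run_bounded:
  assumes growth: "growth_function H" and \<rho>H: "\<And>y. 1 + H (y\<^sup>2) \<le> \<rho> y"
  shows "\<exists>Bd Wf. run_bounded n m k g \<alpha>lo \<alpha>up \<alpha>d \<gamma>e Q DQ cQ CQ h w b V \<sigma> z0 ystar us \<rho> zi xi \<eta>i \<theta>i ri vi R Bd Wf"
proof -
  have H: "\<And>s t. s \<le> t \<Longrightarrow> H s \<le> H t" "\<And>s. 0 \<le> H s" and dom: "\<And>L. dominated L (H L)"
    using growth unfolding growth_function_def by blast+
  define \<kappa> where "\<kappa> = zlin n k (unit_vec 1 :: 'x)"
  define \<zeta>i where "\<zeta>i = zeta n k xi ri"
  define \<eta>hi where "\<eta>hi = \<eta>i - us - \<zeta>i / b"
  define Qi where "Qi = Q (xi - ystar *\<^sub>R unit_vec 1)"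
  define Vi where "Vi = V (zi - z0)"
  \<comment> \<open>A crude sum that dominates every entry of \<open>data_le\<close>.\<close>
  define C where "C = 1 + norm w + \<bar>ystar\<bar> + norm z0 + \<sigma> + b + 1 / b + \<bar>Qi\<bar> + \<bar>Vi\<bar> + \<bar>\<eta>hi\<bar> + \<bar>R\<bar> + \<bar>\<kappa>\<bar> * \<bar>R\<bar>"
  have C: "1 \<le> C" "norm w \<le> C" "\<bar>ystar\<bar> \<le> C" "norm z0 \<le> C" "\<sigma> \<le> C" "b \<le> C" "1 / b \<le> C" "Qi \<le> C" "Vi \<le> C"
    "\<bar>\<eta>hi\<bar> \<le> C" "\<bar>R\<bar> \<le> C" "\<bar>\<kappa>\<bar> * \<bar>R\<bar> \<le> C"
  proof -
    have "0 \<le> norm w" "0 \<le> norm z0" "0 < 1 / b" "0 \<le> \<bar>\<kappa>\<bar> * \<bar>R\<bar>" using b by simp_all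
    then show "1 \<le> C" "norm w \<le> C" "\<bar>ystar\<bar> \<le> C" "norm z0 \<le> C" "\<sigma> \<le> C" "b \<le> C" "1 / b \<le> C" "Qi \<le> C" "Vi \<le> C"
      "\<bar>\<eta>hi\<bar> \<le> C" "\<bar>R\<bar> \<le> C" "\<bar>\<kappa>\<bar> * \<bar>R\<bar> \<le> C"
      using b \<sigma> unfolding C_def by linarith+
  qed
  define L where "L = max C (gain_bound H b C \<zeta>i \<theta>i)"
  have L: "C \<le> L" "gain_bound H b C \<zeta>i \<theta>i \<le> L" unfolding L_def by simp_all
  define B where "B = H L"
  have B0: "0 \<le> B" using H(2) by (simp add: B_def)
  obtain c where c: "0 < c" "\<And>q. 0 \<le> q \<Longrightarrow> q \<le> B \<Longrightarrow> c * q\<^sup>2 \<le> \<alpha>d q" using \<alpha>d_quadratic by blast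
  have "compact (\<gamma>e ` {-B..B})"
    by (intro compact_continuous_image continuous_on_subset[OF \<gamma>e(1)]) auto
  from compact_imp_bounded[OF this] obtain \<Gamma> where "\<forall>e\<in>{-B..B}. \<bar>\<gamma>e e\<bar> \<le> \<Gamma>"
    by (auto simp: bounded_iff)
  then have \<Gamma>: "\<gamma>e e \<le> \<Gamma>" if "\<bar>e\<bar> \<le> B" for e
    using that by (metis abs_le_D1 abs_le_iff atLeastAtMost_iff minus_le_iff)
  define Rr where "Rr = B + norm z0 + \<bar>ystar\<bar>"
  have Rr: "B + norm z0 \<le> Rr" "B + \<bar>ystar\<bar> \<le> Rr" unfolding Rr_def by simp_all
  obtain Lg where Lg: "0 \<le> Lg" "\<And>p p'. norm p \<le> Rr + (Rr + norm w) \<Longrightarrow> norm p' \<le> Rr + (Rr + norm w) \<Longrightarrow>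
      norm ((\<lambda>(z, x, w). g z x w) p - (\<lambda>(z, x, w). g z x w) p') \<le> Lg * norm (p - p')"
    using loc_lipD[OF g_lip] by blast
  have Lg': "\<bar>g z x w - g z' x' w\<bar> \<le> Lg * (norm (z - z') + norm (x - x'))"
    if "norm z \<le> Rr" "norm x \<le> Rr" "norm z' \<le> Rr" "norm x' \<le> Rr" for z x z' x'
  proof -
    have nt: "norm (u, v, y) \<le> norm u + (norm v + norm y)" for u :: 'z and v :: 'x and y :: 'w
      using norm_Pair_le[of u "(v, y)"] norm_Pair_le[of v y] by linarith
    have "\<bar>g z x w - g z' x' w\<bar> \<le> Lg * norm ((z, x, w) - (z', x', w))"
      using Lg(2)[of "(z, x, w)" "(z', x', w)"] nt[of z x w] nt[of z' x' w] that by simp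
    also have "\<dots> \<le> Lg * (norm (z - z') + norm (x - x'))"
      using nt[of "z - z'" "x - x'" 0] Lg(1) by (intro mult_left_mono) simp_all
    finally show ?thesis .
  qed
  have "linear (\<lambda>y :: 'x. zlin n k (chain_A n y))"
    using linear_compose[OF linear_chain_A linear_zlin] by (simp add: o_def)
  from linear_bounded_pos[OF this] obtain Ka where
    Ka: "0 < Ka" "\<And>y :: 'x. norm (zlin n k (chain_A n y)) \<le> Ka * norm y" by blast
  define KX where "KX = 4 * CQ\<^sup>2 * (1 + \<kappa>\<^sup>2)"
  define KD where "KD = 3 * (Ka + Lg)\<^sup>2 * KX + 3 * Lg\<^sup>2 + 3 * \<kappa>\<^sup>2"
  define K where "K = \<bar>\<sigma> * \<Gamma> * KX\<bar> + 2 * CQ + 2 * CQ * \<kappa>\<^sup>2 + (1 + KD) / b\<^sup>2 + (KD / 2 + 3 / 2 + b\<^sup>2 / 2) + KX"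
  have K: "\<sigma> * \<Gamma> * KX \<le> K" "2 * CQ \<le> K" "2 * CQ * \<kappa>\<^sup>2 \<le> K" "(1 + KD) / b\<^sup>2 \<le> K"
      "KD / 2 + 3 / 2 + b\<^sup>2 / 2 \<le> K" "KX \<le> K"
  proof -
    have KX0: "0 \<le> KX" by (simp add: KX_def)
    then have KD0: "0 \<le> KD" by (simp add: KD_def)
    have "0 \<le> 2 * CQ" "0 \<le> 2 * CQ * \<kappa>\<^sup>2" "0 \<le> (1 + KD) / b\<^sup>2" "0 \<le> b\<^sup>2 / 2" using cQ KD0 by simp_all
    then show "\<sigma> * \<Gamma> * KX \<le> K" "2 * CQ \<le> K" "2 * CQ * \<kappa>\<^sup>2 \<le> K" "(1 + KD) / b\<^sup>2 \<le> K"
      "KD / 2 + 3 / 2 + b\<^sup>2 / 2 \<le> K" "KX \<le> K" using KX0 KD0 unfolding K_def by linarith+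
  qed
  define p1 where "p1 = 2 * K / c"
  define p2 where "p2 = (3 * K + p1 * K) / cQ"
  define p4 where "p4 = 3 * K + p1 * K + p2 * K"
  have K0: "0 \<le> K" using K(2) cQ by linarith
  have p: "0 \<le> p1" "0 \<le> p2" "0 \<le> p4" using K0 c cQ by (simp_all add: p1_def p2_def p4_def)
  \<comment> \<open>As a function of values rather than of a run, so that the initial level
    \<open>Wi\<close> is determined by the initial data.\<close>
  define w0 where "w0 \<zeta> \<theta> \<eta>h Vv Qv v = \<zeta>\<^sup>2 / 2 + b * \<theta>\<^sup>2 / 2 + \<eta>h\<^sup>2 / 2 + p1 * Vv + p2 * Qv + p4 * v - p4 * \<theta>"
    for \<zeta> \<theta> \<eta>h Vv Qv v :: real
  define Wf where "Wf z x \<eta> \<theta> r vr t = w0 (zeta n k (x t) (r t)) (\<theta> t) (\<eta> t - us - zeta n k (x t) (r t) / b)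
      (V (z t - z0)) (Q (x t - ystar *\<^sub>R unit_vec 1)) (vr t)"
    for z :: "real \<Rightarrow> 'z" and x :: "real \<Rightarrow> 'x" and \<eta> \<theta> r vr :: "real \<Rightarrow> real" and t
  define Wi where "Wi = w0 \<zeta>i \<theta>i \<eta>hi Vi Qi vi"
  define \<Theta> where "\<Theta> = 1 + 4 * (\<bar>Wi\<bar> + p4\<^sup>2 / b) / b"
  define Bd where "Bd = (B + norm z0) + (B + \<bar>ystar\<bar>) + (B + \<bar>us\<bar> + L / b) + \<Theta> + p4\<^sup>2 / b"
  have "run_bounded n m k g \<alpha>lo \<alpha>up \<alpha>d \<gamma>e Q DQ cQ CQ h w b V \<sigma> z0 ystar us \<rho> zi xi \<eta>i \<theta>i ri vi R Bd Wf"
    unfolding run_bounded_def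
  proof (intro allI impI)
    fix T z x \<eta> \<theta> r \<mu> vr dvr t
    assume run: "agent_run n m k g \<alpha>lo \<alpha>up \<alpha>d \<gamma>e Q DQ cQ CQ h w b V \<sigma> z0 ystar us \<rho> T z x \<eta> \<theta> r \<mu>"
      and ini: "z 0 = zi" "x 0 = xi" "\<eta> 0 = \<eta>i" "\<theta> 0 = \<theta>i" "r 0 = ri" "vr 0 = vi"
      and Rb': "\<forall>s. 0 \<le> s \<longrightarrow> s \<le> T \<longrightarrow> \<bar>r s - ystar\<bar> \<le> R \<and> \<bar>\<mu> s\<bar> \<le> R"
      and vr': "\<forall>s. 0 \<le> s \<longrightarrow> s \<le> T \<longrightarrow> 0 \<le> vr s \<and> (vr has_real_derivative dvr s) (at s within {0..})
        \<and> dvr s \<le> - ((r s - ystar)\<^sup>2 + (\<mu> s)\<^sup>2)"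
      and t: "0 \<le> t" "t \<le> T"
    note Rb = Rb'[rule_format] and vr = vr'[rule_format]
    interpret agent_run n m k g \<alpha>lo \<alpha>up \<alpha>d \<gamma>e Q DQ cQ CQ h w b V \<sigma> z0 ystar us \<rho> T z x \<eta> \<theta> r \<mu> by (rule run)
    have \<zeta>0: "\<zeta> 0 = \<zeta>i" by (simp add: \<zeta>_def \<zeta>i_def ini)
    have \<eta>h0: "\<eta>h 0 = \<eta>hi" by (simp add: \<eta>h_def \<eta>hi_def ini \<zeta>0)
    have Q0: "Q (xh 0) = Qi" by (simp add: xh_def Qi_def ini)
    have V0: "V (zh 0) = Vi" by (simp add: zh_def Vi_def ini)
    have "\<bar>\<delta> s\<bar> \<le> C" "\<bar>\<mu> s\<bar> \<le> C" if "0 \<le> s" "s \<le> T" for s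
    proof -
      have "\<bar>r s - ystar\<bar> \<le> \<bar>R\<bar>" using Rb[OF that] by linarith
      then have "\<bar>\<kappa>\<bar> * \<bar>r s - ystar\<bar> \<le> \<bar>\<kappa>\<bar> * \<bar>R\<bar>" by (rule mult_left_mono) simp
      then show "\<bar>\<delta> s\<bar> \<le> C" using C(12) by (simp add: \<delta>_def \<kappa>_def abs_mult)
      show "\<bar>\<mu> s\<bar> \<le> C" using Rb[OF that] C(11) by linarith
    qed
    then have data: "data_le C" unfolding data_le_def \<eta>h0 Q0 V0 using C by blast
    have zetC: "zeta_le (gain_bound H b C (\<zeta> 0) (\<theta> 0))"
    proof (rule zeta_le_gain_bound[OF H _ \<rho>H data C(1)])
      fix s L' assume s: "0 \<le> s" "s \<le> T" and d: "data_le L'" and zb: "\<And>u. 0 \<le> u \<Longrightarrow> u \<le> s \<Longrightarrow> \<bar>\<zeta> u\<bar> \<le> L'"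
      \<comment> \<open>The growth bound is applied to the run stopped at s, where only the past of
        \<zeta> counts.\<close>
      interpret r: agent_run n m k g \<alpha>lo \<alpha>up \<alpha>d \<gamma>e Q DQ cQ CQ h w b V \<sigma> z0 ystar us \<rho> s z x \<eta> \<theta> r \<mu>
        by (rule run_restrict[OF s(2)])
      have "r.data_le L'" using d s unfolding data_le_def r.data_le_def by auto
      moreover have "r.zeta_le L'" using zb unfolding r.zeta_le_def by auto
      ultimately have "r.state_le (H L')" using dom r.agent_run_axioms unfolding dominated_def by blast
      then show "\<bar>\<Delta> s + \<zeta> s + b * \<eta>h s\<bar> \<le> H L'" using s unfolding r.state_le_def by auto
    qed
    have zet: "zeta_le L" using zeta_le_mono[OF zetC] L(2) by (simp add: \<zeta>0 ini)
    have dat: "data_le L" by (rule data_le_mono[OF data L(1)])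
    have state: "state_le B" using dom run dat zet unfolding B_def dominated_def by blast
    have W_eq: "Wf z x \<eta> \<theta> r vr = (\<lambda>t. (\<zeta> t)\<^sup>2 / 2 + b * (\<theta> t)\<^sup>2 / 2 + (\<eta>h t)\<^sup>2 / 2
      + p1 * V (zh t) + p2 * Q (xh t) + p4 * vr t - p4 * \<theta> t)"
      by (simp add: fun_eq_iff Wf_def w0_def \<zeta>_def \<eta>h_def zh_def xh_def)
    have dW: "\<exists>d \<le> - (xh s \<bullet> u1)\<^sup>2. (Wf z x \<eta> \<theta> r vr has_real_derivative d) (at s within {0..})"
      if s: "0 \<le> s" "s \<le> T" for s
    proof -
      have vr1: "(vr has_real_derivative dvr s) (at s within {0..})"
        and vr2: "dvr s \<le> - ((r s - ystar)\<^sup>2 + (\<mu> s)\<^sup>2)" using vr[OF s] by auto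
      show ?thesis
        unfolding W_eq
        by (rule lyapunov_decrease[OF state c \<Gamma> Rr Lg' Lg(1) Ka(2)[unfolded real_norm_def] less_imp_le[OF Ka(1)]
            KX_def[unfolded \<kappa>_def] KD_def[unfolded \<kappa>_def] K[unfolded \<kappa>_def] p1_def p2_def p4_def vr1 vr2 s])
    qed
    have "\<forall>s. \<exists>d. 0 \<le> s \<longrightarrow> s \<le> T \<longrightarrow> d \<le> 0 \<and> (Wf z x \<eta> \<theta> r vr has_real_derivative d) (at s within {0..})"
    proof
      fix s
      show "\<exists>d. 0 \<le> s \<longrightarrow> s \<le> T \<longrightarrow> d \<le> 0 \<and> (Wf z x \<eta> \<theta> r vr has_real_derivative d) (at s within {0..})"
      proof (cases "0 \<le> s \<and> s \<le> T")
        case True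
        then obtain d where "d \<le> - (xh s \<bullet> u1)\<^sup>2" "(Wf z x \<eta> \<theta> r vr has_real_derivative d) (at s within {0..})"
          using dW by blast
        moreover have "- (xh s \<bullet> u1)\<^sup>2 \<le> 0" by simp
        ultimately show ?thesis by (meson order_trans)
      qed auto
    qed
    from choice[OF this] obtain d where
      d: "\<forall>s. 0 \<le> s \<longrightarrow> s \<le> T \<longrightarrow> d s \<le> 0 \<and> (Wf z x \<eta> \<theta> r vr has_real_derivative d s) (at s within {0..})" by blast
    have "Wf z x \<eta> \<theta> r vr t \<le> Wf z x \<eta> \<theta> r vr 0"
      by (rule nonincreasing_of_derivative_nonpos[where f = "Wf z x \<eta> \<theta> r vr" and f' = d and T = T]) (use d t in auto)
    moreover have "Wf z x \<eta> \<theta> r vr 0 = Wi"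
      unfolding Wf_def Wi_def \<zeta>i_def \<eta>hi_def Vi_def Qi_def ini by simp
    ultimately have W_le: "Wf z x \<eta> \<theta> r vr t \<le> Wi" by simp
    have nn: "0 \<le> (\<zeta> t)\<^sup>2 / 2" "0 \<le> (\<eta>h t)\<^sup>2 / 2" "0 \<le> p1 * V (zh t)" "0 \<le> p2 * Q (xh t)" "0 \<le> p4 * vr t"
      using p Q_nonneg vr[OF t] V_bounds(1)[OF zh_space[OF t]] class_K_inf_nonneg[OF K_inf(1), of "norm (zh t)"] by auto
    then have W_ge: "b * (\<theta> t)\<^sup>2 / 2 - p4 * \<theta> t \<le> Wf z x \<eta> \<theta> r vr t" unfolding W_eq by linarith
    \<comment> \<open>Half of b \<theta>^2 / 2 absorbs the linear term; the other half bounds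
      \<theta>.\<close>
    have sq: "0 \<le> b / 4 * (\<theta> t)\<^sup>2 - p4 * \<theta> t + p4\<^sup>2 / b"
    proof -
      have "0 \<le> (b * \<theta> t / 2 - p4)\<^sup>2 / b" using b by simp
      also have "\<dots> = b / 4 * (\<theta> t)\<^sup>2 - p4 * \<theta> t + p4\<^sup>2 / b" using b by (simp add: power2_eq_square field_simps)
      finally show ?thesis .
    qed
    have \<Theta>b: "\<bar>\<theta> t\<bar> \<le> \<Theta>"
    proof -
      have "b / 4 * (\<theta> t)\<^sup>2 \<le> \<bar>Wi\<bar> + p4\<^sup>2 / b" using sq W_ge W_le by linarith
      then have "(\<theta> t)\<^sup>2 \<le> 4 * (\<bar>Wi\<bar> + p4\<^sup>2 / b) / b" using b by (simp add: field_simps)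
      moreover have "\<bar>\<theta> t\<bar> \<le> 1 + (\<theta> t)\<^sup>2" using zero_le_power2[of "\<bar>\<theta> t\<bar> - 1"] by (simp add: power2_diff)
      ultimately show ?thesis by (simp add: \<Theta>_def)
    qed
    have W_low: "- (p4\<^sup>2 / b) \<le> Wf z x \<eta> \<theta> r vr t"
    proof -
      have "0 \<le> b / 4 * (\<theta> t)\<^sup>2" using b by simp
      then show ?thesis using sq W_ge by linarith
    qed
    have st: "norm (zh t) \<le> B" "norm (xh t) \<le> B" "\<bar>\<eta>h t\<bar> \<le> B" using state t by (auto simp: state_le_def)
    have nz: "norm (z t) \<le> B + norm z0" using st(1) norm_triangle_ineq[of "zh t" z0] by (simp add: zh_def)
    have nx: "norm (x t) \<le> B + \<bar>ystar\<bar>"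
    proof -
      have "norm (x t) \<le> norm (xh t) + norm (ystar *\<^sub>R u1)"
        using norm_triangle_ineq[of "xh t" "ystar *\<^sub>R u1"] by (simp add: xh_def)
      also have "norm (ystar *\<^sub>R u1) = \<bar>ystar\<bar>" using n by (simp add: norm_unit_vec)
      finally show ?thesis using st(2) by linarith
    qed
    have n\<eta>: "\<bar>\<eta> t\<bar> \<le> B + \<bar>us\<bar> + L / b"
    proof -
      have "\<bar>\<zeta> t / b\<bar> \<le> L / b" using zet t b by (simp add: zeta_le_def divide_right_mono)
      moreover have "\<eta> t = \<eta>h t + us + \<zeta> t / b" by (simp add: \<eta>h_def)
      ultimately show ?thesis using st(3) by linarith
    qed
    have pos: "0 \<le> norm z0" "0 \<le> L / b" "0 \<le> \<Theta>" "0 \<le> p4\<^sup>2 / b" using C(1) L(1) b \<Theta>b by simp_all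
    have "norm (z t) \<le> Bd" "norm (x t) \<le> Bd" "\<bar>\<eta> t\<bar> \<le> Bd" "\<bar>\<theta> t\<bar> \<le> Bd" "- Bd \<le> Wf z x \<eta> \<theta> r vr t"
      using nz nx n\<eta> \<Theta>b W_low pos B0 unfolding Bd_def by linarith+
    moreover have "x t \<bullet> unit_vec 1 - ystar = xh t \<bullet> u1" using inner_xh by simp
    ultimately show "norm (z t) \<le> Bd \<and> norm (x t) \<le> Bd \<and> \<bar>\<eta> t\<bar> \<le> Bd \<and> \<bar>\<theta> t\<bar> \<le> Bd \<and> - Bd \<le> Wf z x \<eta> \<theta> r vr t
      \<and> (\<exists>d \<le> - (x t \<bullet> unit_vec 1 - ystar)\<^sup>2. (Wf z x \<eta> \<theta> r vr has_real_derivative d) (at t within {0..}))"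
      using dW[OF t] by simp
  qed
  then show ?thesis by blast
qed

section \<open>Choice of the gain\<close>

definition agent_bounded :: "nat \<Rightarrow> nat \<Rightarrow> (nat \<Rightarrow> real)
    \<Rightarrow> ('z::euclidean_space \<Rightarrow> 'x::euclidean_space \<Rightarrow> 'w::euclidean_space \<Rightarrow> real)
    \<Rightarrow> (real \<Rightarrow> real) \<Rightarrow> (real \<Rightarrow> real) \<Rightarrow> (real \<Rightarrow> real) \<Rightarrow> (real \<Rightarrow> real)
    \<Rightarrow> ('x \<Rightarrow> real) \<Rightarrow> ('x \<Rightarrow> 'x \<Rightarrow> real) \<Rightarrow> real \<Rightarrow> real \<Rightarrow> (real \<Rightarrow> real) \<Rightarrow> bool" where
  "agent_bounded n m k g \<alpha>lo \<alpha>up \<alpha>d \<gamma>e Q DQ cQ CQ \<rho> \<longleftrightarrow>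
    (\<forall>h w b V \<sigma> z0 ystar us zi xi \<eta>i \<theta>i ri vi R.
      agent_plant n m k g \<alpha>lo \<alpha>up \<alpha>d \<gamma>e Q DQ cQ CQ h w b V \<sigma> z0 ystar us \<longrightarrow>
      (\<exists>Bd Wf. run_bounded n m k g \<alpha>lo \<alpha>up \<alpha>d \<gamma>e Q DQ cQ CQ h w b V \<sigma> z0 ystar us \<rho>
        zi xi \<eta>i \<theta>i ri vi R Bd Wf))"

lemma loc_lip_of_continuous_derivative:
  fixes f f' :: "real \<Rightarrow> real"
  assumes "\<And>x. (f has_real_derivative f' x) (at x)" "continuous_on UNIV f'"
  shows "loc_lip f"
  unfolding loc_lip_def
proof
  fix R :: real
  have "compact (f' ` cball 0 R)"
    by (intro compact_continuous_image continuous_on_subset[OF assms(2)]) auto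
  from compact_imp_bounded[OF this] obtain B where B: "\<forall>x\<in>cball 0 R. \<bar>f' x\<bar> \<le> B"
    by (auto simp: bounded_iff)
  have "norm (f x - f y) \<le> B * norm (x - y)" if "norm x \<le> R" "norm y \<le> R" for x y
    by (rule field_differentiable_bound[of "cball 0 R" f f'])
      (use assms(1) B that in \<open>auto intro: has_field_derivative_at_within\<close>)
  then show "\<exists>L. \<forall>x y. norm x \<le> R \<longrightarrow> norm y \<le> R \<longrightarrow> norm (f x - f y) \<le> L * norm (x - y)" by blast
qed

lemma entire_continuous:
  fixes c :: "nat \<Rightarrow> real"
  assumes "\<And>x. summable (\<lambda>n. c n * x ^ n)"
  shows "continuous_on UNIV (\<lambda>x. \<Sum>n. c n * x ^ n)"
  by (intro continuous_at_imp_continuous_on ballI DERIV_isCont)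
    (rule termdiffs_strong_converges_everywhere[OF assms])

text \<open>The gain is an entire majorant of 1 + H(\<zeta>^2): a power series makes smoothness
  immediate, both for \<rho> and for the adaptation rate \<rho> \<zeta>^2.\<close>

lemma (in agent) agent_gain:
  "\<exists>\<rho>. smooth_on UNIV (\<lambda>(\<zeta>::real, r::real). \<rho> \<zeta>) \<and> smooth_on UNIV (\<lambda>(\<zeta>::real, r::real). \<rho> \<zeta> * \<zeta>\<^sup>2)
    \<and> loc_lip \<rho> \<and> (\<forall>s. 1 \<le> \<rho> s) \<and> agent_bounded n m k g \<alpha>lo \<alpha>up \<alpha>d \<gamma>e Q DQ cQ CQ \<rho>"
proof -
  obtain H where growth: "growth_function H" using ex_growth_function by blast
  then have H: "\<And>s t. s \<le> t \<Longrightarrow> H s \<le> H t" "\<And>s. 0 \<le> H s"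
    unfolding growth_function_def by blast+
  have "1 + H (s\<^sup>2) \<le> 1 + H (t\<^sup>2)" if "0 \<le> s" "s \<le> t" for s t
    using H(1)[OF power_mono[OF that(2,1)]] by simp
  from entire_majorant[where H = "\<lambda>s. 1 + H (s\<^sup>2)", OF this]
  obtain c where c: "\<And>x. summable (\<lambda>n. c n * x ^ n)" "\<And>x. 1 + H (\<bar>x\<bar>\<^sup>2) \<le> (\<Sum>n. c n * x ^ n)" by blast
  define \<rho> where "\<rho> x = (\<Sum>n. c n * x ^ n)" for x
  have \<rho>H: "1 + H (x\<^sup>2) \<le> \<rho> x" for x using c(2)[of x] by (simp add: \<rho>_def)
  have \<rho>1: "1 \<le> \<rho> x" for x using \<rho>H[of x] H(2)[of "x\<^sup>2"] by linarith
  have smooth1: "smooth_on UNIV (\<lambda>(\<zeta>::real, r::real). \<rho> \<zeta>)"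
    unfolding smooth_on_def \<rho>_def case_prod_beta using Ck_on_entire[OF c(1)] by blast
  \<comment> \<open>Multiplication by \<zeta>^2 shifts the coefficients by two places.\<close>
  define c2 where "c2 n = (if n < 2 then 0 else c (n - 2))" for n
  have sums2: "(\<lambda>n. c2 n * x ^ n) sums (\<rho> x * x\<^sup>2)" for x
  proof -
    have "(\<lambda>n. c n * x ^ n * x\<^sup>2) sums (\<rho> x * x\<^sup>2)"
      unfolding \<rho>_def by (intro sums_mult2 summable_sums c)
    moreover have "(\<lambda>n. c2 (n + 2) * x ^ (n + 2)) = (\<lambda>n. c n * x ^ n * x\<^sup>2)"
      unfolding power_add by (simp add: c2_def mult.assoc)
    ultimately have "(\<lambda>n. c2 (n + 2) * x ^ (n + 2)) sums (\<rho> x * x\<^sup>2)" by (simp only:)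
    moreover have "(\<Sum>i<2. c2 i * x ^ i) = 0" by (simp add: c2_def)
    ultimately show ?thesis
      using sums_iff_shift[of "\<lambda>n. c2 n * x ^ n" 2 "\<rho> x * x\<^sup>2"] by simp
  qed
  have smooth2: "smooth_on UNIV (\<lambda>(\<zeta>::real, r::real). \<rho> \<zeta> * \<zeta>\<^sup>2)"
  proof -
    have "\<rho> x * x\<^sup>2 = (\<Sum>n. c2 n * x ^ n)" for x using sums_unique[OF sums2] .
    then show ?thesis
      unfolding smooth_on_def case_prod_beta
      using Ck_on_entire[of c2] sums2 sums_summable by simp blast
  qed
  have lip: "loc_lip \<rho>"
    unfolding \<rho>_def[abs_def]
    by (rule loc_lip_of_continuous_derivative[OF termdiffs_strong_converges_everywhere[OF c(1)]
          entire_continuous[OF termdiff_converges_all[OF c(1)]]])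
  have "agent_bounded n m k g \<alpha>lo \<alpha>up \<alpha>d \<gamma>e Q DQ cQ CQ \<rho>"
    unfolding agent_bounded_def
  proof (intro allI impI)
    fix h w b V \<sigma> z0 ystar us zi xi \<eta>i \<theta>i ri vi R
    assume "agent_plant n m k g \<alpha>lo \<alpha>up \<alpha>d \<gamma>e Q DQ cQ CQ h w b V \<sigma> z0 ystar us"
    from agent_plant.ex_run_bounded[OF this growth \<rho>H]
    show "\<exists>Bd Wf. run_bounded n m k g \<alpha>lo \<alpha>up \<alpha>d \<gamma>e Q DQ cQ CQ h w b V \<sigma> z0 ystar us \<rho>
        zi xi \<eta>i \<theta>i ri vi R Bd Wf" .
  qed
  then show ?thesis using smooth1 smooth2 lip \<rho>1 by blast
qed

section \<open>Invariance of the state subspaces\<close>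

definition Rproj :: "nat \<Rightarrow> 'a::euclidean_space \<Rightarrow> 'a" where
  "Rproj n x = (\<Sum>j\<in>{1..n}. (x \<bullet> unit_vec j) *\<^sub>R unit_vec j)"

lemma Rproj_in: "Rproj n x \<in> Rspace n"
  unfolding Rproj_def
  by (intro subspace_sum[OF subspace_Rspace] subspace_scale[OF subspace_Rspace] unit_vec_in_Rspace) auto

lemma Rproj_id: "n \<le> DIM('a) \<Longrightarrow> (x :: 'a::euclidean_space) \<in> Rspace n \<Longrightarrow> Rproj n x = x"
  using Rspace_expand[of x n] by (simp add: Rproj_def)

lemma bounded_linear_Rproj: "bounded_linear (Rproj n)"
  unfolding linear_conv_bounded_linear[symmetric] Rproj_def
  by (rule linearI) (simp_all add: inner_add_left scaleR_add_left sum.distrib scaleR_sum_right)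

text \<open>The component outside the subspace has zero derivative and starts at 0.\<close>

lemma stays_in_Rspace:
  fixes f :: "real \<Rightarrow> 'a::euclidean_space"
  assumes n: "n \<le> DIM('a)" and init: "f 0 \<in> Rspace n"
    and der: "\<And>t. 0 \<le> t \<Longrightarrow> t \<le> T \<Longrightarrow> (f has_vector_derivative f' t) (at t within {0..})"
    and f': "\<And>t. 0 \<le> t \<Longrightarrow> t \<le> T \<Longrightarrow> f' t \<in> Rspace n"
    and t: "0 \<le> t" "t \<le> T"
  shows "f t \<in> Rspace n"
proof -
  have "((\<lambda>t. f t - Rproj n (f t)) has_vector_derivative 0) (at s within {0..T})" if "s \<in> {0..T}" for s
  proof -
    have d: "(f has_vector_derivative f' s) (at s within {0..T})"
      using has_vector_derivative_within_subset[OF der[of s], of "{0..T}"] that by auto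
    have "Rproj n (f' s) = f' s" using f' that by (intro Rproj_id n) auto
    then show ?thesis
      using has_vector_derivative_diff[OF d bounded_linear.has_vector_derivative[OF bounded_linear_Rproj[of n] d]] by simp
  qed
  from has_vector_derivative_zero_constant[OF _ this] obtain c where
    c: "\<And>s. s \<in> {0..T} \<Longrightarrow> f s - Rproj n (f s) = c" by auto
  have "c = 0" using c[of 0] t Rproj_id[OF n init] by simp
  then have "f t = Rproj n (f t)" using c[of t] t by simp
  then show ?thesis using Rproj_in by metis
qed

section \<open>The network\<close>

lemma norm_vec_le_sum:
  fixes y :: "'b::real_normed_vector ^ 'n::finite"
  shows "norm y \<le> (\<Sum>i\<in>UNIV. norm (y $ i))"
  unfolding norm_vec_def by (rule L2_set_le_sum) simp

locale network = balanced_graph a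
  for a :: "'n::finite \<Rightarrow> 'n \<Rightarrow> real" +
  fixes m n :: "'n \<Rightarrow> nat" and k :: "'n \<Rightarrow> nat \<Rightarrow> real"
    and g :: "'n \<Rightarrow> 'z::euclidean_space \<Rightarrow> 'x::euclidean_space \<Rightarrow> 'w::euclidean_space \<Rightarrow> real"
    and \<alpha>lo \<alpha>up \<alpha>d \<gamma>e :: "'n \<Rightarrow> real \<Rightarrow> real"
    and Q :: "'n \<Rightarrow> 'x \<Rightarrow> real" and DQ :: "'n \<Rightarrow> 'x \<Rightarrow> 'x \<Rightarrow> real" and cQ CQ :: "'n \<Rightarrow> real"
    and h :: "'n \<Rightarrow> 'z \<Rightarrow> real \<Rightarrow> 'w \<Rightarrow> 'z" and w :: 'w and b :: "'n \<Rightarrow> real" and V :: "'n \<Rightarrow> 'z \<Rightarrow> real"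
    and \<sigma> :: "'n \<Rightarrow> real" and z0 :: "'n \<Rightarrow> 'z" and ystar :: real and us :: "'n \<Rightarrow> real"
    and \<rho> :: "'n \<Rightarrow> real \<Rightarrow> real" and f' :: "'n \<Rightarrow> real \<Rightarrow> real" and \<beta> :: real
    and Vr Dr :: "real^'n \<Rightarrow> real^'n \<Rightarrow> real" and Cr Br :: real
  assumes m: "m i \<le> DIM('z)"
    and plant: "agent_plant (n i) (m i) (k i) (g i) (\<alpha>lo i) (\<alpha>up i) (\<alpha>d i) (\<gamma>e i) (Q i) (DQ i) (cQ i) (CQ i)
      (h i) w (b i) (V i) (\<sigma> i) (z0 i) ystar (us i)"
    and bounded: "agent_bounded (n i) (m i) (k i) (g i) (\<alpha>lo i) (\<alpha>up i) (\<alpha>d i) (\<gamma>e i) (Q i) (DQ i) (cQ i) (CQ i) (\<rho> i)"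
    and \<rho>: "1 \<le> \<rho> i s" "loc_lip (\<rho> i)"
    and h_space: "za \<in> Rspace (m i) \<Longrightarrow> h i za y w \<in> Rspace (m i)"
    and h_lip: "loc_lip (\<lambda>(z, y). h i z y w)"
    and f'_lip: "loc_lip (f' i)"
    and Vr_nonneg: "0 \<le> Vr ra va"
    and Vr_ge: "(norm (ra - (\<chi> i. ystar)))\<^sup>2 + (norm (ref_field f' \<beta> ra va))\<^sup>2 \<le> Cr * Vr ra va"
    and Dr_le: "Dr ra va \<le> - ((norm (ra - (\<chi> i. ystar)))\<^sup>2 + (norm (ref_field f' \<beta> ra va))\<^sup>2)"
    and Vr_deriv: "(rf has_vector_derivative ref_field f' \<beta> (rf t) (vf t)) (at t within S) \<Longrightarrow>
      (vf has_vector_derivative \<beta> *\<^sub>R laplacian a (rf t)) (at t within S) \<Longrightarrow>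
      ((\<lambda>t. Vr (rf t) (vf t)) has_real_derivative Dr (rf t) (vf t)) (at t within S)"
    and v_bound: "norm va \<le> Br * (1 + Vr ra va + \<bar>\<Sum>i\<in>UNIV. va $ i\<bar>)"
begin

text \<open>The closed loop for \<alpha> = 1 and \<kappa> = 1, where -\<eta> + u reduces to
  -\<theta> \<rho> \<zeta>. The finite horizon is there because the a priori bounds precede global
  existence.\<close>

definition solution :: "real \<Rightarrow> ('n \<Rightarrow> real \<Rightarrow> 'z) \<Rightarrow> ('n \<Rightarrow> real \<Rightarrow> 'x) \<Rightarrow> ('n \<Rightarrow> real \<Rightarrow> real)
    \<Rightarrow> ('n \<Rightarrow> real \<Rightarrow> real) \<Rightarrow> ('n \<Rightarrow> real \<Rightarrow> real) \<Rightarrow> ('n \<Rightarrow> real \<Rightarrow> real) \<Rightarrow> bool" where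
  "solution T z x \<eta> \<theta> r v \<longleftrightarrow> (\<forall>i t. 0 \<le> t \<longrightarrow> t \<le> T \<longrightarrow>
    z i t \<in> Rspace (m i) \<and> x i t \<in> Rspace (n i) \<and>
    (z i has_vector_derivative h i (z i t) (x i t \<bullet> unit_vec 1) w) (at t within {0..}) \<and>
    (x i has_vector_derivative chain_A (n i) (x i t) + (g i (z i t) (x i t) w
        + b i * (- \<theta> i t * \<rho> i (zeta (n i) (k i) (x i t) (r i t)) * zeta (n i) (k i) (x i t) (r i t) + \<eta> i t))
          *\<^sub>R unit_vec (n i)) (at t within {0..}) \<and>
    (\<eta> i has_real_derivative - \<theta> i t * \<rho> i (zeta (n i) (k i) (x i t) (r i t)) * zeta (n i) (k i) (x i t) (r i t))
      (at t within {0..}) \<and>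
    (\<theta> i has_real_derivative \<rho> i (zeta (n i) (k i) (x i t) (r i t)) * (zeta (n i) (k i) (x i t) (r i t))\<^sup>2)
      (at t within {0..}) \<and>
    (r i has_real_derivative ref_field f' \<beta> (\<chi> j. r j t) (\<chi> j. v j t) $ i) (at t within {0..}) \<and>
    (v i has_real_derivative (\<beta> *\<^sub>R laplacian a (\<chi> j. r j t)) $ i) (at t within {0..}))"

definition starts :: "('n \<Rightarrow> 'z) \<Rightarrow> ('n \<Rightarrow> 'x) \<Rightarrow> ('n \<Rightarrow> real) \<Rightarrow> ('n \<Rightarrow> real) \<Rightarrow> ('n \<Rightarrow> real) \<Rightarrow> ('n \<Rightarrow> real)
    \<Rightarrow> ('n \<Rightarrow> real \<Rightarrow> 'z) \<Rightarrow> ('n \<Rightarrow> real \<Rightarrow> 'x) \<Rightarrow> ('n \<Rightarrow> real \<Rightarrow> real)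
    \<Rightarrow> ('n \<Rightarrow> real \<Rightarrow> real) \<Rightarrow> ('n \<Rightarrow> real \<Rightarrow> real) \<Rightarrow> ('n \<Rightarrow> real \<Rightarrow> real) \<Rightarrow> bool" where
  "starts zi xi \<eta>i \<theta>i ri vi z x \<eta> \<theta> r v \<longleftrightarrow> (\<forall>i. z i 0 = zi i \<and> x i 0 = xi i \<and> \<eta> i 0 = \<eta>i i \<and> \<theta> i 0 = \<theta>i i
    \<and> r i 0 = ri i \<and> v i 0 = vi i)"

lemma ref_deriv:
  assumes "solution T z x \<eta> \<theta> r v" "0 \<le> t" "t \<le> T"
  shows "((\<lambda>t. \<chi> j. r j t) has_vector_derivative ref_field f' \<beta> (\<chi> j. r j t) (\<chi> j. v j t)) (at t within {0..})"
    and "((\<lambda>t. \<chi> j. v j t) has_vector_derivative \<beta> *\<^sub>R laplacian a (\<chi> j. r j t)) (at t within {0..})"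
proof -
  have d: "(r i has_vector_derivative ref_field f' \<beta> (\<chi> j. r j t) (\<chi> j. v j t) $ i) (at t within {0..})"
    "(v i has_vector_derivative (\<beta> *\<^sub>R laplacian a (\<chi> j. r j t)) $ i) (at t within {0..})" for i
    using assms unfolding solution_def has_real_derivative_iff_has_vector_derivative by blast+
  from has_vector_derivative_vec[of r, OF d(1)] has_vector_derivative_vec[of v, OF d(2)]
  show "((\<lambda>t. \<chi> j. r j t) has_vector_derivative ref_field f' \<beta> (\<chi> j. r j t) (\<chi> j. v j t)) (at t within {0..})"
    "((\<lambda>t. \<chi> j. v j t) has_vector_derivative \<beta> *\<^sub>R laplacian a (\<chi> j. r j t)) (at t within {0..})"
    by (simp_all only: vec_nth_inverse)
qed

lemma Vr_along:
  assumes "solution T z x \<eta> \<theta> r v" "0 \<le> t" "t \<le> T"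
  shows "((\<lambda>t. Vr (\<chi> j. r j t) (\<chi> j. v j t)) has_real_derivative Dr (\<chi> j. r j t) (\<chi> j. v j t)) (at t within {0..})"
  by (rule Vr_deriv[OF ref_deriv[OF assms]])

lemma Dr_nonpos: "Dr ra va \<le> 0"
  using Dr_le[of ra va] zero_le_power2[of "norm (ra - (\<chi> i. ystar))"] zero_le_power2[of "norm (ref_field f' \<beta> ra va)"]
  by linarith

lemma sq_component: "(y $ i)\<^sup>2 \<le> (norm y)\<^sup>2" for y :: "real^'n"
  using component_le_norm_cart[of y i] power_mono[of "\<bar>y $ i\<bar>" "norm y" 2] by simp

text \<open>The reference subsystem is autonomous, so \<open>Vr\<close> decreases whatever the
  plants do. It leaves the mean of v undetermined, but weight balance conserves the sum of
  v.\<close>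

lemma ref_bounds:
  assumes sol: "solution T z x \<eta> \<theta> r v" and st: "starts zi xi \<eta>i \<theta>i ri vi z x \<eta> \<theta> r v" and t: "0 \<le> t" "t \<le> T"
  shows "\<bar>r i t - ystar\<bar> \<le> 1 + \<bar>Cr\<bar> * Vr (\<chi> j. ri j) (\<chi> j. vi j)"
    and "\<bar>ref_field f' \<beta> (\<chi> j. r j t) (\<chi> j. v j t) $ i\<bar> \<le> 1 + \<bar>Cr\<bar> * Vr (\<chi> j. ri j) (\<chi> j. vi j)"
    and "\<bar>v i t\<bar> \<le> \<bar>Br\<bar> * (1 + Vr (\<chi> j. ri j) (\<chi> j. vi j) + \<bar>\<Sum>j\<in>UNIV. vi j\<bar>)"
proof -
  let ?r = "\<chi> j. r j t" and ?v = "\<chi> j. v j t"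
  have Vle: "Vr ?r ?v \<le> Vr (\<chi> j. ri j) (\<chi> j. vi j)"
    using nonincreasing_of_derivative_nonpos[OF Vr_along[OF sol] _ t(1) t(2) Dr_nonpos] st by (simp add: starts_def)
  have "Cr * Vr ?r ?v \<le> \<bar>Cr\<bar> * Vr (\<chi> j. ri j) (\<chi> j. vi j)"
    using Vle Vr_nonneg[of ?r ?v] by (intro mult_mono) auto
  then have le: "(norm (?r - (\<chi> i. ystar)))\<^sup>2 + (norm (ref_field f' \<beta> ?r ?v))\<^sup>2 \<le> \<bar>Cr\<bar> * Vr (\<chi> j. ri j) (\<chi> j. vi j)"
    using Vr_ge[of ?r ?v] by linarith
  have sq: "\<bar>y\<bar> \<le> 1 + D" if "y\<^sup>2 \<le> D" for y D :: real
    using that zero_le_power2[of "\<bar>y\<bar> - 1"] by (simp add: power2_diff)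
  have "(r i t - ystar)\<^sup>2 \<le> (norm (?r - (\<chi> i. ystar)))\<^sup>2" using sq_component[of "?r - (\<chi> i. ystar)" i] by simp
  then have "(r i t - ystar)\<^sup>2 \<le> \<bar>Cr\<bar> * Vr (\<chi> j. ri j) (\<chi> j. vi j)"
    using le zero_le_power2[of "norm (ref_field f' \<beta> ?r ?v)"] by linarith
  then show "\<bar>r i t - ystar\<bar> \<le> 1 + \<bar>Cr\<bar> * Vr (\<chi> j. ri j) (\<chi> j. vi j)" by (rule sq)
  have "(ref_field f' \<beta> ?r ?v $ i)\<^sup>2 \<le> \<bar>Cr\<bar> * Vr (\<chi> j. ri j) (\<chi> j. vi j)"
    using le sq_component[of "ref_field f' \<beta> ?r ?v" i] zero_le_power2[of "norm (?r - (\<chi> i. ystar))"] by linarith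
  then show "\<bar>ref_field f' \<beta> ?r ?v $ i\<bar> \<le> 1 + \<bar>Cr\<bar> * Vr (\<chi> j. ri j) (\<chi> j. vi j)" by (rule sq)
  have ds: "((\<lambda>t. \<Sum>j\<in>UNIV. v j t) has_real_derivative 0) (at s within {0..})" if s: "0 \<le> s" "s \<le> T" for s
  proof -
    have "((\<lambda>t. \<Sum>j\<in>UNIV. v j t) has_real_derivative (\<Sum>j\<in>UNIV. (\<beta> *\<^sub>R laplacian a (\<chi> j. r j s)) $ j)) (at s within {0..})"
      using sol s unfolding solution_def by (intro DERIV_sum) blast
    moreover have "(\<Sum>j\<in>UNIV. (\<beta> *\<^sub>R laplacian a (\<chi> j. r j s)) $ j) = 0"
      using sum_laplacian[of "\<chi> j. r j s"] by (simp add: sum_distrib_left[symmetric])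
    ultimately show ?thesis by simp
  qed
  have ds': "((\<lambda>t. - (\<Sum>j\<in>UNIV. v j t)) has_real_derivative 0) (at s within {0..})" if s: "0 \<le> s" "s \<le> T" for s
    using DERIV_minus[OF ds[OF s]] by simp
  have "(\<Sum>j\<in>UNIV. v j t) \<le> (\<Sum>j\<in>UNIV. v j 0)"
    by (rule nonincreasing_of_derivative_nonpos[where f = "\<lambda>t. \<Sum>j\<in>UNIV. v j t" and f' = "\<lambda>_. 0", OF ds]) (use t in auto)
  moreover have "- (\<Sum>j\<in>UNIV. v j t) \<le> - (\<Sum>j\<in>UNIV. v j 0)"
    by (rule nonincreasing_of_derivative_nonpos[where f = "\<lambda>t. - (\<Sum>j\<in>UNIV. v j t)" and f' = "\<lambda>_. 0", OF ds']) (use t in auto)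
  ultimately have sv: "(\<Sum>j\<in>UNIV. ?v $ j) = (\<Sum>j\<in>UNIV. vi j)" using st by (simp add: starts_def)
  have "\<bar>v i t\<bar> \<le> norm ?v" using component_le_norm_cart[of ?v i] by simp
  also have "\<dots> \<le> Br * (1 + Vr ?r ?v + \<bar>\<Sum>j\<in>UNIV. vi j\<bar>)" using v_bound[of ?v ?r] unfolding sv .
  also have "\<dots> \<le> \<bar>Br\<bar> * (1 + Vr (\<chi> j. ri j) (\<chi> j. vi j) + \<bar>\<Sum>j\<in>UNIV. vi j\<bar>)"
    using Vle Vr_nonneg[of ?r ?v] by (intro mult_mono) auto
  finally show "\<bar>v i t\<bar> \<le> \<bar>Br\<bar> * (1 + Vr (\<chi> j. ri j) (\<chi> j. vi j) + \<bar>\<Sum>j\<in>UNIV. vi j\<bar>)" .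
qed

lemma solution_agent_run:
  assumes "solution T z x \<eta> \<theta> r v"
  shows "agent_run (n i) (m i) (k i) (g i) (\<alpha>lo i) (\<alpha>up i) (\<alpha>d i) (\<gamma>e i) (Q i) (DQ i) (cQ i) (CQ i)
      (h i) w (b i) (V i) (\<sigma> i) (z0 i) ystar (us i) (\<rho> i) T (z i) (x i) (\<eta> i) (\<theta> i) (r i)
      (\<lambda>t. ref_field f' \<beta> (\<chi> j. r j t) (\<chi> j. v j t) $ i)"
  by (intro agent_run.intro agent_run_axioms.intro plant \<rho>(1))
    (use assms[unfolded solution_def, rule_format, where i = i] in blast)+

definition "state_bounded zi xi \<eta>i \<theta>i ri vi Bd Wf \<longleftrightarrow> (\<forall>T z x \<eta> \<theta> r v t i. solution T z x \<eta> \<theta> r v \<longrightarrow> starts zi xi \<eta>i \<theta>i ri vi z x \<eta> \<theta> r v \<longrightarrow>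
    0 \<le> t \<longrightarrow> t \<le> T \<longrightarrow>
    norm (z i t) \<le> Bd \<and> norm (x i t) \<le> Bd \<and> \<bar>\<eta> i t\<bar> \<le> Bd \<and> \<bar>\<theta> i t\<bar> \<le> Bd \<and> \<bar>r i t\<bar> \<le> Bd \<and> \<bar>v i t\<bar> \<le> Bd
    \<and> - Bd \<le> Wf i z x \<eta> \<theta> r v t
    \<and> (\<exists>d \<le> - (x i t \<bullet> unit_vec 1 - ystar)\<^sup>2. (Wf i z x \<eta> \<theta> r v has_real_derivative d) (at t within {0..})))"

text \<open>Each agent is treated as a separate run, with \<open>Vr\<close> along the trajectory as
  its \<open>vr\<close>. The bound depends on the initial data but not on T.\<close>

lemma ex_state_bounded: "\<exists>Bd Wf. state_bounded zi xi \<eta>i \<theta>i ri vi Bd Wf"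
proof -
  define R where "R = 1 + \<bar>Cr\<bar> * Vr (\<chi> j. ri j) (\<chi> j. vi j)"
  define Rv where "Rv = \<bar>Br\<bar> * (1 + Vr (\<chi> j. ri j) (\<chi> j. vi j) + \<bar>\<Sum>j\<in>UNIV. vi j\<bar>)"
  have R0: "0 \<le> R" "0 \<le> Rv" using Vr_nonneg by (auto simp: R_def Rv_def)
  define P where "P i = run_bounded (n i) (m i) (k i) (g i) (\<alpha>lo i) (\<alpha>up i) (\<alpha>d i) (\<gamma>e i) (Q i) (DQ i) (cQ i) (CQ i)
      (h i) w (b i) (V i) (\<sigma> i) (z0 i) ystar (us i) (\<rho> i) (zi i) (xi i) (\<eta>i i) (\<theta>i i) (ri i)
      (Vr (\<chi> j. ri j) (\<chi> j. vi j)) R" for i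
  have "\<forall>i. \<exists>Bd Wf. P i Bd Wf"
    using bounded plant unfolding agent_bounded_def P_def by blast
  then obtain Bd Wf where P: "\<And>i. P i (Bd i) (Wf i)" by metis
  define B where "B = (\<Sum>i\<in>UNIV. \<bar>Bd i\<bar>) + (R + \<bar>ystar\<bar>) + Rv"
  have Bd_le: "Bd i \<le> B" for i
    using member_le_sum[of i UNIV "\<lambda>i. \<bar>Bd i\<bar>"] R0 by (simp add: B_def)
  have R_le: "R + \<bar>ystar\<bar> \<le> B" "Rv \<le> B"
    using R0 sum_nonneg[of UNIV "\<lambda>i. \<bar>Bd i\<bar>"] by (simp_all add: B_def)
  have "state_bounded zi xi \<eta>i \<theta>i ri vi B
      (\<lambda>i z x \<eta> \<theta> r v. Wf i (z i) (x i) (\<eta> i) (\<theta> i) (r i) (\<lambda>t. Vr (\<chi> j. r j t) (\<chi> j. v j t)))"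
    unfolding state_bounded_def
  proof (intro allI impI)
    fix T z x \<eta> \<theta> r v t i
    assume sol: "solution T z x \<eta> \<theta> r v" and st: "starts zi xi \<eta>i \<theta>i ri vi z x \<eta> \<theta> r v" and t: "0 \<le> t" "t \<le> T"
    let ?vr = "\<lambda>t. Vr (\<chi> j. r j t) (\<chi> j. v j t)"
    have rb: "\<bar>r i s - ystar\<bar> \<le> R \<and> \<bar>ref_field f' \<beta> (\<chi> j. r j s) (\<chi> j. v j s) $ i\<bar> \<le> R" if "0 \<le> s" "s \<le> T" for s
      using ref_bounds(1,2)[OF sol st that] unfolding R_def by blast
    have vrb: "0 \<le> ?vr s \<and> (?vr has_real_derivative Dr (\<chi> j. r j s) (\<chi> j. v j s)) (at s within {0..})
          \<and> Dr (\<chi> j. r j s) (\<chi> j. v j s) \<le> - ((r i s - ystar)\<^sup>2 + (ref_field f' \<beta> (\<chi> j. r j s) (\<chi> j. v j s) $ i)\<^sup>2)"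
      if s: "0 \<le> s" "s \<le> T" for s
    proof (intro conjI Vr_nonneg Vr_along[OF sol s])
      have "(r i s - ystar)\<^sup>2 \<le> (norm ((\<chi> j. r j s) - (\<chi> i. ystar)))\<^sup>2"
        using sq_component[of "(\<chi> j. r j s) - (\<chi> i. ystar)" i] by simp
      then show "Dr (\<chi> j. r j s) (\<chi> j. v j s) \<le> - ((r i s - ystar)\<^sup>2 + (ref_field f' \<beta> (\<chi> j. r j s) (\<chi> j. v j s) $ i)\<^sup>2)"
        using Dr_le[of "\<chi> j. r j s" "\<chi> j. v j s"] sq_component[of "ref_field f' \<beta> (\<chi> j. r j s) (\<chi> j. v j s)" i] by linarith
    qed
    have "norm (z i t) \<le> Bd i \<and> norm (x i t) \<le> Bd i \<and> \<bar>\<eta> i t\<bar> \<le> Bd i \<and> \<bar>\<theta> i t\<bar> \<le> Bd i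
        \<and> - Bd i \<le> Wf i (z i) (x i) (\<eta> i) (\<theta> i) (r i) ?vr t
        \<and> (\<exists>d \<le> - (x i t \<bullet> unit_vec 1 - ystar)\<^sup>2. (Wf i (z i) (x i) (\<eta> i) (\<theta> i) (r i) ?vr has_real_derivative d) (at t within {0..}))"
      by (rule P[unfolded P_def run_bounded_def, rule_format, OF solution_agent_run[OF sol, of i], of ?vr "\<lambda>s. Dr (\<chi> j. r j s) (\<chi> j. v j s)" t])
        (use st rb vrb t in \<open>simp_all add: starts_def\<close>)
    moreover have "\<bar>r i t\<bar> \<le> R + \<bar>ystar\<bar>" using rb[OF t] by linarith
    moreover have "\<bar>v i t\<bar> \<le> Rv" using ref_bounds(3)[OF sol st t] unfolding Rv_def .
    ultimately show "norm (z i t) \<le> B \<and> norm (x i t) \<le> B \<and> \<bar>\<eta> i t\<bar> \<le> B \<and> \<bar>\<theta> i t\<bar> \<le> B \<and> \<bar>r i t\<bar> \<le> B \<and> \<bar>v i t\<bar> \<le> B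
      \<and> - B \<le> Wf i (z i) (x i) (\<eta> i) (\<theta> i) (r i) ?vr t
      \<and> (\<exists>d \<le> - (x i t \<bullet> unit_vec 1 - ystar)\<^sup>2. (Wf i (z i) (x i) (\<eta> i) (\<theta> i) (r i) ?vr has_real_derivative d) (at t within {0..}))"
      using Bd_le[of i] R_le by (meson neg_le_iff_le order_trans)
  qed
  then show ?thesis by blast
qed

text \<open>\<open>h\<close> is known to preserve the state space only at points of it. Projecting
  its argument makes the z-component tangent to the state space at every ambient point, so solutions
  cannot leave it.\<close>

definition field :: "('z^'n) \<times> ('x^'n) \<times> (real^'n) \<times> (real^'n) \<times> (real^'n) \<times> (real^'n)
    \<Rightarrow> ('z^'n) \<times> ('x^'n) \<times> (real^'n) \<times> (real^'n) \<times> (real^'n) \<times> (real^'n)" where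
  "field = (\<lambda>(z, x, \<eta>, \<theta>, r, v).
    (\<chi> i. h i (Rproj (m i) (z $ i)) (x $ i \<bullet> unit_vec 1) w,
     \<chi> i. chain_A (n i) (x $ i) + (g i (z $ i) (x $ i) w
        + b i * (- \<theta> $ i * \<rho> i (zeta (n i) (k i) (x $ i) (r $ i)) * zeta (n i) (k i) (x $ i) (r $ i) + \<eta> $ i))
          *\<^sub>R unit_vec (n i),
     \<chi> i. - \<theta> $ i * \<rho> i (zeta (n i) (k i) (x $ i) (r $ i)) * zeta (n i) (k i) (x $ i) (r $ i),
     \<chi> i. \<rho> i (zeta (n i) (k i) (x $ i) (r $ i)) * (zeta (n i) (k i) (x $ i) (r $ i))\<^sup>2,
     ref_field f' \<beta> r v,
     \<beta> *\<^sub>R laplacian a r))"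

lemma field_loc_lip: "loc_lip field"
proof -
  let ?z = "\<lambda>s :: ('z^'n) \<times> ('x^'n) \<times> (real^'n) \<times> (real^'n) \<times> (real^'n) \<times> (real^'n). fst s"
  let ?x = "\<lambda>s :: ('z^'n) \<times> ('x^'n) \<times> (real^'n) \<times> (real^'n) \<times> (real^'n) \<times> (real^'n). fst (snd s)"
  let ?\<eta> = "\<lambda>s :: ('z^'n) \<times> ('x^'n) \<times> (real^'n) \<times> (real^'n) \<times> (real^'n) \<times> (real^'n). fst (snd (snd s))"
  let ?\<theta> = "\<lambda>s :: ('z^'n) \<times> ('x^'n) \<times> (real^'n) \<times> (real^'n) \<times> (real^'n) \<times> (real^'n). fst (snd (snd (snd s)))"
  let ?r = "\<lambda>s :: ('z^'n) \<times> ('x^'n) \<times> (real^'n) \<times> (real^'n) \<times> (real^'n) \<times> (real^'n). fst (snd (snd (snd (snd s))))"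
  let ?v = "\<lambda>s :: ('z^'n) \<times> ('x^'n) \<times> (real^'n) \<times> (real^'n) \<times> (real^'n) \<times> (real^'n). snd (snd (snd (snd (snd s))))"
  note bl = bounded_linear_fst bounded_linear_snd bounded_linear_compose[OF bounded_linear_fst]
    bounded_linear_compose[OF bounded_linear_snd] bounded_linear_compose[OF bounded_linear_vec_nth]
  have lz: "loc_lip (\<lambda>s. ?z s $ i)" and lx: "loc_lip (\<lambda>s. ?x s $ i)" and l\<eta>: "loc_lip (\<lambda>s. ?\<eta> s $ i)"
    and l\<theta>: "loc_lip (\<lambda>s. ?\<theta> s $ i)" and lr: "loc_lip (\<lambda>s. ?r s $ i)" for i
    by (rule loc_lip_linear, intro bl)+
  have lr0: "loc_lip ?r" and lv0: "loc_lip ?v"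
    by (rule loc_lip_linear, intro bl)+
  have llap: "loc_lip (laplacian a)"
    using linear_laplacian[of a] by (intro loc_lip_linear) (simp add: linear_conv_bounded_linear)
  have lzeta: "loc_lip (\<lambda>s. zeta (n i) (k i) (?x s $ i) (?r s $ i))" for i
  proof -
    have "bounded_linear (zlin (n i) (k i) :: 'x \<Rightarrow> real)" using linear_zlin by (simp add: linear_conv_bounded_linear)
    then show ?thesis
      unfolding zeta_eq
      by (intro loc_lip_diff loc_lip_compose[OF loc_lip_linear lx] loc_lip_bilinear[OF bounded_bilinear_mult] lr loc_lip_const)
  qed
  have l\<rho>: "loc_lip (\<lambda>s. \<rho> i (zeta (n i) (k i) (?x s $ i) (?r s $ i)))" for i
    by (rule loc_lip_compose[OF \<rho>(2) lzeta])
  note mult = loc_lip_bilinear[OF bounded_bilinear_mult]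
  have lu: "loc_lip (\<lambda>s. - ?\<theta> s $ i * \<rho> i (zeta (n i) (k i) (?x s $ i) (?r s $ i)) * zeta (n i) (k i) (?x s $ i) (?r s $ i))" for i
    by (intro mult loc_lip_minus l\<theta> l\<rho> lzeta)
  have l1: "loc_lip (\<lambda>s. h i (Rproj (m i) (?z s $ i)) (?x s $ i \<bullet> unit_vec 1) w)" for i
    using loc_lip_compose[OF h_lip[of i] loc_lip_Pair[OF loc_lip_compose[OF loc_lip_linear[OF bounded_linear_Rproj[of "m i"]] lz[of i]]
          loc_lip_bilinear[OF bounded_bilinear_inner lx[of i] loc_lip_const[of "unit_vec 1"]]]] by simp
  have glip: "loc_lip (\<lambda>(z, x, w). g i z x w)" for i
  proof -
    interpret agent_plant "n i" "m i" "k i" "g i" "\<alpha>lo i" "\<alpha>up i" "\<alpha>d i" "\<gamma>e i" "Q i" "DQ i" "cQ i" "CQ i"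
      "h i" w "b i" "V i" "\<sigma> i" "z0 i" ystar "us i" by (rule plant)
    show ?thesis by (rule g_lip)
  qed
  have lg: "loc_lip (\<lambda>s. g i (?z s $ i) (?x s $ i) w)" for i
    using loc_lip_compose[OF glip loc_lip_Pair[OF lz[of i] loc_lip_Pair[OF lx[of i] loc_lip_const[of w]]]] by simp
  have lA: "loc_lip (\<lambda>s. chain_A (n i) (?x s $ i))" for i
    using linear_chain_A[of "n i", where 'a = 'x]
    by (intro loc_lip_compose[OF loc_lip_linear lx]) (simp add: linear_conv_bounded_linear)
  have l2: "loc_lip (\<lambda>s. chain_A (n i) (?x s $ i) + (g i (?z s $ i) (?x s $ i) w
        + b i * (- ?\<theta> s $ i * \<rho> i (zeta (n i) (k i) (?x s $ i) (?r s $ i)) * zeta (n i) (k i) (?x s $ i) (?r s $ i) + ?\<eta> s $ i))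
          *\<^sub>R (unit_vec (n i) :: 'x))" for i
    by (intro loc_lip_add loc_lip_bilinear[OF bounded_bilinear_scaleR] mult lA lg lu l\<eta> loc_lip_const)
  have l4: "loc_lip (\<lambda>s. \<rho> i (zeta (n i) (k i) (?x s $ i) (?r s $ i)) * (zeta (n i) (k i) (?x s $ i) (?r s $ i))\<^sup>2)" for i
    unfolding power2_eq_square by (intro mult l\<rho> lzeta)
  have l5: "loc_lip (\<lambda>s. ref_field f' \<beta> (?r s) (?v s))"
    unfolding ref_field_def
    by (intro loc_lip_diff loc_lip_minus loc_lip_vec loc_lip_compose[OF f'_lip lr]
        loc_lip_bilinear[OF bounded_bilinear_scaleR] loc_lip_const loc_lip_compose[OF llap] lr0 lv0)
  have l6: "loc_lip (\<lambda>s. \<beta> *\<^sub>R laplacian a (?r s))"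
    by (intro loc_lip_bilinear[OF bounded_bilinear_scaleR] loc_lip_const loc_lip_compose[OF llap lr0])
  show ?thesis
    unfolding field_def case_prod_beta
    by (intro loc_lip_Pair loc_lip_vec l1 l2 lu l4 l5 l6)
qed

text \<open>Invariance of the subspaces comes first; on them the projection in \<open>field\<close>
  is the identity.\<close>

lemma field_solution:
  assumes init: "s 0 = (\<chi> i. zi i, \<chi> i. xi i, \<chi> i. \<eta>i i, \<chi> i. \<theta>i i, \<chi> i. ri i, \<chi> i. vi i)"
    and space: "\<And>i. zi i \<in> Rspace (m i)" "\<And>i. xi i \<in> Rspace (n i)"
    and der: "\<And>t. 0 \<le> t \<Longrightarrow> t \<le> T \<Longrightarrow> (s has_vector_derivative field (s t)) (at t within {0..})"
  shows "solution T (\<lambda>i t. fst (s t) $ i) (\<lambda>i t. fst (snd (s t)) $ i) (\<lambda>i t. fst (snd (snd (s t))) $ i)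
      (\<lambda>i t. fst (snd (snd (snd (s t)))) $ i) (\<lambda>i t. fst (snd (snd (snd (snd (s t))))) $ i)
      (\<lambda>i t. snd (snd (snd (snd (snd (s t))))) $ i)" (is "solution T ?z ?x ?\<eta> ?\<theta> ?r ?v")
    and "starts zi xi \<eta>i \<theta>i ri vi (\<lambda>i t. fst (s t) $ i) (\<lambda>i t. fst (snd (s t)) $ i) (\<lambda>i t. fst (snd (snd (s t))) $ i)
      (\<lambda>i t. fst (snd (snd (snd (s t)))) $ i) (\<lambda>i t. fst (snd (snd (snd (snd (s t))))) $ i)
      (\<lambda>i t. snd (snd (snd (snd (snd (s t))))) $ i)"
proof -
  show "starts zi xi \<eta>i \<theta>i ri vi ?z ?x ?\<eta> ?\<theta> ?r ?v" using init by (simp add: starts_def)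
  note bl = bounded_linear_fst bounded_linear_snd bounded_linear_compose[OF bounded_linear_fst]
    bounded_linear_compose[OF bounded_linear_snd] bounded_linear_compose[OF bounded_linear_vec_nth]
  have n: "n i \<le> DIM('x)" "1 \<le> n i" for i
  proof -
    interpret agent_plant "n i" "m i" "k i" "g i" "\<alpha>lo i" "\<alpha>up i" "\<alpha>d i" "\<gamma>e i" "Q i" "DQ i" "cQ i" "CQ i"
      "h i" w "b i" "V i" "\<sigma> i" "z0 i" ystar "us i" by (rule plant)
    show "n i \<le> DIM('x)" "1 \<le> n i" using n by auto
  qed
  have comp: "((\<lambda>t. P (s t)) has_vector_derivative P (field (s t))) (at t within {0..})"
    if "bounded_linear P" "0 \<le> t" "t \<le> T" for P :: "_ \<Rightarrow> 'b::real_normed_vector" and t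
    by (rule bounded_linear.has_vector_derivative[OF that(1) der[OF that(2,3)]])
  have d1: "(?z i has_vector_derivative h i (Rproj (m i) (?z i t)) (?x i t \<bullet> unit_vec 1) w) (at t within {0..})"
    if t: "0 \<le> t" "t \<le> T" for i t
    using comp[of "\<lambda>s. fst s $ i", OF _ t] by (simp add: bl field_def case_prod_beta)
  have d2: "(?x i has_vector_derivative chain_A (n i) (?x i t) + (g i (?z i t) (?x i t) w
        + b i * (- ?\<theta> i t * \<rho> i (zeta (n i) (k i) (?x i t) (?r i t)) * zeta (n i) (k i) (?x i t) (?r i t) + ?\<eta> i t))
          *\<^sub>R unit_vec (n i)) (at t within {0..})"
    if t: "0 \<le> t" "t \<le> T" for i t
    using comp[of "\<lambda>s. fst (snd s) $ i", OF _ t] by (simp add: bl field_def case_prod_beta)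
  have d3: "(?\<eta> i has_vector_derivative - ?\<theta> i t * \<rho> i (zeta (n i) (k i) (?x i t) (?r i t)) * zeta (n i) (k i) (?x i t) (?r i t))
      (at t within {0..})" if t: "0 \<le> t" "t \<le> T" for i t
    using comp[of "\<lambda>s. fst (snd (snd s)) $ i", OF _ t] by (simp add: bl field_def case_prod_beta)
  have d4: "(?\<theta> i has_vector_derivative \<rho> i (zeta (n i) (k i) (?x i t) (?r i t)) * (zeta (n i) (k i) (?x i t) (?r i t))\<^sup>2)
      (at t within {0..})" if t: "0 \<le> t" "t \<le> T" for i t
    using comp[of "\<lambda>s. fst (snd (snd (snd s))) $ i", OF _ t] by (simp add: bl field_def case_prod_beta)
  have d5: "(?r i has_vector_derivative ref_field f' \<beta> (\<chi> j. ?r j t) (\<chi> j. ?v j t) $ i) (at t within {0..})"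
    if t: "0 \<le> t" "t \<le> T" for i t
    using comp[of "\<lambda>s. fst (snd (snd (snd (snd s)))) $ i", OF _ t] by (simp add: bl field_def case_prod_beta)
  have d6: "(?v i has_vector_derivative (\<beta> *\<^sub>R laplacian a (\<chi> j. ?r j t)) $ i) (at t within {0..})"
    if t: "0 \<le> t" "t \<le> T" for i t
    using comp[of "\<lambda>s. snd (snd (snd (snd (snd s)))) $ i", OF _ t] by (simp add: bl field_def case_prod_beta)
  have sz: "?z i t \<in> Rspace (m i)" if t: "0 \<le> t" "t \<le> T" for i t
    by (rule stays_in_Rspace[OF m _ d1 _ t]) (use init space in \<open>simp_all add: h_space Rproj_in\<close>)
  have sx: "?x i t \<in> Rspace (n i)" if t: "0 \<le> t" "t \<le> T" for i t
  proof (rule stays_in_Rspace[OF n(1) _ d2 _ t])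
    show "?x i 0 \<in> Rspace (n i)" using init space by simp
    show "chain_A (n i) (?x i u) + c *\<^sub>R unit_vec (n i) \<in> Rspace (n i)" for u c
      by (intro subspace_add[OF subspace_Rspace] subspace_scale[OF subspace_Rspace] chain_A_in_Rspace unit_vec_in_Rspace n) simp
  qed
  show "solution T ?z ?x ?\<eta> ?\<theta> ?r ?v"
    unfolding solution_def has_real_derivative_iff_has_vector_derivative
  proof (intro allI impI conjI d2 d3 d4 d5 d6 sz sx)
    fix i t assume t: "0 \<le> t" "t \<le> T"
    show "(?z i has_vector_derivative h i (?z i t) (?x i t \<bullet> unit_vec 1) w) (at t within {0..})"
      using d1[OF t, of i] Rproj_id[OF m sz[OF t, of i]] by simp
  qed
qed

lemma existence:
  assumes space: "\<And>i. zi i \<in> Rspace (m i)" "\<And>i. xi i \<in> Rspace (n i)"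
  shows "\<exists>z x \<eta> \<theta> r v. (\<forall>T. solution T z x \<eta> \<theta> r v) \<and> starts zi xi \<eta>i \<theta>i ri vi z x \<eta> \<theta> r v"
proof -
  obtain Bd Wf where sb: "state_bounded zi xi \<eta>i \<theta>i ri vi Bd Wf" using ex_state_bounded by blast
  note ap = sb[unfolded state_bounded_def, rule_format]
  let ?s0 = "(\<chi> i. zi i, \<chi> i. xi i, \<chi> i. \<eta>i i, \<chi> i. \<theta>i i, \<chi> i. ri i, \<chi> i. vi i)"
  \<comment> \<open>Bounds each of the six vectors, hence the state by 6 N.\<close>
  define N where "N = real CARD('n) * Bd"
  have vec: "norm y \<le> N" if "\<And>i. norm (y $ i) \<le> Bd" for y :: "'b::real_normed_vector ^ 'n"
    using norm_vec_le_sum[of y] sum_bounded_above[of UNIV "\<lambda>i. norm (y $ i)" Bd] that by (simp add: N_def)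
  have "\<exists>s. s 0 = ?s0 \<and> (\<forall>t\<ge>0. (s has_vector_derivative field (s t)) (at t within {0..}))"
  proof (rule ode_solution_of_apriori_bound[OF field_loc_lip])
    fix T s t
    assume init: "s 0 = ?s0" and der: "\<And>t. 0 \<le> t \<Longrightarrow> t \<le> T \<Longrightarrow> (s has_vector_derivative field (s t)) (at t within {0..})"
      and t: "0 \<le> t" "t \<le> T"
    note b = ap[OF field_solution(1)[OF init space der] field_solution(2)[OF init space der] t]
    obtain z x \<eta> \<theta> r v where st: "s t = (z, x, \<eta>, \<theta>, r, v)" by (cases "s t") auto
    have "norm z \<le> N" "norm x \<le> N" "norm \<eta> \<le> N" "norm \<theta> \<le> N" "norm r \<le> N" "norm v \<le> N"
      by (rule vec; use b in \<open>simp add: st\<close>)+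
    moreover have "norm (s t) \<le> norm z + (norm x + (norm \<eta> + (norm \<theta> + (norm r + norm v))))"
      unfolding st using norm_Pair_le by (meson add_left_mono order_trans)
    ultimately show "norm (s t) \<le> 6 * N" by linarith
  qed
  then obtain s where s: "s 0 = ?s0" "\<And>t. 0 \<le> t \<Longrightarrow> (s has_vector_derivative field (s t)) (at t within {0..})" by blast
  show ?thesis
    using field_solution[OF s(1) space s(2)] by blast
qed

text \<open>Boundedness of the whole state bounds the vector field along it, hence the speed of the
  output. This provides the Lipschitz condition of \<open>tendsto_0_of_decrease\<close>.\<close>

lemma bounded_and_convergent:
  assumes sol: "\<And>T. solution T z x \<eta> \<theta> r v" and st: "starts zi xi \<eta>i \<theta>i ri vi z x \<eta> \<theta> r v"
  shows "bounded (z i ` {0..}) \<and> bounded (x i ` {0..}) \<and> bounded (\<eta> i ` {0..}) \<and> bounded (\<theta> i ` {0..})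
      \<and> bounded (r i ` {0..}) \<and> bounded (v i ` {0..})"
    and "((\<lambda>t. x i t \<bullet> unit_vec 1 - ystar) \<longlongrightarrow> 0) at_top"
proof -
  obtain Bd Wf where sb: "state_bounded zi xi \<eta>i \<theta>i ri vi Bd Wf" using ex_state_bounded by blast
  from sb[unfolded state_bounded_def, rule_format, OF sol st _ order_refl] have b: "norm (z i t) \<le> Bd" "norm (x i t) \<le> Bd" "\<bar>\<eta> i t\<bar> \<le> Bd" "\<bar>\<theta> i t\<bar> \<le> Bd"
      "\<bar>r i t\<bar> \<le> Bd" "\<bar>v i t\<bar> \<le> Bd" "- Bd \<le> Wf i z x \<eta> \<theta> r v t"
    and W: "\<exists>d \<le> - (x i t \<bullet> unit_vec 1 - ystar)\<^sup>2. (Wf i z x \<eta> \<theta> r v has_real_derivative d) (at t within {0..})"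
    if "0 \<le> t" for t i
    using that by blast+
  show "bounded (z i ` {0..}) \<and> bounded (x i ` {0..}) \<and> bounded (\<eta> i ` {0..}) \<and> bounded (\<theta> i ` {0..})
      \<and> bounded (r i ` {0..}) \<and> bounded (v i ` {0..})"
    unfolding bounded_iff using b(1-6) by (intro conjI exI[of _ Bd]) auto
  define N where "N = real CARD('n) * Bd"
  have vec: "norm y \<le> N" if "\<And>i. norm (y $ i) \<le> Bd" for y :: "'b::real_normed_vector ^ 'n"
    using norm_vec_le_sum[of y] sum_bounded_above[of UNIV "\<lambda>i. norm (y $ i)" Bd] that by (simp add: N_def)
  define s where "s t = (\<chi> i. z i t, \<chi> i. x i t, \<chi> i. \<eta> i t, \<chi> i. \<theta> i t, \<chi> i. r i t, \<chi> i. v i t)" for t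
  have s_le: "norm (s t) \<le> 6 * N" if t: "0 \<le> t" for t
  proof -
    have "norm (\<chi> i. z i t) \<le> N" "norm (\<chi> i. x i t) \<le> N" "norm (\<chi> i. \<eta> i t) \<le> N" "norm (\<chi> i. \<theta> i t) \<le> N"
      "norm (\<chi> i. r i t) \<le> N" "norm (\<chi> i. v i t) \<le> N"
      by (rule vec; use b[OF t] in simp)+
    moreover have "norm (s t) \<le> norm (\<chi> i. z i t) + (norm (\<chi> i. x i t) + (norm (\<chi> i. \<eta> i t) + (norm (\<chi> i. \<theta> i t)
        + (norm (\<chi> i. r i t) + norm (\<chi> i. v i t)))))"
      unfolding s_def using norm_Pair_le by (meson add_left_mono order_trans)
    ultimately show ?thesis by linarith
  qed
  obtain K where K: "\<And>p. norm p \<le> 6 * N \<Longrightarrow> norm (field p) \<le> K" using loc_lip_bounded[OF field_loc_lip] by blast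
  define x' where "x' t = fst (snd (field (s t))) $ i" for t
  have x'_le: "norm (x' t) \<le> K" if t: "0 \<le> t" for t
  proof -
    have "norm (x' t) \<le> norm (fst (snd (field (s t))))" unfolding x'_def by (rule Finite_Cartesian_Product.norm_nth_le)
    also have "\<dots> \<le> norm (snd (field (s t)))" using norm_fst_le[of "fst (snd (field (s t)))" "snd (snd (field (s t)))"] by simp
    also have "\<dots> \<le> norm (field (s t))" using norm_snd_le[of "snd (field (s t))" "fst (field (s t))"] by simp
    finally show ?thesis using K[OF s_le[OF t]] by linarith
  qed
  have dx: "(x i has_vector_derivative x' t) (at t within {0..})" if t: "0 \<le> t" for t
    using sol[of t, unfolded solution_def, rule_format, OF t order_refl, of i] by (simp add: x'_def field_def s_def)
  define \<phi> where "\<phi> t = x i t \<bullet> unit_vec 1 - ystar" for t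
  have d\<phi>: "(\<phi> has_field_derivative x' t \<bullet> unit_vec 1) (at t within {0..})" if t: "0 \<le> t" for t
  proof -
    have "((\<lambda>t. x i t \<bullet> unit_vec 1 - ystar) has_vector_derivative x' t \<bullet> unit_vec 1 - 0) (at t within {0..})"
      by (intro has_vector_derivative_diff has_vector_derivative_const
          bounded_linear.has_vector_derivative[OF bounded_linear_inner_left dx[OF t]])
    then show ?thesis unfolding \<phi>_def[abs_def] has_real_derivative_iff_has_vector_derivative by simp
  qed
  have u1: "norm (unit_vec 1 :: 'x) = 1" by (rule norm_unit_vec) (simp add: Suc_le_eq)
  have lip: "\<bar>\<phi> t - \<phi> u\<bar> \<le> K * (t - u)" if "0 \<le> u" "u \<le> t" for u t
  proof -
    have "norm (\<phi> t - \<phi> u) \<le> K * norm (t - u)"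
    proof (rule field_differentiable_bound[of "{0..}" \<phi> "\<lambda>t. x' t \<bullet> unit_vec 1"])
      show "norm (x' a \<bullet> unit_vec 1) \<le> K" if "a \<in> {0..}" for a
        using Cauchy_Schwarz_ineq2[of "x' a" "unit_vec 1"] x'_le[of a] that u1 by simp
    qed (use d\<phi> that in auto)
    then show ?thesis using that by simp
  qed
  have "\<forall>t. \<exists>d. 0 \<le> t \<longrightarrow> d \<le> - (\<phi> t)\<^sup>2 \<and> (Wf i z x \<eta> \<theta> r v has_real_derivative d) (at t within {0..})"
    using W[of _ i] unfolding \<phi>_def by blast
  from choice[OF this] obtain W' where
    "\<And>t. 0 \<le> t \<Longrightarrow> W' t \<le> - (\<phi> t)\<^sup>2 \<and> (Wf i z x \<eta> \<theta> r v has_real_derivative W' t) (at t within {0..})" by blast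
  then have "(\<phi> \<longlongrightarrow> 0) at_top"
    by (intro tendsto_0_of_decrease[where W = "Wf i z x \<eta> \<theta> r v" and W' = W' and B = "- Bd" and K = K])
      (use b(7) lip in auto)
  then show "((\<lambda>t. x i t \<bullet> unit_vec 1 - ystar) \<longlongrightarrow> 0) at_top" unfolding \<phi>_def .
qed

end

theorem theorem1:
  fixes m n :: "'n::finite \<Rightarrow> nat"
    and h :: "'n \<Rightarrow> 'z::euclidean_space \<Rightarrow> real \<Rightarrow> 'w::euclidean_space \<Rightarrow> 'z"
    and g :: "'n \<Rightarrow> 'z \<Rightarrow> 'x::euclidean_space \<Rightarrow> 'w \<Rightarrow> real"
    and b :: "'n \<Rightarrow> 'w \<Rightarrow> real"
    and f :: "'n \<Rightarrow> real \<Rightarrow> real"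
    and E :: "('n \<times> 'n) set"
    and a :: "'n \<Rightarrow> 'n \<Rightarrow> real"
    and l\<^sub>l l\<^sub>u :: "'n \<Rightarrow> real"
    and zs :: "'n \<Rightarrow> real \<Rightarrow> 'w \<Rightarrow> 'z"
    and \<alpha>lo \<alpha>up \<alpha>d \<gamma>e \<gamma>\<mu> :: "'n \<Rightarrow> real \<Rightarrow> real"
    and k :: "'n \<Rightarrow> nat \<Rightarrow> real"
  assumes dims: "\<And>i. m i \<le> DIM('z)" "\<And>i. 1 \<le> n i" "\<And>i. n i \<le> DIM('x)"
    and h_space: "\<And>i z y w. z \<in> Rspace (m i) \<Longrightarrow> h i z y w \<in> Rspace (m i)"
    and h_C1: "\<And>i. Ck_on 1 UNIV (\<lambda>(z, y, w). h i z y w)"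
    and g_C1: "\<And>i. Ck_on 1 UNIV (\<lambda>(z, x, w). g i z x w)"
    and b_C1: "\<And>i. Ck_on 1 UNIV (b i)"
    and weights: "\<And>i. a i i = 0" "\<And>i j. 0 \<le> a i j" "\<And>i j. 0 < a i j \<longleftrightarrow> (j, i) \<in> E"
    and weight_balanced: "\<And>i. (\<Sum>j\<in>UNIV. a i j) = (\<Sum>j\<in>UNIV. a j i)"
    and strongly_connected: "\<And>i j. (i, j) \<in> E\<^sup>*"
    and f_C2: "\<And>i. Ck_on 2 UNIV (f i)"
    and f_hess: "\<And>i. 0 < l\<^sub>l i" "\<And>i s. l\<^sub>l i \<le> deriv (deriv (f i)) s"
      "\<And>i s. deriv (deriv (f i)) s \<le> l\<^sub>u i"
    and zs_space: "\<And>i s w. zs i s w \<in> Rspace (m i)"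
    and zs_smooth: "\<And>i. smooth_on UNIV (\<lambda>(s, w). zs i s w)"
    and zs_zero: "\<And>i w. zs i 0 w = 0"
    and zs_equilibrium: "\<And>i s w. h i (zs i s w) s w = 0"
    and K_inf: "\<And>i. class_K_inf (\<alpha>lo i)" "\<And>i. class_K_inf (\<alpha>up i)" "\<And>i. class_K_inf (\<alpha>d i)"
    and K_inf_smooth: "\<And>i. smooth_on {0..} (\<alpha>lo i)" "\<And>i. smooth_on {0..} (\<alpha>up i)"
      "\<And>i. smooth_on {0..} (\<alpha>d i)"
    and \<gamma>_smooth: "\<And>i. smooth_on UNIV (\<gamma>e i)" "\<And>i. smooth_on UNIV (\<gamma>\<mu> i)"
    and \<gamma>_gt_1: "\<And>i s. 1 < \<gamma>e i s" "\<And>i s. 1 < \<gamma>\<mu> i s"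
    and \<alpha>d_inv: "\<And>i. Limsup (at_right 0) (\<lambda>s. ereal (the_inv_into {0..} (\<alpha>d i) (s\<^sup>2) / s)) < \<infinity>"
    and k_hurwitz: "\<And>i. hurwitz (zeta_poly (n i) (k i))"
  shows "\<exists>ystar. (\<forall>y. is_arg_min (\<lambda>s. \<Sum>i\<in>UNIV. f i s) (\<lambda>_. True) y \<longleftrightarrow> y = ystar) \<and>
    (\<exists>\<alpha> \<beta> (\<kappa> :: 'n \<Rightarrow> real \<Rightarrow> real) (\<rho> :: 'n \<Rightarrow> real \<Rightarrow> real \<Rightarrow> real)
        (\<tau> :: 'n \<Rightarrow> real \<Rightarrow> real \<Rightarrow> real).
      0 < \<alpha> \<and> 0 < \<beta> \<and>
      (\<forall>i. smooth_on UNIV (\<kappa> i)) \<and>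
      (\<forall>i. smooth_on UNIV (\<lambda>(\<zeta>, r). \<rho> i \<zeta> r)) \<and>
      (\<forall>i. smooth_on UNIV (\<lambda>(\<zeta>, r). \<tau> i \<zeta> r)) \<and>
      (\<forall>W :: 'w set. compact W \<longrightarrow> 0 \<in> W \<longrightarrow>
        (\<forall>i. \<forall>w\<in>W. h i 0 0 w = 0 \<and> g i 0 0 w = 0) \<longrightarrow>
        (\<exists>b0>0. \<forall>i. \<forall>w\<in>W. b0 \<le> b i w) \<longrightarrow>
        (\<forall>i. iss_inverse_dynamics (m i) (h i) (zs i) (\<alpha>lo i) (\<alpha>up i) (\<alpha>d i) (\<gamma>e i) (\<gamma>\<mu> i) W) \<longrightarrow>
        (\<forall>w\<in>W. \<forall>z0 x0 \<eta>0 \<theta>0 r0 v0.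
          (\<forall>i. z0 i \<in> Rspace (m i) \<and> x0 i \<in> Rspace (n i)) \<longrightarrow>
          (let traj = (\<lambda>z x \<eta> \<theta> r v.
                 closed_loop_solution m n h g b f a k \<alpha> \<beta> \<kappa> \<rho> \<tau> w z x \<eta> \<theta> r v \<and>
                 (\<forall>i. z i 0 = z0 i \<and> x i 0 = x0 i \<and> \<eta> i 0 = \<eta>0 i \<and> \<theta> i 0 = \<theta>0 i \<and>
                      r i 0 = r0 i \<and> v i 0 = v0 i))
           in (\<exists>z x \<eta> \<theta> r v. traj z x \<eta> \<theta> r v) \<and>
              (\<forall>z x \<eta> \<theta> r v. traj z x \<eta> \<theta> r v \<longrightarrow>
                (\<forall>i. bounded (z i ` {0..}) \<and> bounded (x i ` {0..}) \<and> bounded (\<eta> i ` {0..}) \<and>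
                     bounded (\<theta> i ` {0..}) \<and> bounded (r i ` {0..}) \<and> bounded (v i ` {0..})) \<and>
                (\<forall>i. ((\<lambda>t. \<bar>chain_C (x i t) - ystar\<bar>) \<longlongrightarrow> 0) at_top))))))"
proof -
  define l where "l = Min (range l\<^sub>l)"
  define u where "u = Max (range l\<^sub>u)"
  have l0: "0 < l" using f_hess(1) by (simp add: l_def)
  have l_le: "l \<le> deriv (deriv (f i)) s" for i s
  proof -
    have "l \<le> l\<^sub>l i" unfolding l_def by (rule Min_le) auto
    then show ?thesis using f_hess(2)[of i s] by linarith
  qed
  have u_ge: "deriv (deriv (f i)) s \<le> u" for i s
  proof -
    have "l\<^sub>u i \<le> u" unfolding u_def by (rule Max_ge) auto
    then show ?thesis using f_hess(3)[of i s] by linarith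
  qed
  note df = deriv_facts_of_hessian[OF f_C2 l_le u_ge l0]
  obtain ystar where ystar: "(\<Sum>i\<in>UNIV. deriv (f i) ystar) = 0"
    and argmin: "\<And>y. is_arg_min (\<lambda>s. \<Sum>i\<in>UNIV. f i s) (\<lambda>_. True) y \<longleftrightarrow> y = ystar"
  proof -
    show thesis
      by (rule strongly_convex_sum_minimizer[where f = f and f' = "\<lambda>i. deriv (f i)", OF df(1) df(4) l0 df(2)]) (fact that)
  qed
  have E: "{(j, i). 0 < a i j} = E" using weights(3) by auto
  interpret G: balanced_graph a
    by unfold_locales (use weights(2) weight_balanced strongly_connected E in auto)
  obtain \<beta> Vr Dr Cr Br where \<beta>: "0 < \<beta>"
    and Vr: "\<And>r v. 0 \<le> Vr r v"
      "\<And>r v. (norm (r - (\<chi> i. ystar)))\<^sup>2 + (norm (G.ref_field (\<lambda>i. deriv (f i)) \<beta> r v))\<^sup>2 \<le> Cr * Vr r v"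
      "\<And>r v. Dr r v \<le> - ((norm (r - (\<chi> i. ystar)))\<^sup>2 + (norm (G.ref_field (\<lambda>i. deriv (f i)) \<beta> r v))\<^sup>2)"
      "\<And>r v t S. (r has_vector_derivative G.ref_field (\<lambda>i. deriv (f i)) \<beta> (r t) (v t)) (at t within S) \<Longrightarrow>
        (v has_vector_derivative \<beta> *\<^sub>R laplacian a (r t)) (at t within S) \<Longrightarrow>
        ((\<lambda>t. Vr (r t) (v t)) has_real_derivative Dr (r t) (v t)) (at t within S)"
      "\<And>r v. norm v \<le> Br * (1 + Vr r v + \<bar>\<Sum>i\<in>UNIV. v $ i\<bar>)"
  proof -
    show thesis
      by (rule G.reference_lyapunov[where f' = "\<lambda>i. deriv (f i)", OF l0 df(2) df(3) ystar]) (fact that)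
  qed
  define P where "P i Q DQ cQ CQ \<rho> \<longleftrightarrow>
      agent (n i) (k i) (g i) (\<alpha>lo i) (\<alpha>up i) (\<alpha>d i) (\<gamma>e i) Q DQ cQ CQ
      \<and> smooth_on UNIV (\<lambda>(\<zeta>::real, r::real). \<rho> \<zeta>) \<and> smooth_on UNIV (\<lambda>(\<zeta>::real, r::real). \<rho> \<zeta> * \<zeta>\<^sup>2)
      \<and> loc_lip \<rho> \<and> (\<forall>s. 1 \<le> \<rho> s)
      \<and> agent_bounded (n i) (m i) (k i) (g i) (\<alpha>lo i) (\<alpha>up i) (\<alpha>d i) (\<gamma>e i) Q DQ cQ CQ \<rho>"
    for i and Q :: "'x \<Rightarrow> real" and DQ cQ CQ and \<rho> :: "real \<Rightarrow> real"
  have "\<forall>i. \<exists>Q DQ cQ CQ \<rho>. P i Q DQ cQ CQ \<rho>"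
  proof
    fix i
    obtain Q :: "'x \<Rightarrow> real" and DQ c C where Q: "0 < c" "0 < C" "\<And>x. 0 \<le> Q x"
      "\<And>x. (Q has_derivative DQ x) (at x)"
      "\<And>x. x \<in> Rspace (n i) \<Longrightarrow> norm x \<le> C * (sqrt (Q x) + \<bar>zlin (n i) (k i) x\<bar>)"
      "\<And>x s. DQ x (chain_A (n i) x + s *\<^sub>R unit_vec (n i)) \<le> - c * Q x + C * (zlin (n i) (k i) x)\<^sup>2"
    proof -
      show thesis by (rule hurwitz_chain_lyapunov[OF dims(2,3) k_hurwitz, of i]) (fact that)
    qed
    have "continuous_on UNIV (\<gamma>e i)" using \<gamma>_smooth(1)[of i] unfolding smooth_on_def by (metis Ck_on.simps(1))
    moreover have "0 \<le> \<gamma>e i s" for s using \<gamma>_gt_1(1)[of i s] by simp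
    ultimately have ag: "agent (n i) (k i) (g i) (\<alpha>lo i) (\<alpha>up i) (\<alpha>d i) (\<gamma>e i) Q DQ c C"
      using dims K_inf Q quadratic_below_of_limsup[OF K_inf(3)[of i] \<alpha>d_inv[of i]] loc_lip_Ck1[OF g_C1[of i]]
      by (intro agent.intro) auto
    from agent.agent_gain[OF ag, where m = "m i"] obtain \<rho> where "P i Q DQ c C \<rho>"
      unfolding P_def using ag by (elim exE) simp
    then show "\<exists>Q DQ cQ CQ \<rho>. P i Q DQ cQ CQ \<rho>" by (intro exI)
  qed
  then obtain Q DQ cQ CQ \<rho> where P: "\<And>i. P i (Q i) (DQ i) (cQ i) (CQ i) (\<rho> i)" by metis
  note P' = P[unfolded P_def]
  show ?thesis
  \<comment> \<open>The design: \<alpha> = 1, \<kappa> = 1, \<beta> from the reference Lyapunov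
    function, \<rho> a function of \<zeta> alone and \<tau> = \<rho> \<zeta>^2.\<close>
  proof (rule exI[of _ ystar], rule conjI[OF allI[OF argmin]], rule exI[of _ "1::real"], rule exI[of _ \<beta>],
      rule exI[of _ "\<lambda>_ _. 1::real"], rule exI[of _ "\<lambda>i \<zeta> _. \<rho> i \<zeta>"],
      rule exI[of _ "\<lambda>i \<zeta> _. \<rho> i \<zeta> * \<zeta>\<^sup>2"], intro conjI allI impI ballI \<beta>)
    show "(0::real) < 1" by simp
    show "smooth_on UNIV (\<lambda>_::real. 1::real)" unfolding smooth_on_def using Ck_on_const by blast
    show "smooth_on UNIV (\<lambda>(\<zeta>::real, _::real). \<rho> i \<zeta>)" for i using P'[of i] by blast
    show "smooth_on UNIV (\<lambda>(\<zeta>::real, _::real). \<rho> i \<zeta> * \<zeta>\<^sup>2)" for i using P'[of i] by blast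
    fix W :: "'w set" and w and z0 :: "'n \<Rightarrow> 'z" and x0 :: "'n \<Rightarrow> 'x" and \<eta>0 \<theta>0 r0 v0 :: "'n \<Rightarrow> real"
    assume "compact W" "0 \<in> W" "\<forall>i. \<forall>w\<in>W. h i 0 0 w = 0 \<and> g i 0 0 w = 0"
      and b0: "\<exists>b0>0. \<forall>i. \<forall>w\<in>W. b0 \<le> b i w"
      and iss: "\<forall>i. iss_inverse_dynamics (m i) (h i) (zs i) (\<alpha>lo i) (\<alpha>up i) (\<alpha>d i) (\<gamma>e i) (\<gamma>\<mu> i) W"
      and w: "w \<in> W" and space: "\<forall>i. z0 i \<in> Rspace (m i) \<and> x0 i \<in> Rspace (n i)"
    have b_pos: "0 < b i w" for i using b0 w by (meson less_le_trans)
    \<comment> \<open>The constant input that keeps agent i at output y*.\<close>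
    define us where "us i = - g i (zs i ystar w) (ystar *\<^sub>R unit_vec 1) w / b i w" for i
    have "\<exists>V \<sigma>. agent_plant (n i) (m i) (k i) (g i) (\<alpha>lo i) (\<alpha>up i) (\<alpha>d i) (\<gamma>e i) (Q i) (DQ i) (cQ i) (CQ i)
        (h i) w (b i w) V \<sigma> (zs i ystar w) ystar (us i)" for i
    proof -
      obtain V \<sigma>e \<sigma>\<mu> where V: "Ck_on 1 UNIV V" "\<sigma>e > 1"
        "\<And>zb. zb \<in> Rspace (m i) \<Longrightarrow> \<alpha>lo i (norm zb) \<le> V zb \<and> V zb \<le> \<alpha>up i (norm zb)"
        "\<And>zb e r \<mu> w. zb \<in> Rspace (m i) \<Longrightarrow> w \<in> W \<Longrightarrow> frechet_derivative V (at zb)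
              (hbar (h i) (zs i) zb e r w - \<mu> *\<^sub>R vector_derivative (\<lambda>s. zs i s w) (at r))
            \<le> - \<alpha>d i (norm zb) + \<sigma>e * \<gamma>e i e * e\<^sup>2 + \<sigma>\<mu> * \<gamma>\<mu> i r * \<mu>\<^sup>2"
        using iss[rule_format, of i] unfolding iss_inverse_dynamics_def by blast
      \<comment> \<open>At r = y* and \<mu> = 0 the error field \<open>hbar\<close> is h itself,
        since \<open>zs\<close> consists of equilibria.\<close>
      have "frechet_derivative V (at zb) (h i (zb + zs i ystar w) (e + ystar) w)
          \<le> - \<alpha>d i (norm zb) + \<sigma>e * \<gamma>e i e * e\<^sup>2" if "zb \<in> Rspace (m i)" for zb e
        using V(4)[OF that w, of e ystar 0] by (simp add: hbar_def zs_equilibrium)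
      moreover have "g i (zs i ystar w) (ystar *\<^sub>R unit_vec 1) w + b i w * us i = 0"
        using b_pos[of i] by (simp add: us_def)
      ultimately have "agent_plant (n i) (m i) (k i) (g i) (\<alpha>lo i) (\<alpha>up i) (\<alpha>d i) (\<gamma>e i) (Q i) (DQ i) (cQ i) (CQ i)
        (h i) w (b i w) V \<sigma>e (zs i ystar w) ystar (us i)"
        using P'[of i] V(1,2,3) b_pos zs_space by (intro agent_plant.intro agent_plant_axioms.intro) auto
      then show ?thesis by blast
    qed
    then obtain V \<sigma> where plant: "\<And>i. agent_plant (n i) (m i) (k i) (g i) (\<alpha>lo i) (\<alpha>up i) (\<alpha>d i) (\<gamma>e i)
        (Q i) (DQ i) (cQ i) (CQ i) (h i) w (b i w) (V i) (\<sigma> i) (zs i ystar w) ystar (us i)" by metis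
    have h_lip: "loc_lip (\<lambda>(z, y). h i z y w)" for i
    proof -
      have "loc_lip (\<lambda>p. (\<lambda>(z, y, w). h i z y w) (fst p, snd p, w))"
        by (intro loc_lip_compose[OF loc_lip_Ck1[OF h_C1]] loc_lip_Pair loc_lip_const
            loc_lip_linear bounded_linear_fst bounded_linear_snd)
      then show ?thesis by (simp add: case_prod_unfold)
    qed
    have f'_lip: "loc_lip (deriv (f i))" for i
      unfolding loc_lip_def using df(3)[of i] by (auto simp: real_norm_def)
    interpret N: network a m n k g \<alpha>lo \<alpha>up \<alpha>d \<gamma>e Q DQ cQ CQ h w "\<lambda>i. b i w" V \<sigma> "\<lambda>i. zs i ystar w" ystar us
      \<rho> "\<lambda>i. deriv (f i)" \<beta> Vr Dr Cr Br
      by (intro network.intro network_axioms.intro G.balanced_graph_axioms plant dims(1) h_space h_lip f'_lip Vr)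
        (use P' in auto)
    \<comment> \<open>A solution on the half-line is one on every [0, T], since derivatives are
      taken within {0..} in both notions.\<close>
    have cl: "closed_loop_solution m n h g b f a k 1 \<beta> (\<lambda>_ _. 1) (\<lambda>i \<zeta> _. \<rho> i \<zeta>) (\<lambda>i \<zeta> _. \<rho> i \<zeta> * \<zeta>\<^sup>2) w z x \<eta> \<theta> r v
        \<longleftrightarrow> (\<forall>T. N.solution T z x \<eta> \<theta> r v)" for z x \<eta> \<theta> r v
      unfolding closed_loop_solution_def N.solution_def
      by (auto simp: Let_def chain_C_def chain_B_def G.ref_field_def laplacian_def
          has_real_derivative_iff_has_vector_derivative)
    have st: "(\<forall>i. z i 0 = z0 i \<and> x i 0 = x0 i \<and> \<eta> i 0 = \<eta>0 i \<and> \<theta> i 0 = \<theta>0 i \<and> r i 0 = r0 i \<and> v i 0 = v0 i)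
        \<longleftrightarrow> N.starts z0 x0 \<eta>0 \<theta>0 r0 v0 z x \<eta> \<theta> r v" for z x \<eta> \<theta> r v
      unfolding N.starts_def by blast
    show "let traj = (\<lambda>z x \<eta> \<theta> r v.
                 closed_loop_solution m n h g b f a k 1 \<beta> (\<lambda>_ _. 1) (\<lambda>i \<zeta> _. \<rho> i \<zeta>) (\<lambda>i \<zeta> _. \<rho> i \<zeta> * \<zeta>\<^sup>2) w z x \<eta> \<theta> r v \<and>
                 (\<forall>i. z i 0 = z0 i \<and> x i 0 = x0 i \<and> \<eta> i 0 = \<eta>0 i \<and> \<theta> i 0 = \<theta>0 i \<and>
                      r i 0 = r0 i \<and> v i 0 = v0 i))
           in (\<exists>z x \<eta> \<theta> r v. traj z x \<eta> \<theta> r v) \<and>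
              (\<forall>z x \<eta> \<theta> r v. traj z x \<eta> \<theta> r v \<longrightarrow>
                (\<forall>i. bounded (z i ` {0..}) \<and> bounded (x i ` {0..}) \<and> bounded (\<eta> i ` {0..}) \<and>
                     bounded (\<theta> i ` {0..}) \<and> bounded (r i ` {0..}) \<and> bounded (v i ` {0..})) \<and>
                (\<forall>i. ((\<lambda>t. \<bar>chain_C (x i t) - ystar\<bar>) \<longlongrightarrow> 0) at_top))"
      unfolding Let_def cl st chain_C_def
    proof (intro conjI allI impI)
      show "\<exists>z x \<eta> \<theta> r v. (\<forall>T. N.solution T z x \<eta> \<theta> r v) \<and> N.starts z0 x0 \<eta>0 \<theta>0 r0 v0 z x \<eta> \<theta> r v"
        by (rule N.existence) (use space in auto)
      fix z x \<eta> \<theta> r v i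
      assume "(\<forall>T. N.solution T z x \<eta> \<theta> r v) \<and> N.starts z0 x0 \<eta>0 \<theta>0 r0 v0 z x \<eta> \<theta> r v"
      then have sol: "\<And>T. N.solution T z x \<eta> \<theta> r v" and ini: "N.starts z0 x0 \<eta>0 \<theta>0 r0 v0 z x \<eta> \<theta> r v"
        by blast+
      note bd = N.bounded_and_convergent(1)[OF sol ini, of i]
      show "bounded (z i ` {0..})" "bounded (x i ` {0..})" "bounded (\<eta> i ` {0..})" "bounded (\<theta> i ` {0..})"
        "bounded (r i ` {0..})" "bounded (v i ` {0..})" using bd by blast+
      show "((\<lambda>t. \<bar>x i t \<bullet> unit_vec 1 - ystar\<bar>) \<longlongrightarrow> 0) at_top"
        by (rule tendsto_rabs_zero[OF N.bounded_and_convergent(2)[OF sol ini, of i]])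
    qed
  qed
qed

end
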